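(* Let $\omega:\mathbb T\to\mathbb R$ be a non-constant real-valued function with $\omega\in L^1(\mathbb T)$ and $\operatorname{ess\,inf}\omega>-\infty$, and let $T=T(\omega)$ be the self-adjoint Toeplitz operator with symbol $\omega$. Then $T$ is absolutely continuous, i.e. for every $f\in\mathbb H^2$ the measure $(E(\cdot)f,f)$, where $E$ is the spectral measure of $T$, is absolutely continuous with respect to Lebesgue measure on $\mathbb R$.
   Context: $\mathbb D$ is the open unit disk, $\mathbb T$ the unit circle with normalized Lebesgue measure $d\mathbf m(\zeta)=(2\pi i\zeta)^{-1}d\zeta$. $\mathbb H^2\subset L^2(\mathbb T)$ is the Hardy space with inner product $(f,g)=\int_{\mathbb T}f\overline g\,d\mathbf m$. Definition of $T(\omega)$: let $\gamma_1=\operatorname{ess\,inf}\omega$, $H(z)=\frac{1+z}{1-z}$, and for $\lambda<\gamma_1$ let $F_\lambda(z)=\exp\big(\frac12\int_{\mathbb T}\ln(\omega(\zeta)-\lambda)H(z\overline\zeta)\,d\mathbf m(\zeta)\big)$, $z\in\mathbb D$; this is an outer function in $\mathbb H^2$ with $|F_\lambda(\zeta)|^2=\omega(\zeta)-\lambda$ a.e. on $\mathbb T$. The form $T[f,g]=\int_{\mathbb T}\omega f\overline g\,d\mathbf m$ on the domain $D[T]=\{f\in\mathbb H^2: F_\lambda f\in\mathbb H^2\}$ (independent of $\lambda<\gamma_1$) is densely defined, closed and bounded below by $\gamma_1$; $T=T(\omega)$ is the associated self-adjoint operator in $\mathbb H^2$, i.e. $(Tf,g)=T[f,g]$ for $f\in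 D(T)$, $g\in D[T]$. (If $\omega$ is bounded, $Tf=\mathbb P(\omega f)$ with $\mathbb P$ the orthogonal projection of $L^2(\mathbb T)$ onto $\mathbb H^2$.) *)

theory Defs
  imports "HOL-Probability.Probability"
begin

section \<open>The spaces $L^2$ and $H^2$ on the unit circle\<close>

text \<open>Elements of $L^2$ are represented by measurable functions; equality of
  elements is equality almost everywhere.\<close>

definition L2 :: "'a measure \<Rightarrow> ('a \<Rightarrow> complex) set" where
  "L2 M = {f \<in> borel_measurable M. integrable M (\<lambda>x. (cmod (f x))\<^sup>2)}"

definition L2_inner :: "'a measure \<Rightarrow> ('a \<Rightarrow> complex) \<Rightarrow> ('a \<Rightarrow> complex) \<Rightarrow> complex" where
  "L2_inner M f g = (\<integral>x. f x * cnj (g x) \<partial>M)"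

definition L2_norm :: "'a measure \<Rightarrow> ('a \<Rightarrow> complex) \<Rightarrow> real" where
  "L2_norm M f = sqrt (\<integral>x. (cmod (f x))\<^sup>2 \<partial>M)"

text \<open>Normalized Lebesgue measure on the unit circle (\<^const>\<open>uniform_measure\<close> has
  total mass 1).\<close>

definition circle :: "complex measure" where
  "circle = distr (uniform_measure lborel {0..<2 * pi}) (restrict_space borel (sphere 0 1)) cis"

text \<open>The Hardy space as a subspace of $L^2$: the Fourier coefficients of index $-n$,
  $n \geq 1$, vanish.\<close>

definition hardy2 :: "(complex \<Rightarrow> complex) set" where
  "hardy2 = {f \<in> L2 circle. \<forall>n\<ge>1. (\<integral>\<zeta>. f \<zeta> * \<zeta> ^ n \<partial>circle) = 0}"

text \<open>The analytic function in the unit disk with boundary values \<open>f\<close>, for \<open>f\<close> in \<^const>\<open>hardy2\<close>.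
  This is the Cauchy integral, since $\zeta / (\zeta - z) = 1 / (1 - z \overline\zeta)$ on the
  circle.\<close>

definition disk_ext :: "(complex \<Rightarrow> complex) \<Rightarrow> complex \<Rightarrow> complex" where
  "disk_ext f z = (\<integral>\<zeta>. f \<zeta> / (1 - z * cnj \<zeta>) \<partial>circle)"

section \<open>Toeplitz operators with semibounded symbol\<close>

definition ess_inf :: "'a measure \<Rightarrow> ('a \<Rightarrow> real) \<Rightarrow> ereal" where
  "ess_inf M w = - esssup M (\<lambda>x. - ereal (w x))"

definition herglotz :: "complex \<Rightarrow> complex" where
  "herglotz z = (1 + z) / (1 - z)"

definition outer_fun :: "(complex \<Rightarrow> real) \<Rightarrow> real \<Rightarrow> complex \<Rightarrow> complex" where
  "outer_fun \<omega> lam z =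
     exp (1 / 2 * (\<integral>\<zeta>. complex_of_real (ln (\<omega> \<zeta> - lam)) * herglotz (z * cnj \<zeta>) \<partial>circle))"

text \<open>The condition $F_\lambda f \in H^2$ is read in the unit disk: the analytic function
  $z \mapsto F_\lambda(z) f(z)$ is the extension of some element of \<^const>\<open>hardy2\<close>. It does not
  depend on the choice of $\lambda$ below the essential infimum.\<close>

definition toeplitz_form_domain :: "(complex \<Rightarrow> real) \<Rightarrow> (complex \<Rightarrow> complex) set" where
  "toeplitz_form_domain \<omega> =
     {f \<in> hardy2. \<exists>lam. ereal lam < ess_inf circle \<omega> \<and>
        (\<exists>g\<in>hardy2. \<forall>z\<in>ball 0 1. outer_fun \<omega> lam z * disk_ext f z = disk_ext g z)}"

definition toeplitz_form ::
    "(complex \<Rightarrow> real) \<Rightarrow> (complex \<Rightarrow> complex) \<Rightarrow> (complex \<Rightarrow> complex) \<Rightarrow> complex" where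
  "toeplitz_form \<omega> f g = (\<integral>\<zeta>. complex_of_real (\<omega> \<zeta>) * f \<zeta> * cnj (g \<zeta>) \<partial>circle)"

text \<open>The graph of the operator associated with the form. As the form domain is dense in
  \<^const>\<open>hardy2\<close>, the second component is determined almost everywhere by the first.\<close>

definition toeplitz ::
    "(complex \<Rightarrow> real) \<Rightarrow> ((complex \<Rightarrow> complex) \<times> (complex \<Rightarrow> complex)) set" where
  "toeplitz \<omega> = {(f, h). f \<in> toeplitz_form_domain \<omega> \<and> h \<in> hardy2 \<and>
     (\<forall>g\<in>toeplitz_form_domain \<omega>. L2_inner circle h g = toeplitz_form \<omega> f g)}"

section \<open>Spectral measures\<close>

text \<open>Projection-valued Borel measures on the real line, acting on a closed subspace \<open>H\<close> of
  \<open>L2 M\<close>: each \<open>E A\<close> is an orthogonal projection in \<open>H\<close>, \<open>E UNIV\<close> is the identity, and \<open>E\<close> is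
  countably additive in the strong operator topology.\<close>

definition projection_valued_measure ::
    "'a measure \<Rightarrow> ('a \<Rightarrow> complex) set \<Rightarrow> (real set \<Rightarrow> ('a \<Rightarrow> complex) \<Rightarrow> ('a \<Rightarrow> complex)) \<Rightarrow> bool"
  where
  "projection_valued_measure M H E \<longleftrightarrow>
     (\<forall>A\<in>sets borel. \<forall>f\<in>H. E A f \<in> H) \<and>
     (\<forall>A\<in>sets borel. \<forall>f\<in>H. \<forall>g\<in>H. \<forall>a b. AE x in M.
        E A (\<lambda>x. a * f x + b * g x) x = a * E A f x + b * E A g x) \<and>
     (\<forall>A\<in>sets borel. \<forall>f\<in>H. AE x in M. E A (E A f) x = E A f x) \<and>
     (\<forall>A\<in>sets borel. \<forall>f\<in>H. \<forall>g\<in>H. L2_inner M (E A f) g = L2_inner M f (E A g)) \<and>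
     (\<forall>f\<in>H. AE x in M. E UNIV f x = f x) \<and>
     (\<forall>A :: nat \<Rightarrow> real set. range A \<subseteq> sets borel \<longrightarrow> disjoint_family A \<longrightarrow>
        (\<forall>f\<in>H. (\<lambda>n. L2_norm M (\<lambda>x. E (\<Union>i. A i) f x - (\<Sum>i<n. E (A i) f x))) \<longlonglongrightarrow> 0))"

text \<open>The scalar measure $A \mapsto (E(A) f, f)$.\<close>

definition scalar_spectral_measure ::
    "'a measure \<Rightarrow> (real set \<Rightarrow> ('a \<Rightarrow> complex) \<Rightarrow> ('a \<Rightarrow> complex)) \<Rightarrow> ('a \<Rightarrow> complex) \<Rightarrow> real measure"
  where
  "scalar_spectral_measure M E f =
     measure_of UNIV (sets borel) (\<lambda>A. ennreal (Re (L2_inner M (E A f) f)))"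

text \<open>\<open>E\<close> is the spectral measure of the self-adjoint operator with graph \<open>T\<close>, that is,
  $T = \int t \, dE(t)$: the domain consists of the \<open>f\<close> with $\int t^2 \, d(E(t)f,f) < \infty$, and
  $(Tf,f) = \int t \, d(E(t)f,f)$ for such \<open>f\<close>. By polarization the quadratic form
  determines \<open>T\<close> on its domain.\<close>

definition is_spectral_measure ::
    "'a measure \<Rightarrow> ('a \<Rightarrow> complex) set \<Rightarrow> (('a \<Rightarrow> complex) \<times> ('a \<Rightarrow> complex)) set \<Rightarrow>
     (real set \<Rightarrow> ('a \<Rightarrow> complex) \<Rightarrow> ('a \<Rightarrow> complex)) \<Rightarrow> bool" where
  "is_spectral_measure M H T E \<longleftrightarrow>
     projection_valued_measure M H E \<and>
     (\<forall>f\<in>H. f \<in> Domain T \<longleftrightarrow> integrable (scalar_spectral_measure M E f) (\<lambda>t. t\<^sup>2)) \<and>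
     (\<forall>(f, h)\<in>T. L2_inner M h f = complex_of_real (\<integral>t. t \<partial>scalar_spectral_measure M E f))"

end

theory Submission
  imports Defs "HOL-Complex_Analysis.Complex_Analysis"
begin

text \<open>
  For $\lambda < \gamma = \mathrm{ess\,inf}\,\omega$ the operator factorizes as
  $T - \lambda = T_{F_\lambda}^* T_{F_\lambda}$, so the resolvent acts explicitly on the Szegoe kernels
  $k_w(z) = 1 / (1 - \overline{w} z)$:
  $((T - \lambda)^{-1} k_w, k_w) = (1 - |w|^2)^{-1} \exp(- \int \ln(\omega - \lambda) P_w)$, where $P_w$ is
  the Poisson kernel. Both sides are analytic in $\lambda$ off $[\gamma, \infty)$. If $\omega$ is not
  constant, then every real $x_0$ has a neighbourhood outside of which \<open>\<omega>\<close> takes values with positive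
  probability, so that Jensen's inequality for the remaining mass $\alpha < 1$ bounds the modulus at
  $x + iy$ by a multiple of $1 + \int |\omega - x|^{-\alpha} P_w$, which is integrable in \<open>x\<close> near
  $x_0$ and does not depend on \<open>y\<close>. By Stieltjes inversion the spectral measure of $k_w$ is
  absolutely continuous; since the $k_w$ are total, so are all the others.
\<close>

section \<open>Normalized measure and Poisson kernel on the circle\<close>

text \<open>\<open>is_spectral_measure\<close> gives only the domain and the quadratic form of T,
  not its resolvent. The resolvent identity is therefore obtained backwards, from the explicit
  vector f with (T - lam) f = k_w: polarization on bounded Borel sets shows that the scalar measure
  of (T - lam) f is (t - lam)^2 times that of f, and dividing by t - lam gives the integral of 1 /
  (t - lam) against the measure of k_w. All of this happens for real lam below gamma, where the
  outer function lives; continuation carries the formula to the upper half-plane. F_lam may be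
  unbounded, but 1 / F_lam is bounded since omega - lam stays away from 0. So boundary values are
  needed for bounded outer functions only, and they come from L^2 and L^1 convergence along
  subsequences instead of pointwise radial limits. A constant symbol drops out at one place: the
  kernel |u|^(-alpha) is locally integrable exactly for alpha < 1. Of Stieltjes inversion only an
  upper bound on open sets is used; outer regularity turns it into a statement about null
  sets.\<close>

lemma space_circle: "space circle = sphere 0 1"
  by (simp add: circle_def space_restrict_space)

lemma sets_circle [measurable_cong]: "sets circle = sets (restrict_space borel (sphere 0 1))"
  by (simp add: circle_def)

lemma norm_circle: "x \<in> space circle \<Longrightarrow> cmod x = 1"
  by (simp add: space_circle)

lemma measurable_circle_ident [measurable]: "(\<lambda>x. x) \<in> borel_measurable circle"
  by (subst measurable_cong_sets[OF sets_circle refl], rule measurable_restrict_space1) simp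

lemma measurable_cnj [measurable]: "cnj \<in> borel_measurable borel"
  by (intro borel_measurable_continuous_onI continuous_intros)

lemma measurable_cis [measurable]: "cis \<in> borel_measurable borel"
  by (auto intro!: borel_measurable_continuous_onI continuous_intros simp: cis_conv_exp)

lemma prob_space_circle: "prob_space circle"
proof -
  interpret prob_space "uniform_measure lborel {0..<2 * pi}"
    by (rule prob_space_uniform_measure) auto
  show ?thesis unfolding circle_def
    by (rule prob_space_distr, rule measurable_restrict_space2) auto
qed

interpretation circle: prob_space circle
  by (rule prob_space_circle)

text \<open>The primitive exp(int) / (in) takes the same value at 0 and 2 pi. Everything else moves
  the integral from the circle to the closed interval, which differs from the half-open one by a
  single point.\<close>

lemma integral_circle_power:
  assumes "n \<ge> 1"
  shows "(\<integral>\<zeta>. \<zeta> ^ n \<partial>circle) = 0"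
proof -
  have m: "(\<lambda>x. x ^ n) \<in> borel_measurable (restrict_space borel (sphere 0 (1::real)) :: complex measure)"
    by (rule measurable_restrict_space1) measurable
  have c: "cis \<in> uniform_measure lborel {0..<2 * pi} \<rightarrow>\<^sub>M restrict_space borel (sphere 0 1)"
    by (rule measurable_restrict_space2) auto
  have u: "uniform_measure lborel {0..<2 * pi} =
      density lborel (\<lambda>t. ennreal (indicator {0..<2 * pi} t / (2 * pi)))"
    unfolding uniform_measure_def
    by (intro density_cong) (auto split: split_indicator simp: divide_ennreal ennreal_1[symmetric] simp del: ennreal_1)
  have d: "((\<lambda>t. exp (\<i> * n * of_real t) / (\<i> * n)) has_vector_derivative exp (\<i> * n * of_real t)) (at t within {0..2*pi})" for t
    by (rule has_vector_derivative_real_field) (use assms in \<open>auto intro!: derivative_eq_intros\<close>)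
  have "(\<integral>\<zeta>. \<zeta> ^ n \<partial>circle) = (\<integral>t. cis t ^ n \<partial>uniform_measure lborel {0..<2 * pi})"
    unfolding circle_def by (rule integral_distr[OF c m])
  also have "\<dots> = (\<integral>t. (indicator {0..<2 * pi} t / (2 * pi)) *\<^sub>R cis t ^ n \<partial>lborel)"
    unfolding u by (rule integral_density) auto
  also have "\<dots> = (\<integral>t. (1 / (2 * pi)) *\<^sub>R (indicator {0..2*pi} t *\<^sub>R exp (\<i> * n * of_real t)) \<partial>lborel)"
  proof (rule integral_cong_AE)
    show "AE t in lborel. (indicator {0..<2 * pi} t / (2 * pi)) *\<^sub>R cis t ^ n =
        (1 / (2 * pi)) *\<^sub>R (indicator {0..2*pi} t *\<^sub>R exp (\<i> * n * of_real t))"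
      using AE_lborel_singleton[of "2*pi"]
      by eventually_elim (auto split: split_indicator simp: cis_conv_exp exp_of_nat_mult[symmetric] mult_ac)
  qed (auto intro!: borel_measurable_scaleR borel_measurable_continuous_onI continuous_intros)
  also have "\<dots> = (1 / (2 * pi)) *\<^sub>R (\<integral>t. indicator {0..2*pi} t *\<^sub>R exp (\<i> * n * of_real t) \<partial>lborel)"
    by (rule integral_scaleR_right)
  also have "(\<integral>t. indicator {0..2*pi} t *\<^sub>R exp (\<i> * n * of_real t) \<partial>lborel) = 
      exp (\<i> * n * of_real (2*pi)) / (\<i> * n) - exp (\<i> * n * of_real 0) / (\<i> * n)"
    by (rule integral_FTC_Icc[OF _ d]) (auto intro!: continuous_intros)
  also have "exp (\<i> * n * of_real (2*pi)) = 1"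
    by (rule exp_eq_1[THEN iffD2]) (auto intro!: exI[of _ "int n"])
  finally show ?thesis by simp
qed

lemma integrable_mult_bounded:
  fixes f g :: "'a \<Rightarrow> complex"
  assumes "integrable M f" "g \<in> borel_measurable M" "AE x in M. cmod (g x) \<le> B"
  shows "integrable M (\<lambda>x. f x * g x)"
proof (rule Bochner_Integration.integrable_bound)
  show "integrable M (\<lambda>x. B * cmod (f x))" using assms by auto
  show "AE x in M. norm (f x * g x) \<le> norm (B * cmod (f x))"
    using assms(3)
  proof eventually_elim
    case (elim x)
    have "cmod (f x) * cmod (g x) \<le> cmod (f x) * \<bar>B\<bar>"
      using elim by (intro mult_left_mono) auto
    then show ?case by (simp add: norm_mult abs_mult mult.commute)
  qed
qed (use assms in measurable)

text \<open>The L^1 norms of the terms are at most |a_n| times that of \<open>f\<close>, hence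
  summable, which justifies termwise integration. With \<open>b n\<close> a power of the variable or
  of its conjugate, this integrates geometric and Taylor series against L^1 functions.\<close>

lemma integral_suminf_bounded:
  fixes f :: "'a \<Rightarrow> complex"
  assumes f: "integrable M f" and b: "\<And>n. b n \<in> borel_measurable M"
    and b1: "\<And>n x. x \<in> space M \<Longrightarrow> cmod (b n x) \<le> 1" and a: "summable (\<lambda>n. cmod (a n))"
  shows "(\<lambda>n. a n * (\<integral>x. f x * b n x \<partial>M)) sums (\<integral>x. f x * (\<Sum>n. a n * b n x) \<partial>M)"
proof -
  have i: "integrable M (\<lambda>x. f x * b n x)" for n
    by (rule integrable_mult_bounded[OF f b AE_I2[OF b1]])
  have le: "cmod (a n * b n x) \<le> cmod (a n)" if "x \<in> space M" for n x
    using b1[OF that, of n] by (simp add: norm_mult mult_left_le)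
  have s: "summable (\<lambda>n. cmod (a n * b n x))" if "x \<in> space M" for x
    using le[OF that] by (intro summable_comparison_test[OF _ a]) auto
  have "(\<lambda>n. (\<integral>x. f x * (a n * b n x) \<partial>M)) sums (\<integral>x. (\<Sum>n. f x * (a n * b n x)) \<partial>M)"
  proof (rule sums_integral)
    show "integrable M (\<lambda>x. f x * (a n * b n x))" for n
      using i[of n] by (simp add: mult.left_commute)
    show "AE x in M. summable (\<lambda>n. norm (f x * (a n * b n x)))"
      by (rule AE_I2) (use s in \<open>simp add: norm_mult[of "f _"] summable_mult\<close>)
    show "summable (\<lambda>n. \<integral>x. norm (f x * (a n * b n x)) \<partial>M)"
    proof (rule summable_comparison_test[OF _ summable_mult2[OF a, of "\<integral>x. norm (f x) \<partial>M"]],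
        intro exI allI impI)
      fix n
      have "(\<integral>x. norm (f x * (a n * b n x)) \<partial>M) \<le> (\<integral>x. cmod (a n) * cmod (f x) \<partial>M)"
      proof (rule integral_mono)
        show "integrable M (\<lambda>x. norm (f x * (a n * b n x)))"
          using i[of n] by (intro integrable_norm) (simp add: mult.left_commute)
        show "norm (f x * (a n * b n x)) \<le> cmod (a n) * cmod (f x)" if "x \<in> space M" for x
          using le[OF that, of n] by (subst norm_mult, subst mult.commute) (rule mult_right_mono, auto)
      qed (use f in auto)
      then show "norm (\<integral>x. norm (f x * (a n * b n x)) \<partial>M) \<le> cmod (a n) * (\<integral>x. norm (f x) \<partial>M)"
        by simp
    qed
  qed
  also have "(\<integral>x. (\<Sum>n. f x * (a n * b n x)) \<partial>M) = (\<integral>x. f x * (\<Sum>n. a n * b n x) \<partial>M)"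
    by (rule Bochner_Integration.integral_cong[OF refl])
      (rule suminf_mult, rule summable_norm_cancel, rule s)
  also have "(\<lambda>n. (\<integral>x. f x * (a n * b n x) \<partial>M)) = (\<lambda>n. a n * (\<integral>x. f x * b n x \<partial>M))"
  proof
    fix n
    have eq: "f x * (a n * b n x) = a n * (f x * b n x)" for x
      by (rule mult.left_commute)
    show "(\<integral>x. f x * (a n * b n x) \<partial>M) = a n * (\<integral>x. f x * b n x \<partial>M)"
      unfolding eq by (rule integral_mult_right_zero)
  qed
  finally show ?thesis .
qed

text \<open>For \<open>\<zeta>\<close> on the circle the denominator equals |zeta - z|^2, so this is
  the usual Poisson kernel, written with the denominator of \<open>disk_ext\<close>.\<close>

definition poisson :: "complex \<Rightarrow> complex \<Rightarrow> real" where
  "poisson z \<zeta> = (1 - (cmod z)\<^sup>2) / (cmod (1 - z * cnj \<zeta>))\<^sup>2"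

definition poisson_int :: "(complex \<Rightarrow> complex) \<Rightarrow> complex \<Rightarrow> complex" where
  "poisson_int f z = (\<integral>\<zeta>. f \<zeta> * poisson z \<zeta> \<partial>circle)"

lemma norm_cauchy_denom:
  assumes "cmod z < 1" "cmod \<zeta> = 1"
  shows "1 - cmod z \<le> cmod (1 - z * cnj \<zeta>)" "1 - z * cnj \<zeta> \<noteq> 0"
proof -
  show 1: "1 - cmod z \<le> cmod (1 - z * cnj \<zeta>)"
    using norm_triangle_ineq2[of 1 "z * cnj \<zeta>"] assms by (simp add: norm_mult)
  show "1 - z * cnj \<zeta> \<noteq> 0" using 1 assms by auto
qed

lemma poisson_nonneg: "cmod z < 1 \<Longrightarrow> 0 \<le> poisson z \<zeta>"
  unfolding poisson_def by (auto simp: abs_square_le_1)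

lemma poisson_pos: "cmod z < 1 \<Longrightarrow> cmod \<zeta> = 1 \<Longrightarrow> 0 < poisson z \<zeta>"
  unfolding poisson_def using norm_cauchy_denom[of z \<zeta>] by (auto simp: abs_square_less_1)

lemma poisson_le:
  assumes "cmod z < 1" "cmod \<zeta> = 1"
  shows "poisson z \<zeta> \<le> 1 / (1 - cmod z)\<^sup>2"
  unfolding poisson_def using norm_cauchy_denom[OF assms] assms
  by (intro frac_le power_mono) auto

text \<open>The Poisson kernel is the Cauchy kernel plus a series in strictly positive powers of
  \<open>\<zeta>\<close>. The second part integrates to 0 against functions whose negative Fourier
  coefficients vanish.\<close>

lemma poisson_eq:
  assumes "cmod z < 1" "cmod \<zeta> = 1"
  shows "of_real (poisson z \<zeta>) = 1 / (1 - z * cnj \<zeta>) + cnj z * \<zeta> / (1 - cnj z * \<zeta>)"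
proof -
  have "1 - z * cnj \<zeta> \<noteq> 0" using norm_cauchy_denom[OF assms] by simp
  moreover from this have "1 - cnj z * \<zeta> \<noteq> 0"
    by (metis complex_cnj_cnj complex_cnj_diff complex_cnj_mult complex_cnj_one complex_cnj_zero)
  moreover have "\<zeta> * cnj \<zeta> = 1" using assms by (simp add: complex_norm_square[symmetric])
  moreover have "of_real (poisson z \<zeta>) = (1 - z * cnj z) / ((1 - z * cnj \<zeta>) * (1 - cnj z * \<zeta>))"
    unfolding poisson_def by (simp only: of_real_divide of_real_diff of_real_power [symmetric]) (simp add: complex_norm_square del: of_real_power)
  ultimately show ?thesis by (simp add: field_simps)
qed

lemma Re_herglotz:
  assumes "cmod z < 1" "cmod \<zeta> = 1"
  shows "Re (herglotz (z * cnj \<zeta>)) = poisson z \<zeta>"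
proof -
  have "cmod z = cmod (z * cnj \<zeta>)" using assms by (simp add: norm_mult)
  moreover have "Re ((1 + q) / (1 - q)) = (1 - (cmod q)\<^sup>2) / (cmod (1 - q))\<^sup>2" for q
    unfolding Re_divide' by (simp add: cmod_power2) (simp add: algebra_simps power2_eq_square)
  ultimately show ?thesis
    unfolding herglotz_def poisson_def by simp
qed

lemma poisson_measurable [measurable]:
  "(\<lambda>\<zeta>. poisson z \<zeta>) \<in> borel_measurable circle"
  unfolding poisson_def by measurable

section \<open>Cauchy integrals and analytic extension to the disk\<close>

lemma integrable_cauchy:
  fixes f :: "complex \<Rightarrow> complex"
  assumes "integrable circle f" "cmod z < 1"
  shows "integrable circle (\<lambda>\<zeta>. f \<zeta> / (1 - z * cnj \<zeta>))"
  using integrable_mult_bounded[OF assms(1), of "\<lambda>\<zeta>. 1 / (1 - z * cnj \<zeta>)" "1 / (1 - cmod z)"] assms(2) norm_cauchy_denom[OF assms(2) norm_circle]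
  by (auto simp: norm_divide divide_le_cancel frac_le)

lemma integrable_poisson:
  fixes f :: "complex \<Rightarrow> complex"
  assumes "integrable circle f" "cmod z < 1"
  shows "integrable circle (\<lambda>\<zeta>. f \<zeta> * poisson z \<zeta>)"
  using integrable_mult_bounded[OF assms(1), of "\<lambda>\<zeta>. poisson z \<zeta>" "1 / (1 - cmod z)\<^sup>2"] assms(2) 
    poisson_le[OF assms(2) norm_circle] poisson_nonneg[OF assms(2)]
  by auto

lemma L2_integrable:
  assumes "f \<in> L2 circle"
  shows "integrable circle f"
proof -
  have m: "f \<in> borel_measurable circle" and i: "integrable circle (\<lambda>x. (cmod (f x))\<^sup>2)"
    using assms by (auto simp: L2_def)
  have n: "(\<lambda>x. cmod (f x)) \<in> borel_measurable circle" using m by measurable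
  show ?thesis
    by (rule integrable_norm_cancel[OF circle.square_integrable_imp_integrable[OF n i] m])
qed

text \<open>Geometric expansion of the kernel. The first series carries the moments that vanish for
  Hardy functions, the second the Fourier coefficients that become the Taylor coefficients of
  \<open>disk_ext\<close>.\<close>

lemma cauchy_series:
  fixes f :: "complex \<Rightarrow> complex"
  assumes "integrable circle f" "cmod z < 1"
  shows "(\<lambda>n. z ^ n * (\<integral>\<zeta>. f \<zeta> * \<zeta> ^ n \<partial>circle)) sums (\<integral>\<zeta>. f \<zeta> / (1 - z * \<zeta>) \<partial>circle)"
    "(\<lambda>n. z ^ n * (\<integral>\<zeta>. f \<zeta> * cnj \<zeta> ^ n \<partial>circle)) sums (\<integral>\<zeta>. f \<zeta> / (1 - z * cnj \<zeta>) \<partial>circle)"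
proof -
  have s: "summable (\<lambda>n. cmod (z ^ n))"
    using assms by (simp add: norm_power summable_geometric)
  have g: "(\<Sum>n. z ^ n * w ^ n) = 1 / (1 - z * w)" if "cmod w = 1" for w
    using that assms(2) suminf_geometric[of "z * w"] by (simp add: power_mult_distrib norm_mult)
  have e: "(\<integral>\<zeta>. f \<zeta> * (\<Sum>n. z ^ n * \<zeta> ^ n) \<partial>circle) = (\<integral>\<zeta>. f \<zeta> / (1 - z * \<zeta>) \<partial>circle)"
    "(\<integral>\<zeta>. f \<zeta> * (\<Sum>n. z ^ n * cnj \<zeta> ^ n) \<partial>circle) = (\<integral>\<zeta>. f \<zeta> / (1 - z * cnj \<zeta>) \<partial>circle)"
    by (rule Bochner_Integration.integral_cong; simp add: g norm_circle)+
  show "(\<lambda>n. z ^ n * (\<integral>\<zeta>. f \<zeta> * \<zeta> ^ n \<partial>circle)) sums (\<integral>\<zeta>. f \<zeta> / (1 - z * \<zeta>) \<partial>circle)"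
    unfolding e(1)[symmetric]
    by (rule integral_suminf_bounded[OF assms(1) _ _ s]) (auto simp: norm_power norm_circle)
  show "(\<lambda>n. z ^ n * (\<integral>\<zeta>. f \<zeta> * cnj \<zeta> ^ n \<partial>circle)) sums (\<integral>\<zeta>. f \<zeta> / (1 - z * cnj \<zeta>) \<partial>circle)"
    unfolding e(2)[symmetric]
    by (rule integral_suminf_bounded[OF assms(1) _ _ s]) (auto simp: norm_power norm_circle)
qed

lemma integral_cauchy_conj_zero:
  fixes f :: "complex \<Rightarrow> complex"
  assumes f: "integrable circle f" "\<forall>n\<ge>1. (\<integral>\<zeta>. f \<zeta> * \<zeta> ^ n \<partial>circle) = 0" and z: "cmod z < 1"
  shows "(\<integral>\<zeta>. f \<zeta> * (z * \<zeta>  / (1 - z * \<zeta>)) \<partial>circle) = 0"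
proof -
  have i: "integrable circle (\<lambda>\<zeta>. f \<zeta> * \<zeta>)"
    by (rule integrable_mult_bounded[OF f(1), of _ 1]) (auto simp: norm_circle)
  \<comment> \<open>Absorbing one factor \<open>\<zeta>\<close> into the function shifts all
    exponents to at least 1, where the moments of \<open>f\<close> vanish.\<close>
  have 0: "(\<integral>\<zeta>. (f \<zeta> * \<zeta>) * \<zeta> ^ n \<partial>circle) = 0" for n
    using f(2)[rule_format, of "Suc n"] by (simp add: mult.assoc)
  from cauchy_series(1)[OF i z] have "(\<lambda>n::nat. 0) sums (\<integral>\<zeta>. f \<zeta> * \<zeta> / (1 - z * \<zeta>) \<partial>circle)"
    unfolding 0 by simp
  then have "(\<integral>\<zeta>. f \<zeta> * \<zeta> / (1 - z * \<zeta>) \<partial>circle) = 0"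
    using sums_unique2 sums_zero by blast
  then have "(\<integral>\<zeta>. z * (f \<zeta> * \<zeta> / (1 - z * \<zeta>)) \<partial>circle) = 0"
    by (simp only: integral_mult_right_zero mult_zero_right)
  then show ?thesis by (simp add: mult.left_commute)
qed

text \<open>By \<open>poisson_eq\<close> the two kernels differ by a part annihilated by
  \<open>f\<close>. This lets real-variable facts on Poisson means apply to analytic
  extensions.\<close>

lemma poisson_int_hardy:
  assumes f: "integrable circle f" "\<forall>n\<ge>1. (\<integral>\<zeta>. f \<zeta> * \<zeta> ^ n \<partial>circle) = 0" and z: "cmod z < 1"
  shows "poisson_int f z = disk_ext f z"
proof -
  have i: "integrable circle (\<lambda>\<zeta>. f \<zeta> * poisson z \<zeta>)" "integrable circle (\<lambda>\<zeta>. f \<zeta> / (1 - z * cnj \<zeta>))"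
    by (intro integrable_poisson integrable_cauchy f z)+
  have e: "f \<zeta> * poisson z \<zeta> - f \<zeta> / (1 - z * cnj \<zeta>) = f \<zeta> * (cnj z * \<zeta> / (1 - cnj z * \<zeta>))" if "\<zeta> \<in> space circle" for \<zeta>
    using poisson_eq[OF z norm_circle[OF that]] by (simp add: algebra_simps)
  have "poisson_int f z - disk_ext f z = (\<integral>\<zeta>. f \<zeta> * poisson z \<zeta> - f \<zeta> / (1 - z * cnj \<zeta>) \<partial>circle)"
    unfolding poisson_int_def disk_ext_def using i by simp
  also have "\<dots> = (\<integral>\<zeta>. f \<zeta> * (cnj z * \<zeta> / (1 - cnj z * \<zeta>)) \<partial>circle)"
    by (rule Bochner_Integration.integral_cong[OF refl e])
  also have "\<dots> = 0" using integral_cauchy_conj_zero[OF f, of "cnj z"] z by simp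
  finally show ?thesis by simp
qed

lemma disk_ext_mult_power:
  assumes f: "integrable circle f" "\<forall>n\<ge>1. (\<integral>\<zeta>. f \<zeta> * \<zeta> ^ n \<partial>circle) = 0" and z: "cmod z < 1"
  shows "disk_ext (\<lambda>\<zeta>. f \<zeta> * \<zeta> ^ m) z = z ^ m * disk_ext f z"
proof (induction m)
  case (Suc m)
  have i: "integrable circle (\<lambda>\<zeta>. f \<zeta> * \<zeta> ^ m)" for m
    by (rule integrable_mult_bounded[OF f(1), of _ 1]) (auto simp: norm_circle norm_power)
  have i2: "integrable circle (\<lambda>\<zeta>. f \<zeta> * \<zeta> ^ m / (1 - z * cnj \<zeta>))" for m
    by (intro integrable_cauchy i z)
  \<comment> \<open>On the circle z = zeta (z conj zeta), so the difference of the numerators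
    contains the denominator as a factor; what remains is a vanishing moment of
    \<open>f\<close>.\<close>
  have e: "f \<zeta> * \<zeta> ^ Suc m / (1 - z * cnj \<zeta>) - z * (f \<zeta> * \<zeta> ^ m / (1 - z * cnj \<zeta>)) = f \<zeta> * \<zeta> ^ Suc m"
    if "\<zeta> \<in> space circle" for \<zeta>
  proof -
    have "\<zeta> * cnj \<zeta> = 1" using norm_circle[OF that] by (simp add: complex_norm_square[symmetric])
    then have zeq: "z = \<zeta> * (z * cnj \<zeta>)" by (simp add: mult.left_commute)
    have "z * (f \<zeta> * \<zeta> ^ m) = \<zeta> * (z * cnj \<zeta>) * (f \<zeta> * \<zeta> ^ m)"
      by (rule arg_cong[OF zeq])
    then have "f \<zeta> * \<zeta> ^ Suc m - z * (f \<zeta> * \<zeta> ^ m) = f \<zeta> * \<zeta> ^ Suc m * (1 - z * cnj \<zeta>)"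
      by (simp only:) (simp add: algebra_simps)
    then have "(f \<zeta> * \<zeta> ^ Suc m - z * (f \<zeta> * \<zeta> ^ m)) / (1 - z * cnj \<zeta>) = f \<zeta> * \<zeta> ^ Suc m"
      using norm_cauchy_denom(2)[OF z norm_circle[OF that]] by (metis nonzero_divide_eq_eq)
    then show ?thesis
      by (simp only: diff_divide_distrib times_divide_eq_right)
  qed
  have "disk_ext (\<lambda>\<zeta>. f \<zeta> * \<zeta> ^ Suc m) z - z * disk_ext (\<lambda>\<zeta>. f \<zeta> * \<zeta> ^ m) z =
     (\<integral>\<zeta>. f \<zeta> * \<zeta> ^ Suc m / (1 - z * cnj \<zeta>) - z * (f \<zeta> * \<zeta> ^ m / (1 - z * cnj \<zeta>)) \<partial>circle)"
    unfolding disk_ext_def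
    by (subst Bochner_Integration.integral_diff[OF i2 integrable_mult_right[OF i2]])
      (simp only: integral_mult_right_zero)
  also have "\<dots> = (\<integral>\<zeta>. f \<zeta> * \<zeta> ^ Suc m \<partial>circle)"
    by (rule Bochner_Integration.integral_cong[OF refl e])
  also have "\<dots> = 0" using f(2)[rule_format, of "Suc m"] by simp
  finally show ?case using Suc by simp
qed simp

lemma disk_ext_1: "cmod z < 1 \<Longrightarrow> disk_ext (\<lambda>_. 1) z = 1"
proof -
  assume z: "cmod z < 1"
  have "(\<integral>\<zeta>. cnj \<zeta> ^ n \<partial>circle) = (if n = 0 then 1 else 0)" for n
    using integral_circle_power[of n] by (auto simp: circle.prob_space simp flip: complex_cnj_power)
  then have "(\<lambda>n. z ^ n * (if n = 0 then 1 else 0)) sums disk_ext (\<lambda>_. 1) z"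
    using cauchy_series(2)[of "\<lambda>_. 1" z] z by (simp add: disk_ext_def)
  moreover have "(\<lambda>n. z ^ n * (if n = 0 then 1 else 0)) sums 1"
    using sums_If_finite[of "\<lambda>n. n = 0" "\<lambda>_. 1::complex"] by (simp add: if_distrib cong: if_cong)
  ultimately show ?thesis using sums_unique2 by blast
qed

text \<open>A power of the variable is its own harmonic extension. The case m = 0 gives the total
  mass of the kernel, m = 1 its mean.\<close>

lemma poisson_int_power:
  assumes "cmod z < 1"
  shows "poisson_int (\<lambda>\<zeta>. \<zeta> ^ m) z = z ^ m"
proof -
  have "poisson_int (\<lambda>\<zeta>. \<zeta> ^ m) z = disk_ext (\<lambda>\<zeta>. \<zeta> ^ m) z"
  proof (intro poisson_int_hardy assms allI impI)
    show "integrable circle (\<lambda>\<zeta>. \<zeta> ^ m)"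
      by (rule circle.integrable_const_bound[of _ 1]) (auto simp: norm_power norm_circle)
    fix n :: nat assume "n \<ge> 1"
    then show "(\<integral>\<zeta>. \<zeta> ^ m * \<zeta> ^ n \<partial>circle) = 0"
      using integral_circle_power[of "m + n"] by (simp add: power_add)
  qed
  also have "\<dots> = z ^ m" using disk_ext_mult_power[of "\<lambda>_. 1" z m] assms integral_circle_power
    by (simp add: disk_ext_1)
  finally show ?thesis .
qed

lemma integral_poisson:
  assumes "cmod z < 1"
  shows "(\<integral>\<zeta>. poisson z \<zeta> \<partial>circle) = 1"
proof -
  have "complex_of_real (\<integral>\<zeta>. poisson z \<zeta> \<partial>circle) = 1"
    using poisson_int_power[OF assms, of 0] by (simp add: poisson_int_def)
  then show ?thesis by (simp only: of_real_eq_1_iff)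
qed

section \<open>Radial convergence in $L^1$\<close>

lemma measurable_circle_borel: "f \<in> borel_measurable borel \<Longrightarrow> f \<in> borel_measurable circle"
  by (rule measurable_compose[OF measurable_circle_ident])

text \<open>Mean convergence of the Poisson integrals, packaged with integrability as a predicate so
  that it can be carried from Lipschitz functions to indicators of closed sets, of Borel sets, and
  to all integrable functions.\<close>

definition radial_L1 :: "(complex \<Rightarrow> complex) \<Rightarrow> bool" where
  "radial_L1 f \<longleftrightarrow> integrable circle f \<and>
     ((\<lambda>r. \<integral>\<eta>. cmod (poisson_int f (of_real r * \<eta>) - f \<eta>) \<partial>circle) \<longlongrightarrow> 0) (at_left 1)"

lemma poisson_sym:
  assumes "cmod \<eta> = 1" "cmod \<zeta> = 1"
  shows "poisson (of_real r * \<eta>) \<zeta> = poisson (of_real r * \<zeta>) \<eta>"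
proof -
  have "cmod (1 - of_real r * \<eta> * cnj \<zeta>) = cmod (cnj (1 - of_real r * \<eta> * cnj \<zeta>))"
    by (rule complex_mod_cnj[symmetric])
  also have "cnj (1 - of_real r * \<eta> * cnj \<zeta>) = 1 - of_real r * \<zeta> * cnj \<eta>" by simp
  finally show ?thesis using assms by (simp add: poisson_def norm_mult)
qed

lemma poisson_int_measurable:
  assumes [measurable]: "f \<in> borel_measurable circle"
  shows "(\<lambda>\<eta>. poisson_int f (of_real r * \<eta>)) \<in> borel_measurable circle"
  unfolding poisson_int_def
  by (rule circle.borel_measurable_lebesgue_integral) (unfold poisson_def, measurable)

lemma norm_radial: "0 \<le> r \<Longrightarrow> r < 1 \<Longrightarrow> \<eta> \<in> space circle \<Longrightarrow> cmod (of_real r * \<eta>) < 1"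
  by (simp add: norm_mult norm_circle)

text \<open>Tonelli together with the symmetry \<open>poisson_sym\<close>: integrated over the
  evaluation point, the kernel again has mass 1. This makes the dilated Poisson integral an L^1
  contraction.\<close>

lemma poisson_int_L1:
  assumes f: "integrable circle f" and r: "0 \<le> r" "r < 1"
  shows "integrable circle (\<lambda>\<eta>. poisson_int f (of_real r * \<eta>))"
    "(\<integral>\<eta>. cmod (poisson_int f (of_real r * \<eta>)) \<partial>circle) \<le> (\<integral>\<eta>. cmod (f \<eta>) \<partial>circle)"
proof -
  interpret pair_sigma_finite circle circle ..
  have [measurable]: "f \<in> borel_measurable circle" using f by auto
  have nn: "0 \<le> poisson (of_real r * \<eta>) \<zeta>" if "\<eta> \<in> space circle" for \<eta> \<zeta>
    by (rule poisson_nonneg[OF norm_radial[OF r that]])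
  have m: "(\<lambda>\<eta>. poisson_int f (of_real r * \<eta>)) \<in> borel_measurable circle"
    by (rule poisson_int_measurable) measurable
  \<comment> \<open>A non-integrable function has integral 0 by convention, so the value 1 already
    proves integrability.\<close>
  have i: "integrable circle (\<lambda>\<eta>. poisson (of_real r * \<zeta>) \<eta>)" if "\<zeta> \<in> space circle" for \<zeta>
    using integral_poisson[OF norm_radial[OF r that]] not_integrable_integral_eq[of circle] by fastforce
  have "(\<integral>\<^sup>+\<eta>. ennreal (cmod (poisson_int f (of_real r * \<eta>))) \<partial>circle) \<le>
     (\<integral>\<^sup>+\<eta>. (\<integral>\<^sup>+\<zeta>. ennreal (cmod (f \<zeta>) * poisson (of_real r * \<eta>) \<zeta>) \<partial>circle) \<partial>circle)"
  proof (rule nn_integral_mono)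
    fix \<eta> assume \<eta>: "\<eta> \<in> space circle"
    have "ennreal (cmod (poisson_int f (of_real r * \<eta>))) \<le>
       (\<integral>\<^sup>+\<zeta>. ennreal (cmod (f \<zeta> * poisson (of_real r * \<eta>) \<zeta>)) \<partial>circle)"
      unfolding poisson_int_def
      by (intro integral_norm_bound_ennreal integrable_poisson f norm_radial r \<eta>)
    then show "ennreal (cmod (poisson_int f (of_real r * \<eta>))) \<le>
       (\<integral>\<^sup>+\<zeta>. ennreal (cmod (f \<zeta>) * poisson (of_real r * \<eta>) \<zeta>) \<partial>circle)"
      using nn[OF \<eta>] by (simp add: norm_mult)
  qed
  also have "\<dots> = (\<integral>\<^sup>+\<zeta>. (\<integral>\<^sup>+\<eta>. ennreal (cmod (f \<zeta>) * poisson (of_real r * \<eta>) \<zeta>) \<partial>circle) \<partial>circle)"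
    by (rule Fubini') (unfold poisson_def, measurable)
  also have "\<dots> = (\<integral>\<^sup>+\<zeta>. ennreal (cmod (f \<zeta>)) \<partial>circle)"
  proof (rule nn_integral_cong)
    fix \<zeta> assume z: "\<zeta> \<in> space circle"
    have "(\<integral>\<^sup>+\<eta>. ennreal (cmod (f \<zeta>) * poisson (of_real r * \<eta>) \<zeta>) \<partial>circle) =
      (\<integral>\<^sup>+\<eta>. ennreal (cmod (f \<zeta>)) * ennreal (poisson (of_real r * \<zeta>) \<eta>) \<partial>circle)"
      by (rule nn_integral_cong) (simp add: poisson_sym norm_circle z ennreal_mult nn)
    also have "\<dots> = ennreal (cmod (f \<zeta>)) * (\<integral>\<^sup>+\<eta>. ennreal (poisson (of_real r * \<zeta>) \<eta>) \<partial>circle)"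
      by (rule nn_integral_cmult) measurable
    also have "(\<integral>\<^sup>+\<eta>. ennreal (poisson (of_real r * \<zeta>) \<eta>) \<partial>circle) = 1"
      using nn_integral_eq_integral[OF i[OF z]] nn[OF z] integral_poisson[OF norm_radial[OF r z]] by simp
    finally show "(\<integral>\<^sup>+\<eta>. ennreal (cmod (f \<zeta>) * poisson (of_real r * \<eta>) \<zeta>) \<partial>circle) = ennreal (cmod (f \<zeta>))"
      by simp
  qed
  also have "\<dots> = ennreal (\<integral>\<zeta>. cmod (f \<zeta>) \<partial>circle)"
    using f by (intro nn_integral_eq_integral) auto
  finally have le: "(\<integral>\<^sup>+\<eta>. ennreal (cmod (poisson_int f (of_real r * \<eta>))) \<partial>circle) \<le> ennreal (\<integral>\<zeta>. cmod (f \<zeta>) \<partial>circle)" .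
  show 1: "integrable circle (\<lambda>\<eta>. poisson_int f (of_real r * \<eta>))"
    using le m by (intro integrableI_bounded) (auto simp: le_less_trans)
  show "(\<integral>\<eta>. cmod (poisson_int f (of_real r * \<eta>)) \<partial>circle) \<le> (\<integral>\<eta>. cmod (f \<eta>) \<partial>circle)"
    using le nn_integral_eq_integral[OF integrable_norm[OF 1]] by simp
qed

lemma poisson_int_diff:
  assumes "integrable circle f" "integrable circle g" "cmod z < 1"
  shows "poisson_int (\<lambda>\<zeta>. f \<zeta> - g \<zeta>) z = poisson_int f z - poisson_int g z"
  unfolding poisson_int_def left_diff_distrib
  by (intro Bochner_Integration.integral_diff integrable_poisson assms)

lemma poisson_int_add:
  assumes "integrable circle f" "integrable circle g" "cmod z < 1"
  shows "poisson_int (\<lambda>\<zeta>. f \<zeta> + g \<zeta>) z = poisson_int f z + poisson_int g z"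
  unfolding poisson_int_def distrib_right
  by (intro Bochner_Integration.integral_add integrable_poisson assms)

lemma poisson_int_cmult: "poisson_int (\<lambda>\<zeta>. c * f \<zeta>) z = c * poisson_int f z"
  unfolding poisson_int_def by (simp add: mult.assoc)

lemma eventually_at_left_1: "eventually (\<lambda>r::real. 0 \<le> r \<and> r < 1) (at_left 1)"
  by (rule eventually_at_leftI[of 0]) auto

lemma radial_L1_add:
  assumes "radial_L1 f" "radial_L1 g"
  shows "radial_L1 (\<lambda>x. f x + g x)"
proof -
  have f: "integrable circle f" and g: "integrable circle g" using assms by (auto simp: radial_L1_def)
  let ?d = "\<lambda>f r. \<integral>\<eta>. cmod (poisson_int f (of_real r * \<eta>) - f \<eta>) \<partial>circle"
  have lim: "((\<lambda>r. ?d f r + ?d g r) \<longlongrightarrow> 0) (at_left 1)"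
    using assms tendsto_add[of "?d f" 0 "at_left 1" "?d g" 0] by (simp add: radial_L1_def)
  have "\<forall>\<^sub>F r in at_left 1. ?d (\<lambda>x. f x + g x) r \<le> ?d f r + ?d g r"
    using eventually_at_left_1
  proof eventually_elim
    case (elim r)
    then have r: "0 \<le> r" "r < 1" by auto
    have i: "integrable circle (\<lambda>\<eta>. poisson_int f (of_real r * \<eta>) - f \<eta>)" "integrable circle (\<lambda>\<eta>. poisson_int g (of_real r * \<eta>) - g \<eta>)"
      by (intro Bochner_Integration.integrable_diff poisson_int_L1 f g r)+
    have "?d (\<lambda>x. f x + g x) r = (\<integral>\<eta>. cmod ((poisson_int f (of_real r * \<eta>) - f \<eta>) + (poisson_int g (of_real r * \<eta>) - g \<eta>)) \<partial>circle)"
      by (rule Bochner_Integration.integral_cong) (auto simp: poisson_int_add[OF f g norm_radial[OF r]] add_diff_add)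
    also have "\<dots> \<le> (\<integral>\<eta>. cmod (poisson_int f (of_real r * \<eta>) - f \<eta>) + cmod (poisson_int g (of_real r * \<eta>) - g \<eta>) \<partial>circle)"
      by (intro integral_mono integrable_norm Bochner_Integration.integrable_add i norm_triangle_ineq)
    also have "\<dots> = ?d f r + ?d g r"
      by (intro Bochner_Integration.integral_add integrable_norm i)
    finally show ?case .
  qed
  then have "(?d (\<lambda>x. f x + g x) \<longlongrightarrow> 0) (at_left 1)"
    by (intro tendsto_sandwich[OF _ _ tendsto_const lim]) auto
  then show ?thesis using f g by (simp add: radial_L1_def)
qed

lemma radial_L1_cmult:
  assumes "radial_L1 f"
  shows "radial_L1 (\<lambda>x. c * f x)"
proof -
  let ?d = "\<lambda>f r. \<integral>\<eta>. cmod (poisson_int f (of_real r * \<eta>) - f \<eta>) \<partial>circle"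
  have "?d (\<lambda>x. c * f x) = (\<lambda>r. cmod c * ?d f r)"
    by (simp add: poisson_int_cmult norm_mult flip: right_diff_distrib)
  then show ?thesis
    using assms tendsto_mult_right_zero[of "?d f" "at_left 1" "cmod c"] by (auto simp: radial_L1_def)
qed

text \<open>Three-term splitting: the Poisson integral of f - g costs no more than f - g itself, by
  the L^1 contraction.\<close>

lemma radial_L1_approx:
  assumes f: "integrable circle f"
    and g: "\<And>e. e > 0 \<Longrightarrow> \<exists>g. radial_L1 g \<and> (\<integral>x. cmod (f x - g x) \<partial>circle) < e"
  shows "radial_L1 f"
proof -
  let ?d = "\<lambda>f r. \<integral>\<eta>. cmod (poisson_int f (of_real r * \<eta>) - f \<eta>) \<partial>circle"
  have "(?d f \<longlongrightarrow> 0) (at_left 1)"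
  proof (rule tendstoI)
    fix e :: real assume e: "e > 0"
    obtain g where g: "radial_L1 g" and ge: "(\<integral>x. cmod (f x - g x) \<partial>circle) < e / 3"
      using g[of "e / 3"] e by auto
    have gi: "integrable circle g" and gl: "(?d g \<longlongrightarrow> 0) (at_left 1)" using g by (auto simp: radial_L1_def)
    have i1: "integrable circle (\<lambda>x. f x - g x)" using f gi by auto
    have "\<forall>\<^sub>F r in at_left 1. dist (?d g r) 0 < e / 3" using gl e by (intro tendstoD) auto
    with eventually_at_left_1 show "\<forall>\<^sub>F r in at_left 1. dist (?d f r) 0 < e"
    proof eventually_elim
      case (elim r)
      then have r: "0 \<le> r" "r < 1" by auto
      let ?p = "\<lambda>f \<eta>. poisson_int f (of_real r * \<eta>)"
      have i: "integrable circle (?p (\<lambda>x. f x - g x))" "integrable circle (\<lambda>\<eta>. ?p g \<eta> - g \<eta>)"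
        by (intro Bochner_Integration.integrable_diff poisson_int_L1 f gi i1 r)+
      have "?d f r = (\<integral>\<eta>. cmod (?p (\<lambda>x. f x - g x) \<eta> + (?p g \<eta> - g \<eta>) - (f \<eta> - g \<eta>)) \<partial>circle)"
        by (rule Bochner_Integration.integral_cong) (auto simp: poisson_int_diff[OF f gi norm_radial[OF r]])
      also have "\<dots> \<le> (\<integral>\<eta>. cmod (?p (\<lambda>x. f x - g x) \<eta>) + cmod (?p g \<eta> - g \<eta>) + cmod (f \<eta> - g \<eta>) \<partial>circle)"
        by (intro integral_mono integrable_norm Bochner_Integration.integrable_diff Bochner_Integration.integrable_add i
            f gi order_trans[OF norm_triangle_ineq4] add_right_mono norm_triangle_ineq)
      also have "\<dots> = (\<integral>\<eta>. cmod (?p (\<lambda>x. f x - g x) \<eta>) \<partial>circle) + ?d g r + (\<integral>\<eta>. cmod (f \<eta> - g \<eta>) \<partial>circle)"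
        by (subst Bochner_Integration.integral_add; (intro Bochner_Integration.integrable_add integrable_norm i i1)?)+ simp
      also have "\<dots> \<le> (\<integral>\<eta>. cmod (f \<eta> - g \<eta>) \<partial>circle) + ?d g r + (\<integral>\<eta>. cmod (f \<eta> - g \<eta>) \<partial>circle)"
        using poisson_int_L1(2)[OF i1 r] by simp
      finally show ?case using elim ge by simp
    qed
  qed
  with f show ?thesis by (simp add: radial_L1_def)
qed

lemma radial_L1_limit:
  fixes w :: "complex \<Rightarrow> real"
  assumes s: "\<And>i::nat. radial_L1 (s i)" and f: "f \<in> borel_measurable circle"
    and lim: "\<And>x. x \<in> space circle \<Longrightarrow> (\<lambda>i. s i x) \<longlonglongrightarrow> f x"
    and w: "integrable circle w" "\<And>i x. x \<in> space circle \<Longrightarrow> cmod (s i x) \<le> w x"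
  shows "radial_L1 f"
proof -
  have sm: "s i \<in> borel_measurable circle" for i using s[of i] by (auto simp: radial_L1_def)
  have fw: "cmod (f x) \<le> w x" if "x \<in> space circle" for x
    by (rule LIMSEQ_le_const2[OF tendsto_norm[OF lim[OF that]]]) (use w(2)[OF that] in auto)
  have fi: "integrable circle f"
    by (rule Bochner_Integration.integrable_bound[OF w(1) f AE_I2]) (use fw in force)
  show ?thesis
  proof (rule radial_L1_approx[OF fi])
    fix e :: real assume "e > 0"
    have "(\<lambda>i. \<integral>x. cmod (f x - s i x) \<partial>circle) \<longlonglongrightarrow> (\<integral>x. 0 \<partial>circle)"
    proof (rule integral_dominated_convergence)
      show "integrable circle (\<lambda>x. 2 * w x)" using w by auto
      show "AE x in circle. (\<lambda>i. cmod (f x - s i x)) \<longlonglongrightarrow> 0"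
        by (rule AE_I2, rule tendsto_norm_zero, rule LIM_zero_iff[THEN iffD1], rule tendsto_minus_cancel)
          (use lim in \<open>auto intro!: tendsto_eq_intros\<close>)
      show "AE x in circle. norm (cmod (f x - s i x)) \<le> 2 * w x" for i
      proof (rule AE_I2)
        fix x assume x: "x \<in> space circle"
        show "norm (cmod (f x - s i x)) \<le> 2 * w x"
          using norm_triangle_ineq4[of "f x" "s i x"] fw[OF x] w(2)[OF x, of i] by simp
      qed
    qed (use f sm in measurable)
    then have "(\<lambda>i. \<integral>x. cmod (f x - s i x) \<partial>circle) \<longlonglongrightarrow> 0" by simp
    then have "\<forall>\<^sub>F i in sequentially. (\<integral>x. cmod (f x - s i x) \<partial>circle) < e"
      using \<open>e > 0\<close> order_tendstoD(2) by blast
    then obtain i where "(\<integral>x. cmod (f x - s i x) \<partial>circle) < e"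
      using eventually_sequentially by auto
    with s show "\<exists>g. radial_L1 g \<and> (\<integral>x. cmod (f x - g x) \<partial>circle) < e" by blast
  qed
qed


lemma norm_diff_circle:
  assumes "cmod \<eta> = 1" "cmod \<zeta> = 1"
  shows "(cmod (\<zeta> - \<eta>))\<^sup>2 = 2 - 2 * Re (\<zeta> * cnj \<eta>)"
proof -
  have "(cmod (\<zeta> - \<eta>))\<^sup>2 = (cmod \<zeta>)\<^sup>2 + (cmod \<eta>)\<^sup>2 - 2 * Re (\<zeta> * cnj \<eta>)"
    by (simp add: cmod_power2) (simp add: algebra_simps power2_eq_square)
  then show ?thesis using assms by simp
qed

lemma integrable_poisson_real: "cmod z < 1 \<Longrightarrow> integrable circle (\<lambda>\<zeta>. poisson z \<zeta>)"
  using integral_poisson[of z] not_integrable_integral_eq[of circle] by fastforce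

text \<open>The second moment of the kernel about \<open>\<eta>\<close>, seen as a probability
  density: |zeta - eta|^2 = 2 - 2 Re(zeta conj eta), and the mean of the kernel at r eta is r eta.
  It plays the role of the usual estimate that the kernel concentrates at
  \<open>\<eta>\<close>.\<close>

lemma integral_poisson_dist:
  assumes r: "0 \<le> r" "r < 1" and \<eta>: "cmod \<eta> = 1"
  shows "integrable circle (\<lambda>\<zeta>. (cmod (\<zeta> - \<eta>))\<^sup>2 * poisson (of_real r * \<eta>) \<zeta>)" (is ?A)
    "(\<integral>\<zeta>. (cmod (\<zeta> - \<eta>))\<^sup>2 * poisson (of_real r * \<eta>) \<zeta> \<partial>circle) = 2 - 2 * r" (is ?B)
proof -
  let ?z = "of_real r * \<eta>"
  have z: "cmod ?z < 1" using r \<eta> by (simp add: norm_mult)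
  have ip: "integrable circle (\<lambda>\<zeta>. \<zeta> * poisson ?z \<zeta>)"
    by (intro integrable_poisson z circle.integrable_const_bound[of _ 1]) (auto simp: norm_circle)
  have i: "integrable circle (\<lambda>\<zeta>. cnj \<eta> * (\<zeta> * poisson ?z \<zeta>))"
    using ip by auto
  have "(\<integral>\<zeta>. cnj \<eta> * (\<zeta> * poisson ?z \<zeta>) \<partial>circle) = cnj \<eta> * poisson_int (\<lambda>\<zeta>. \<zeta> ^ 1) ?z"
    by (simp add: poisson_int_def)
  also have "\<dots> = r * (\<eta> * cnj \<eta>)" using poisson_int_power[OF z, of 1] by simp
  also have "\<eta> * cnj \<eta> = 1" using \<eta> by (simp add: complex_norm_square[symmetric])
  finally have 1: "(\<integral>\<zeta>. Re (cnj \<eta> * (\<zeta> * poisson ?z \<zeta>)) \<partial>circle) = r"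
    by (subst integral_Re[OF i]) simp
  have e: "(cmod (\<zeta> - \<eta>))\<^sup>2 * poisson ?z \<zeta> = 2 * poisson ?z \<zeta> - 2 * Re (cnj \<eta> * (\<zeta> * poisson ?z \<zeta>))"
    if "\<zeta> \<in> space circle" for \<zeta>
    by (simp add: norm_diff_circle[OF \<eta> norm_circle[OF that]] algebra_simps)
  have i2: "integrable circle (\<lambda>\<zeta>. 2 * poisson ?z \<zeta>)" "integrable circle (\<lambda>\<zeta>. 2 * Re (cnj \<eta> * (\<zeta> * poisson ?z \<zeta>)))"
    by (intro integrable_mult_right integrable_poisson_real z integrable_Re i)+
  show ?A
    by (rule Bochner_Integration.integrable_cong[OF refl e, THEN iffD2], assumption, rule Bochner_Integration.integrable_diff[OF i2])
  have "(\<integral>\<zeta>. (cmod (\<zeta> - \<eta>))\<^sup>2 * poisson ?z \<zeta> \<partial>circle) =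
      (\<integral>\<zeta>. 2 * poisson ?z \<zeta> - 2 * Re (cnj \<eta> * (\<zeta> * poisson ?z \<zeta>)) \<partial>circle)"
    by (rule Bochner_Integration.integral_cong[OF refl e])
  also have "\<dots> = 2 * (\<integral>\<zeta>. poisson ?z \<zeta> \<partial>circle) - 2 * (\<integral>\<zeta>. Re (cnj \<eta> * (\<zeta> * poisson ?z \<zeta>)) \<partial>circle)"
    by (subst Bochner_Integration.integral_diff[OF i2]) (simp only: integral_mult_right_zero)
  also have "\<dots> = 2 - 2 * r" unfolding 1 integral_poisson[OF z] by simp
  finally show ?B .
qed

lemma poisson_int_lipschitz:
  assumes g: "integrable circle g" and L: "\<And>x y. cmod (g x - g y) \<le> L * cmod (x - y)"
    and r: "0 \<le> r" "r < 1" and \<eta>: "cmod \<eta> = 1"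
  shows "cmod (poisson_int g (of_real r * \<eta>) - g \<eta>) \<le> L * sqrt (2 - 2 * r)"
proof -
  \<comment> \<open>\<open>?s\<close> is the standard deviation of the kernel about
    \<open>\<eta>\<close>. The bound d <= s/2 + d^2/(2s), used with this s, turns the second moment
    into a bound on the first one.\<close>
  let ?z = "of_real r * \<eta>" and ?s = "sqrt (2 - 2 * r)"
  have z: "cmod ?z < 1" using r \<eta> by (simp add: norm_mult)
  have s: "?s > 0" "?s\<^sup>2 = 2 - 2 * r" using r by auto
  have Lnn: "0 \<le> L"
    using order_trans[OF norm_ge_zero L[of 1 0]] by simp
  have ic: "integrable circle (\<lambda>\<zeta>. g \<eta>)" by simp
  have id: "integrable circle (\<lambda>\<zeta>. (g \<zeta> - g \<eta>) * poisson ?z \<zeta>)"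
    by (intro integrable_poisson Bochner_Integration.integrable_diff g ic z)
  have c: "poisson_int (\<lambda>\<zeta>. g \<eta>) ?z = g \<eta>"
    using poisson_int_cmult[of "g \<eta>" "\<lambda>_. 1" ?z] poisson_int_power[OF z, of 0] by simp
  have ib: "integrable circle (\<lambda>\<zeta>. L * (?s / 2 * poisson ?z \<zeta> + 1 / (2 * ?s) * ((cmod (\<zeta> - \<eta>))\<^sup>2 * poisson ?z \<zeta>)))"
    by (intro Bochner_Integration.integrable_add integrable_mult_right integrable_poisson_real z integral_poisson_dist r \<eta>)
  have "cmod (poisson_int g ?z - g \<eta>) = cmod (\<integral>\<zeta>. (g \<zeta> - g \<eta>) * poisson ?z \<zeta> \<partial>circle)"
    by (subst c[symmetric], subst poisson_int_diff[OF g ic z, symmetric]) (simp only: poisson_int_def)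
  also have "\<dots> \<le> (\<integral>\<zeta>. cmod ((g \<zeta> - g \<eta>) * poisson ?z \<zeta>) \<partial>circle)"
    by (rule integral_norm_bound)
  also have "\<dots> \<le> (\<integral>\<zeta>. L * (?s / 2 * poisson ?z \<zeta> + 1 / (2 * ?s) * ((cmod (\<zeta> - \<eta>))\<^sup>2 * poisson ?z \<zeta>)) \<partial>circle)"
  proof (rule integral_mono[OF integrable_norm[OF id] ib])
    fix \<zeta> assume "\<zeta> \<in> space circle"
    let ?d = "cmod (\<zeta> - \<eta>)"
    have "0 \<le> (?s - ?d)\<^sup>2" by simp
    then have "2 * ?s * ?d \<le> ?s\<^sup>2 + ?d\<^sup>2" by (simp add: power2_diff)
    then have d: "?d \<le> ?s / 2 + 1 / (2 * ?s) * ?d\<^sup>2"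
      using s(1) by (simp add: field_simps power2_eq_square)
    have "cmod ((g \<zeta> - g \<eta>) * poisson ?z \<zeta>) = cmod (g \<zeta> - g \<eta>) * poisson ?z \<zeta>"
      using poisson_nonneg[OF z] by (simp add: norm_mult)
    also have "\<dots> \<le> (L * (?s / 2 + 1 / (2 * ?s) * ?d\<^sup>2)) * poisson ?z \<zeta>"
      by (intro mult_right_mono poisson_nonneg z order_trans[OF L] mult_left_mono d Lnn)
    finally show "cmod ((g \<zeta> - g \<eta>) * poisson ?z \<zeta>) \<le> L * (?s / 2 * poisson ?z \<zeta> + 1 / (2 * ?s) * (?d\<^sup>2 * poisson ?z \<zeta>))"
      by (simp add: distrib_right mult.assoc)
  qed
  also have "\<dots> = L * (?s / 2 * (\<integral>\<zeta>. poisson ?z \<zeta> \<partial>circle) + 1 / (2 * ?s) * (\<integral>\<zeta>. (cmod (\<zeta> - \<eta>))\<^sup>2 * poisson ?z \<zeta> \<partial>circle))"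
    by (subst integral_mult_right_zero, subst Bochner_Integration.integral_add;
      (intro integrable_mult_right integrable_poisson_real z integral_poisson_dist r \<eta>)?)
      (simp only: integral_mult_right_zero)
  also have "\<dots> = L * (?s / 2 * 1 + 1 / (2 * ?s) * ?s\<^sup>2)"
    unfolding integral_poisson[OF z] integral_poisson_dist(2)[OF r \<eta>] s(2) ..
  also have "\<dots> = L * ?s"
  proof -
    have "x / 2 * 1 + 1 / (2 * x) * x\<^sup>2 = x" if "x > 0" for x :: real
      using that by (simp add: power2_eq_square)
    from this[OF s(1)] show ?thesis by (simp only:)
  qed
  finally show ?thesis .
qed

lemma radial_L1_lipschitz:
  assumes g: "integrable circle g" and L: "\<And>x y. cmod (g x - g y) \<le> L * cmod (x - y)"
  shows "radial_L1 g"
proof -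
  let ?d = "\<lambda>f r. \<integral>\<eta>. cmod (poisson_int f (of_real r * \<eta>) - f \<eta>) \<partial>circle"
  have le: "\<forall>\<^sub>F r in at_left 1. ?d g r \<le> L * sqrt (2 - 2 * r)"
    using eventually_at_left_1
  proof eventually_elim
    case (elim r)
    then have r: "0 \<le> r" "r < 1" by auto
    have "?d g r \<le> (\<integral>\<eta>. L * sqrt (2 - 2 * r) \<partial>circle)"
      by (intro integral_mono integrable_norm Bochner_Integration.integrable_diff poisson_int_L1 g r
        poisson_int_lipschitz[OF g L r]) (auto simp: norm_circle)
    then show ?case by (simp add: circle.prob_space)
  qed
  have nn: "\<forall>\<^sub>F r in at_left 1. 0 \<le> ?d g r" by (intro always_eventually allI integral_nonneg) simp
  have "((\<lambda>r. L * sqrt (2 - 2 * r)) \<longlongrightarrow> L * sqrt (2 - 2 * 1)) (at_left 1)"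
    by (intro tendsto_intros)
  then have "((\<lambda>r. L * sqrt (2 - 2 * r)) \<longlongrightarrow> 0) (at_left 1)" by simp
  from nn le tendsto_const this have "(?d g \<longlongrightarrow> 0) (at_left 1)"
    by (rule tendsto_sandwich)
  with g show ?thesis by (simp add: radial_L1_def)
qed

lemma radial_L1_const: "radial_L1 (\<lambda>_. c)"
  by (rule radial_L1_lipschitz[of _ 0]) auto

lemma radial_L1_closed:
  assumes C: "closed C"
  shows "radial_L1 (indicator C)"
\<comment> \<open>\<open>infdist\<close> to the empty set is 0 by convention, so the functions
  \<open>g n\<close> below would be 1 instead of 0 there.\<close>
proof (cases "C = {}")
  case True
  then show ?thesis using radial_L1_const[of 0] by (simp add: indicator_def[abs_def])
next
  case False
  define g where "g n x = complex_of_real (max 0 (1 - real n * infdist x C))" for n x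
  have b: "cmod (g n x) \<le> 1" for n x by (simp add: g_def infdist_nonneg)
  show ?thesis
  proof (rule radial_L1_limit[where w = "\<lambda>_. 1" and s = g])
    fix n
    have m: "g n \<in> borel_measurable circle" unfolding g_def
      by (intro measurable_circle_borel borel_measurable_continuous_onI continuous_intros)
    show "radial_L1 (g n)"
    proof (rule radial_L1_lipschitz[where L = "real n"])
      show "integrable circle (g n)"
        by (rule circle.integrable_const_bound[of _ 1]) (use b m in auto)
      fix x y
      have "cmod (g n x - g n y) = \<bar>max 0 (1 - real n * infdist x C) - max 0 (1 - real n * infdist y C)\<bar>"
        unfolding g_def by (simp flip: of_real_diff)
      also have "\<dots> \<le> \<bar>real n * infdist x C - real n * infdist y C\<bar>" by linarith
      also have "\<dots> = real n * \<bar>infdist x C - infdist y C\<bar>"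
        by (simp add: abs_mult flip: right_diff_distrib)
      also have "\<dots> \<le> real n * dist x y"
        by (intro mult_left_mono infdist_triangle_abs) auto
      finally show "cmod (g n x - g n y) \<le> real n * cmod (x - y)" by (simp add: dist_norm)
    qed
  next
    show "indicator C \<in> borel_measurable circle"
      by (rule measurable_circle_borel) (use C in simp)
    fix x
    show "(\<lambda>n. g n x) \<longlonglongrightarrow> indicator C x"
    proof (cases "x \<in> C")
      case True
      then show ?thesis by (simp add: g_def)
    next
      case False
      then have d: "infdist x C > 0"
        using in_closed_iff_infdist_zero[OF C \<open>C \<noteq> {}\<close>, of x] infdist_nonneg[of x C] by auto
      obtain N where N: "1 < real N * infdist x C" using reals_Archimedean3[OF d] by blast
      have "g n x = 0" if "n \<ge> N" for n
      proof -
        have "real N * infdist x C \<le> real n * infdist x C" using that d by (intro mult_right_mono) auto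
        then show ?thesis using N by (simp add: g_def)
      qed
      then have "\<forall>\<^sub>F n in sequentially. g n x = 0" unfolding eventually_sequentially by blast
      with False show ?thesis by (simp add: tendsto_eventually)
    qed
  qed (use b in auto)
qed

text \<open>Dynkin induction over the intersection-stable generator of closed sets. Disjoint unions
  are handled by finite sums and dominated convergence.\<close>

lemma radial_L1_indicator:
  assumes "A \<in> sets borel"
  shows "radial_L1 (indicator A)"
proof -
  have "sets borel = sigma_sets UNIV (Collect closed :: complex set set)"
    unfolding borel_eq_closed by simp
  with assms have A: "A \<in> sigma_sets UNIV (Collect closed)" by simp
  have "Int_stable (Collect closed :: complex set set)" by (auto simp: Int_stable_def)
  moreover have "Collect closed \<subseteq> Pow (UNIV :: complex set)" by auto
  ultimately show ?thesis using A
  proof (induction rule: sigma_sets_induct_disjoint)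
    case (basic A)
    then show ?case using radial_L1_closed by auto
  next
    case empty
    show ?case using radial_L1_const[of 0] by simp
  next
    case (compl A)
    have "indicator (UNIV - A) = (\<lambda>x. 1 + (-1) * indicator A x :: complex)"
      by (auto split: split_indicator)
    with radial_L1_add[OF radial_L1_const[of 1] radial_L1_cmult[OF compl(2), of "-1"]] show ?case by simp
  next
    case (union A)
    have s: "radial_L1 (indicator (\<Union>i<n. A i))" for n
    proof (induction n)
      case 0
      then show ?case using radial_L1_const[of 0] by (simp add: indicator_def[abs_def])
    next
      case (Suc n)
      have "A n \<inter> (\<Union>i<n. A i) = {}"
        using union(1) by (auto simp: disjoint_family_on_def) (metis IntI UNIV_I empty_iff less_irrefl)
      then have "indicator (\<Union>i<Suc n. A i) = (\<lambda>x. indicator (\<Union>i<n. A i) x + indicator (A n) x :: complex)"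
        by (auto split: split_indicator simp: lessThan_Suc fun_eq_iff)
      with radial_L1_add[OF Suc union(3)[of n]] show ?case by simp
    qed
    have m: "A i \<in> sets borel" for i using union(2) unfolding borel_eq_closed by auto
    show ?case
    proof (rule radial_L1_limit[OF s, where w = "\<lambda>_. 1"])
      show "indicator (\<Union> (range A)) \<in> borel_measurable circle"
        by (rule measurable_circle_borel) (use m in auto)
      show "(\<lambda>n. indicator (\<Union>i<n. A i) x) \<longlonglongrightarrow> (indicator (\<Union> (range A)) x :: complex)" for x
        by (rule LIMSEQ_indicator_UN)
    qed (auto split: split_indicator)
  qed
qed

lemma radial_L1_integrable:
  assumes "integrable circle f"
  shows "radial_L1 f"
  using assms
proof (induction rule: integrable_induct)
  case (base A c)
  then obtain B where B: "B \<in> sets borel" "A = B \<inter> sphere 0 1"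
    unfolding sets_circle sets_restrict_space by auto
  have "radial_L1 (\<lambda>x. c * indicator B x)" using radial_L1_cmult[OF radial_L1_indicator[OF B(1)]] .
  \<comment> \<open>The constant sequence in \<open>radial_L1_limit\<close> serves only to replace a
    function by one that agrees with it on the circle.\<close>
  then show ?case
    by (rule radial_L1_limit[where w = "\<lambda>_. cmod c" and s = "\<lambda>_ x. c * indicator B x"])
      (use base in \<open>auto simp: B(2) space_circle norm_mult split: split_indicator\<close>)
next
  case (add f g)
  then show ?case by (auto intro: radial_L1_add)
next
  case (lim f s)
  show ?case
    by (rule radial_L1_limit[where s = s and w = "\<lambda>x. 2 * cmod (f x)"]) (use lim in auto)
qed

section \<open>Boundary values of bounded analytic functions\<close>

text \<open>The Poisson integrals of \<open>f\<close> are its analytic extension, hence 0, yet they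
  converge to \<open>f\<close> in L^1. So the constant norm of \<open>f\<close> has limit 0.\<close>

lemma hardy_AE_zero:
  assumes f: "integrable circle f" "\<forall>n\<ge>1. (\<integral>\<zeta>. f \<zeta> * \<zeta> ^ n \<partial>circle) = 0"
    and z: "\<And>z. cmod z < 1 \<Longrightarrow> disk_ext f z = 0"
  shows "AE \<zeta> in circle. f \<zeta> = 0"
proof -
  have "((\<lambda>r. \<integral>\<eta>. cmod (poisson_int f (of_real r * \<eta>) - f \<eta>) \<partial>circle) \<longlongrightarrow> 0) (at_left 1)"
    using radial_L1_integrable[OF f(1)] by (simp add: radial_L1_def)
  moreover have "\<forall>\<^sub>F r in at_left 1. (\<integral>\<eta>. cmod (poisson_int f (of_real r * \<eta>) - f \<eta>) \<partial>circle) = (\<integral>\<eta>. cmod (f \<eta>) \<partial>circle)"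
    using eventually_at_left_1
  proof eventually_elim
    case (elim r)
    show ?case
      by (rule Bochner_Integration.integral_cong[OF refl])
        (use elim in \<open>simp add: poisson_int_hardy[OF f norm_radial] z[OF norm_radial]\<close>)
  qed
  ultimately have "((\<lambda>r::real. \<integral>\<eta>. cmod (f \<eta>) \<partial>circle) \<longlongrightarrow> 0) (at_left 1)"
    by (rule Lim_transform_eventually)
  then have "(\<integral>\<eta>. cmod (f \<eta>) \<partial>circle) = 0"
    by (rule tendsto_unique[OF trivial_limit_at_left_real tendsto_const])
  then show ?thesis
    using integral_nonneg_eq_0_iff_AE[OF integrable_norm[OF f(1)]] by simp
qed

lemma disk_ext_holomorphic:
  assumes "integrable circle f"
  shows "disk_ext f holomorphic_on ball 0 1"
  by (rule power_series_holomorphic[where a = "\<lambda>n. \<integral>\<zeta>. f \<zeta> * cnj \<zeta> ^ n \<partial>circle"])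
    (use cauchy_series(2)[OF assms] in \<open>simp add: disk_ext_def mult.commute\<close>)

text \<open>Used later with \<open>e\<close> an outer function whose boundary modulus is bounded;
  the aim is a boundary function that acts as a multiplier on \<open>hardy2\<close>.\<close>

locale bounded_holomorphic_disk =
  fixes e :: "complex \<Rightarrow> complex" and B :: real
  assumes holo: "e holomorphic_on ball 0 1"
    and bounded: "\<And>z. cmod z < 1 \<Longrightarrow> cmod (e z) \<le> B"
begin

definition coef :: "nat \<Rightarrow> complex" where
  "coef n = (deriv ^^ n) e 0 / fact n"

lemma coef_sums: "cmod z < 1 \<Longrightarrow> (\<lambda>n. coef n * z ^ n) sums e z"
  using holomorphic_power_series[OF holo, of z] by (simp add: coef_def)

lemma coef_summable:
  assumes "0 \<le> r" "r < 1"
  shows "summable (\<lambda>n. cmod (coef n * of_real r ^ n))"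
proof -
  \<comment> \<open>Convergence at a point s strictly further out gives absolute convergence at
    r.\<close>
  obtain s where s: "r < s" "s < 1" using dense[OF assms(2)] by blast
  show ?thesis
    by (rule powser_insidea[where x = "of_real s"])
      (use s assms coef_sums[of "of_real s"] in \<open>auto simp: sums_iff\<close>)
qed

lemma measurable_radial [measurable]:
  assumes "0 \<le> r" "r < 1"
  shows "(\<lambda>\<zeta>. e (of_real r * \<zeta>)) \<in> borel_measurable circle"
proof -
  have "continuous_on (sphere 0 1) (\<lambda>\<zeta>. e (of_real r * \<zeta>))"
    by (rule continuous_on_compose2[OF holomorphic_on_imp_continuous_on[OF holo]])
      (use assms in \<open>auto intro!: continuous_intros simp: norm_mult\<close>)
  then show ?thesis
    using borel_measurable_continuous_on_restrict measurable_cong_sets[OF sets_circle refl] by blast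
qed

lemma integral_mult_radial:
  assumes f: "integrable circle f" and r: "0 \<le> r" "r < 1"
  shows "(\<lambda>n. coef n * of_real r ^ n * (\<integral>\<zeta>. f \<zeta> * \<zeta> ^ n \<partial>circle)) sums (\<integral>\<zeta>. f \<zeta> * e (of_real r * \<zeta>) \<partial>circle)"
proof -
  have "(\<integral>\<zeta>. f \<zeta> * (\<Sum>n. coef n * of_real r ^ n * \<zeta> ^ n) \<partial>circle) = (\<integral>\<zeta>. f \<zeta> * e (of_real r * \<zeta>) \<partial>circle)"
  proof (rule Bochner_Integration.integral_cong[OF refl])
    fix \<zeta> assume "\<zeta> \<in> space circle"
    then have "(\<Sum>n. coef n * of_real r ^ n * \<zeta> ^ n) = e (of_real r * \<zeta>)"
      using coef_sums[OF norm_radial[OF r]] by (simp add: sums_iff power_mult_distrib mult.assoc)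
    then show "f \<zeta> * (\<Sum>n. coef n * of_real r ^ n * \<zeta> ^ n) = f \<zeta> * e (of_real r * \<zeta>)" by simp
  qed
  then show ?thesis
    using integral_suminf_bounded[OF f _ _ coef_summable[OF r], of "\<lambda>n \<zeta>. \<zeta> ^ n"]
    by (simp add: norm_power norm_circle)
qed

lemma integral_radial_mult_zero:
  assumes f: "integrable circle f" "\<forall>n\<ge>1. (\<integral>\<zeta>. f \<zeta> * \<zeta> ^ n \<partial>circle) = 0" and r: "0 \<le> r" "r < 1" and n: "n \<ge> 1"
  shows "(\<integral>\<zeta>. f \<zeta> * \<zeta> ^ n * e (of_real r * \<zeta>) \<partial>circle) = 0"
proof -
  have "integrable circle (\<lambda>\<zeta>. f \<zeta> * \<zeta> ^ n)"
    by (rule integrable_mult_bounded[OF f(1), of _ 1]) (auto simp: norm_circle norm_power)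
  from integral_mult_radial[OF this r]
  have "(\<lambda>k. 0 :: complex) sums (\<integral>\<zeta>. f \<zeta> * \<zeta> ^ n * e (of_real r * \<zeta>) \<partial>circle)"
    using f(2) n by (simp add: mult.assoc flip: power_add)
  then show ?thesis using sums_unique2 sums_zero by blast
qed

text \<open>A dilation of \<open>e\<close> is an absolutely convergent power series on the circle,
  and each monomial passes through \<open>disk_ext\<close> by
  \<open>disk_ext_mult_power\<close>.\<close>

lemma disk_ext_mult_radial:
  assumes f: "integrable circle f" "\<forall>n\<ge>1. (\<integral>\<zeta>. f \<zeta> * \<zeta> ^ n \<partial>circle) = 0" and r: "0 \<le> r" "r < 1" and z: "cmod z < 1"
  shows "disk_ext (\<lambda>\<zeta>. f \<zeta> * e (of_real r * \<zeta>)) z = e (of_real r * z) * disk_ext f z"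
proof -
  have rz: "cmod (of_real r * z) < 1"
    using r z by (simp add: norm_mult mult_le_one le_less_trans[OF mult_left_le_one_le z])
  have "(\<lambda>n. coef n * of_real r ^ n * (z ^ n * disk_ext f z)) sums disk_ext (\<lambda>\<zeta>. f \<zeta> * e (of_real r * \<zeta>)) z"
    using integral_mult_radial[OF integrable_cauchy[OF f(1) z] r] disk_ext_mult_power[OF f z]
    by (simp add: disk_ext_def)
  moreover have "(\<lambda>n. coef n * of_real r ^ n * (z ^ n * disk_ext f z)) sums (e (of_real r * z) * disk_ext f z)"
    using sums_mult2[OF coef_sums[OF rz], of "disk_ext f z"] by (simp add: power_mult_distrib mult.assoc)
  ultimately show ?thesis using sums_unique2 by blast
qed

text \<open>At r^2 this is the squared L^2 mean of \<open>e\<close> on the circle of radius r. The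
  argument is a product of radii because the inner product of the dilations by r and s is the value
  at r s.\<close>

definition sqsum :: "real \<Rightarrow> real" where
  "sqsum t = (\<Sum>n. (cmod (coef n))\<^sup>2 * t ^ n)"

lemma integral_power_cnj:
  "(\<integral>\<zeta>. \<zeta> ^ m * cnj \<zeta> ^ n \<partial>circle) = (if m = n then 1 else 0)"
proof -
  have u: "\<zeta> * cnj \<zeta> = 1" if "\<zeta> \<in> space circle" for \<zeta>
    using norm_circle[OF that] by (simp add: complex_norm_square[symmetric])
  show ?thesis
  proof (cases "n \<le> m")
    case True
    then obtain k where k: "m = n + k" using le_Suc_ex by blast
    have "(\<integral>\<zeta>. \<zeta> ^ m * cnj \<zeta> ^ n \<partial>circle) = (\<integral>\<zeta>. \<zeta> ^ k \<partial>circle)"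
    proof (rule Bochner_Integration.integral_cong[OF refl])
      fix \<zeta> assume z: "\<zeta> \<in> space circle"
      have "\<zeta> ^ m * cnj \<zeta> ^ n = (\<zeta> * cnj \<zeta>) ^ n * \<zeta> ^ k"
        by (simp add: k power_add power_mult_distrib mult_ac)
      then show "\<zeta> ^ m * cnj \<zeta> ^ n = \<zeta> ^ k" by (simp add: u[OF z])
    qed
    then show ?thesis using integral_circle_power[of k] by (auto simp: k circle.prob_space)
  next
    case False
    then obtain k where k: "n = m + Suc k" using less_imp_Suc_add[of m n] by auto
    have "(\<integral>\<zeta>. \<zeta> ^ m * cnj \<zeta> ^ n \<partial>circle) = (\<integral>\<zeta>. cnj (\<zeta> ^ Suc k) \<partial>circle)"
    proof (rule Bochner_Integration.integral_cong[OF refl])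
      fix \<zeta> assume z: "\<zeta> \<in> space circle"
      have "\<zeta> ^ m * cnj \<zeta> ^ n = (\<zeta> * cnj \<zeta>) ^ m * cnj \<zeta> ^ Suc k"
        by (simp only: k power_add power_mult_distrib mult_ac)
      then show "\<zeta> ^ m * cnj \<zeta> ^ n = cnj (\<zeta> ^ Suc k)" by (simp add: u[OF z])
    qed
    also have "\<dots> = cnj (\<integral>\<zeta>. \<zeta> ^ Suc k \<partial>circle)" by (rule Bochner_Integration.integral_cnj)
    finally show ?thesis using integral_circle_power[of "Suc k"] False by simp
  qed
qed

lemma integrable_radial:
  assumes "0 \<le> r" "r < 1"
  shows "integrable circle (\<lambda>\<zeta>. e (of_real r * \<zeta>))"
  by (rule circle.integrable_const_bound[of _ B])
    (use assms bounded[OF norm_radial[OF assms]] measurable_radial in auto)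

lemma fourier_radial:
  assumes r: "0 \<le> r" "r < 1"
  shows "(\<integral>\<zeta>. cnj (e (of_real r * \<zeta>)) * \<zeta> ^ n \<partial>circle) = cnj (coef n) * of_real r ^ n"
proof -
  have "integrable circle (\<lambda>\<zeta>. cnj \<zeta> ^ n)"
    by (rule circle.integrable_const_bound[of _ 1]) (auto simp: norm_power norm_circle)
  from integral_mult_radial[OF this r]
  have "(\<lambda>m. coef m * of_real r ^ m * (if m = n then 1 else 0)) sums (\<integral>\<zeta>. cnj \<zeta> ^ n * e (of_real r * \<zeta>) \<partial>circle)"
    by (simp add: integral_power_cnj mult.commute[of "cnj _ ^ n"])
  moreover have "(\<lambda>m. coef m * of_real r ^ m * (if m = n then 1 else 0)) sums (coef n * of_real r ^ n)"
    using sums_If_finite[of "\<lambda>m. m = n" "\<lambda>m. coef m * of_real r ^ m"] by (simp add: if_distrib cong: if_cong)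
  ultimately have "(\<integral>\<zeta>. cnj \<zeta> ^ n * e (of_real r * \<zeta>) \<partial>circle) = coef n * of_real r ^ n"
    using sums_unique2 by blast
  then have "(\<integral>\<zeta>. cnj (cnj \<zeta> ^ n * e (of_real r * \<zeta>)) \<partial>circle) = cnj (coef n * of_real r ^ n)"
    by (simp only: Bochner_Integration.integral_cnj)
  then show ?thesis by (simp add: mult.commute)
qed

text \<open>Parseval for two dilations: expand the second one and insert the Fourier coefficients of
  the first one.\<close>

lemma inner_radial:
  assumes r: "0 \<le> r" "r < 1" and s: "0 \<le> s" "s < 1"
  shows "(\<lambda>n. (cmod (coef n))\<^sup>2 * (r * s) ^ n) sums sqsum (r * s)"
    "(\<integral>\<zeta>. cnj (e (of_real r * \<zeta>)) * e (of_real s * \<zeta>) \<partial>circle) = of_real (sqsum (r * s))"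
proof -
  have "(\<lambda>n. coef n * of_real s ^ n * (cnj (coef n) * of_real r ^ n)) sums (\<integral>\<zeta>. cnj (e (of_real r * \<zeta>)) * e (of_real s * \<zeta>) \<partial>circle)"
    using integral_mult_radial[OF _ s, of "\<lambda>\<zeta>. cnj (e (of_real r * \<zeta>))"] integrable_radial[OF r]
    by (simp add: fourier_radial[OF r])
  also have "(\<lambda>n. coef n * of_real s ^ n * (cnj (coef n) * of_real r ^ n)) = (\<lambda>n. of_real ((cmod (coef n))\<^sup>2 * (r * s) ^ n))"
    by (rule ext, subst of_real_mult, subst complex_norm_square) (simp add: power_mult_distrib)
  finally have *: "(\<lambda>n. complex_of_real ((cmod (coef n))\<^sup>2 * (r * s) ^ n)) sums (\<integral>\<zeta>. cnj (e (of_real r * \<zeta>)) * e (of_real s * \<zeta>) \<partial>circle)" .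
  then have "summable (\<lambda>n. complex_of_real ((cmod (coef n))\<^sup>2 * (r * s) ^ n))" by (rule sums_summable)
  then have "summable (\<lambda>n. (cmod (coef n))\<^sup>2 * (r * s) ^ n)" by (simp only: summable_complex_of_real)
  then show 1: "(\<lambda>n. (cmod (coef n))\<^sup>2 * (r * s) ^ n) sums sqsum (r * s)"
    unfolding sqsum_def by (rule summable_sums)
  from sums_unique2[OF * sums_of_real[OF this]]
  show "(\<integral>\<zeta>. cnj (e (of_real r * \<zeta>)) * e (of_real s * \<zeta>) \<partial>circle) = of_real (sqsum (r * s))" .
qed

lemma sqsum_mono:
  assumes "0 \<le> s" "s \<le> t" "t < 1"
  shows "sqsum s \<le> sqsum t"
proof -
  have sq: "sqrt s * sqrt s = s" "sqrt t * sqrt t = t" "sqrt s < 1" "sqrt t < 1" using assms by auto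
  have "(\<lambda>n. (cmod (coef n))\<^sup>2 * s ^ n) sums sqsum s" "(\<lambda>n. (cmod (coef n))\<^sup>2 * t ^ n) sums sqsum t"
    using inner_radial(1)[of "sqrt s" "sqrt s"] inner_radial(1)[of "sqrt t" "sqrt t"] assms sq by auto
  then show ?thesis
    by (rule sums_le[rotated]) (use assms in \<open>auto intro!: mult_left_mono power_mono\<close>)
qed

lemma integral_radial_square:
  assumes r: "0 \<le> r" "r < 1"
  shows "integrable circle (\<lambda>\<zeta>. (cmod (e (of_real r * \<zeta>)))\<^sup>2)"
    "(\<integral>\<zeta>. (cmod (e (of_real r * \<zeta>)))\<^sup>2 \<partial>circle) = sqsum (r * r)"
proof -
  have "complex_of_real (\<integral>\<zeta>. (cmod (e (of_real r * \<zeta>)))\<^sup>2 \<partial>circle) = (\<integral>\<zeta>. of_real ((cmod (e (of_real r * \<zeta>)))\<^sup>2) \<partial>circle)"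
    by (rule integral_complex_of_real[symmetric])
  also have "\<dots> = of_real (sqsum (r * r))"
    unfolding complex_norm_square inner_radial(2)[OF r r, symmetric] by (simp add: mult.commute)
  finally show "(\<integral>\<zeta>. (cmod (e (of_real r * \<zeta>)))\<^sup>2 \<partial>circle) = sqsum (r * r)"
    by (simp only: of_real_eq_iff)
  show "integrable circle (\<lambda>\<zeta>. (cmod (e (of_real r * \<zeta>)))\<^sup>2)"
    by (rule circle.integrable_const_bound[of _ "B\<^sup>2"])
      (use assms bounded[OF norm_radial[OF assms]] measurable_radial in \<open>auto intro!: power_mono\<close>)
qed

lemma sqsum_le:
  assumes "0 \<le> t" "t < 1"
  shows "sqsum t \<le> B\<^sup>2"
proof -
  have sq: "sqrt t * sqrt t = t" "0 \<le> sqrt t" "sqrt t < 1" using assms by auto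
  have "sqsum t = (\<integral>\<zeta>. (cmod (e (of_real (sqrt t) * \<zeta>)))\<^sup>2 \<partial>circle)"
    using integral_radial_square(2)[OF sq(2,3)] sq(1) by simp
  also have "\<dots> \<le> (\<integral>\<zeta>. B\<^sup>2 \<partial>circle)"
    by (rule integral_mono[OF integral_radial_square(1)[OF sq(2,3)]])
      (use bounded[OF norm_radial[OF sq(2,3)]] in \<open>auto intro!: power_mono\<close>)
  finally show ?thesis by (simp add: circle.prob_space)
qed

lemma integral_radial_diff:
  assumes r: "0 \<le> r" "r < 1" and s: "0 \<le> s" "s < 1"
  shows "integrable circle (\<lambda>\<zeta>. (cmod (e (of_real s * \<zeta>) - e (of_real r * \<zeta>)))\<^sup>2)"
    "(\<integral>\<zeta>. (cmod (e (of_real s * \<zeta>) - e (of_real r * \<zeta>)))\<^sup>2 \<partial>circle) = sqsum (s * s) + sqsum (r * r) - 2 * sqsum (r * s)"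
proof -
  let ?f = "\<lambda>\<zeta>. cnj (e (of_real r * \<zeta>)) * e (of_real s * \<zeta>)"
  have eq: "(cmod (x - y))\<^sup>2 = (cmod x)\<^sup>2 + (cmod y)\<^sup>2 - 2 * Re (cnj y * x)" for x y
    by (simp add: cmod_power2) (simp add: algebra_simps power2_eq_square)
  have i: "integrable circle ?f"
    by (rule integrable_mult_bounded[of _ _ _ B])
      (use integrable_radial[OF r] bounded[OF norm_radial[OF s]] measurable_radial[OF s] in auto)
  have i2: "integrable circle (\<lambda>\<zeta>. 2 * Re (?f \<zeta>))" by (intro integrable_mult_right integrable_Re i)
  note sq = integral_radial_square(1)[OF r] integral_radial_square(1)[OF s]
  show "integrable circle (\<lambda>\<zeta>. (cmod (e (of_real s * \<zeta>) - e (of_real r * \<zeta>)))\<^sup>2)"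
    unfolding eq by (intro Bochner_Integration.integrable_diff Bochner_Integration.integrable_add sq i2)
  have "(\<integral>\<zeta>. (cmod (e (of_real s * \<zeta>) - e (of_real r * \<zeta>)))\<^sup>2 \<partial>circle) =
    sqsum (s * s) + sqsum (r * r) - (\<integral>\<zeta>. 2 * Re (?f \<zeta>) \<partial>circle)"
    unfolding eq integral_radial_square(2)[OF r, symmetric] integral_radial_square(2)[OF s, symmetric]
    by (subst Bochner_Integration.integral_diff[OF Bochner_Integration.integrable_add[OF sq(2,1)] i2],
      subst Bochner_Integration.integral_add[OF sq(2,1)]) simp
  also have "(\<integral>\<zeta>. 2 * Re (?f \<zeta>) \<partial>circle) = 2 * sqsum (r * s)"
    by (subst integral_mult_right_zero, subst integral_Re[OF i]) (simp add: inner_radial(2)[OF r s])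
  finally show "(\<integral>\<zeta>. (cmod (e (of_real s * \<zeta>) - e (of_real r * \<zeta>)))\<^sup>2 \<partial>circle) = sqsum (s * s) + sqsum (r * r) - 2 * sqsum (r * s)" .
qed

text \<open>The means \<open>sqsum (r * r)\<close> increase to a finite limit, so the dilations of \<open>e\<close> are Cauchy in
  $L^2$; a fast subsequence converges almost everywhere.\<close>

lemma boundary_function:
  obtains v R where "v \<in> borel_measurable circle" "\<And>n::nat. 0 \<le> R n" "\<And>n. R n < 1" "R \<longlonglongrightarrow> 1"
    "AE \<zeta> in circle. (\<lambda>n. e (of_real (R n) * \<zeta>)) \<longlonglongrightarrow> v \<zeta>"
proof -
  define S where "S = Sup (sqsum ` {0..<1})"
  have bdd: "bdd_above (sqsum ` {0..<1})" by (rule bdd_aboveI2[of _ _ "B\<^sup>2"]) (use sqsum_le in auto)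
  have MS: "sqsum t \<le> S" if "0 \<le> t" "t < 1" for t
    unfolding S_def by (rule cSUP_upper[OF _ bdd]) (use that in auto)
  \<comment> \<open>Being within 4^(-n) of the supremum makes consecutive L^2 distances of order
    2^(-n), which is summable. The lower bound 1 - 1/(n+1) forces R to tend to 1 even when
    \<open>sqsum\<close> is constant.\<close>
  have "\<exists>R. 0 \<le> R \<and> 1 - 1 / real (Suc n) \<le> R \<and> R < 1 \<and> S - (1/4) ^ n \<le> sqsum (R * R)" for n
  proof -
    have "S - (1/4) ^ n < S" by simp
    then obtain t where t: "0 \<le> t" "t < 1" "S - (1/4) ^ n < sqsum t"
      unfolding S_def using less_cSUP_iff[OF _ bdd] by fastforce
    define R where "R = max (sqrt t) (1 - 1 / real (Suc n))"
    have R: "0 \<le> R" "R < 1" "sqrt t \<le> R" using t by (auto simp: R_def max_def)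
    then have "t \<le> R * R" "R * R < 1" 
      using t mult_mono[of "sqrt t" R "sqrt t" R] mult_strict_mono'[of R 1 R 1] by auto
    then have "sqsum t \<le> sqsum (R * R)" using t by (intro sqsum_mono) auto
    then show ?thesis using R t by (intro exI[of _ R]) (auto simp: R_def)
  qed
  then obtain R where R: "\<And>n. 0 \<le> R n" "\<And>n. 1 - 1 / real (Suc n) \<le> R n" "\<And>n. R n < 1"
    "\<And>n. S - (1/4) ^ n \<le> sqsum (R n * R n)" by metis
  define d where "d n \<zeta> = cmod (e (of_real (R (Suc n)) * \<zeta>) - e (of_real (R n) * \<zeta>))" for n \<zeta>
  note [measurable] = measurable_radial[OF R(1,3)]
  have md [measurable]: "d n \<in> borel_measurable circle" for n
    unfolding d_def by measurable
  have lt1: "R n * R m < 1" for n m using mult_strict_mono'[of "R n" 1 "R m" 1] R by auto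
  have d2: "(\<integral>\<zeta>. (d n \<zeta>)\<^sup>2 \<partial>circle) \<le> 2 * (1/4) ^ n" for n
  proof -
    \<comment> \<open>\<open>R\<close> need not be increasing. The mixed product dominates the
      square of the smaller radius, and monotonicity of \<open>sqsum\<close> applies.\<close>
    have "S - (1/4) ^ n \<le> sqsum (R n * R (Suc n))"
    proof (cases "R n \<le> R (Suc n)")
      case True
      have "sqsum (R n * R n) \<le> sqsum (R n * R (Suc n))"
        by (rule sqsum_mono) (use R lt1 True in \<open>auto intro!: mult_left_mono\<close>)
      then show ?thesis using R(4)[of n] by simp
    next
      case False
      have "sqsum (R (Suc n) * R (Suc n)) \<le> sqsum (R n * R (Suc n))"
        by (rule sqsum_mono) (use R lt1 False in \<open>auto intro!: mult_right_mono\<close>)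
      moreover have "(1/4::real) ^ Suc n \<le> (1/4) ^ n" by simp
      ultimately show ?thesis using R(4)[of "Suc n"] by linarith
    qed
    moreover have "sqsum (R n * R n) \<le> S" "sqsum (R (Suc n) * R (Suc n)) \<le> S"
      by (auto intro!: MS lt1 mult_nonneg_nonneg R)
    ultimately show ?thesis unfolding d_def integral_radial_diff(2)[OF R(1,3) R(1,3)] by simp
  qed
  have d1: "(\<integral>\<^sup>+\<zeta>. ennreal (d n \<zeta>) \<partial>circle) \<le> ennreal (2 * (1/2) ^ n)" for n
  proof -
    let ?q = "(1/2::real) ^ n"
    have q: "?q > 0" "(1/4::real) ^ n = ?q\<^sup>2" by (auto simp: power2_eq_square simp flip: power_mult_distrib)
    have i2: "integrable circle (\<lambda>\<zeta>. (d n \<zeta>)\<^sup>2)" unfolding d_def by (intro integral_radial_diff R)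
    \<comment> \<open>Young's inequality with weight q = 2^(-n) passes from the L^2 bound 2 q^2 to
      the L^1 bound 2 q.\<close>
    have le: "d n \<zeta> \<le> ?q + (1 / ?q / 2) * (d n \<zeta>)\<^sup>2" for \<zeta>
    proof -
      have "0 \<le> (?q - d n \<zeta>)\<^sup>2" "0 \<le> ?q\<^sup>2" by simp_all
      then have "2 * ?q * d n \<zeta> \<le> 2 * ?q\<^sup>2 + (d n \<zeta>)\<^sup>2" unfolding power2_diff by linarith
      then have "2 * ?q * d n \<zeta> / (2 * ?q) \<le> (2 * ?q\<^sup>2 + (d n \<zeta>)\<^sup>2) / (2 * ?q)"
        using q(1) by (intro divide_right_mono) auto
      then show ?thesis using q(1) by (simp add: add_divide_distrib power2_eq_square)
    qed
    have "(\<integral>\<^sup>+\<zeta>. ennreal (d n \<zeta>) \<partial>circle) \<le> (\<integral>\<^sup>+\<zeta>. ennreal (?q + (1 / ?q / 2) * (d n \<zeta>)\<^sup>2) \<partial>circle)"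
      by (intro nn_integral_mono ennreal_leI le)
    also have "\<dots> = ennreal (\<integral>\<zeta>. ?q + (1 / ?q / 2) * (d n \<zeta>)\<^sup>2 \<partial>circle)"
      by (rule nn_integral_eq_integral) (use i2 q(1) in auto)
    also have "(\<integral>\<zeta>. ?q + (1 / ?q / 2) * (d n \<zeta>)\<^sup>2 \<partial>circle) = ?q + (1 / ?q / 2) * (\<integral>\<zeta>. (d n \<zeta>)\<^sup>2 \<partial>circle)"
      by (subst Bochner_Integration.integral_add)
        (use i2 in \<open>auto simp: circle.prob_space\<close>)
    also have "ennreal \<dots> \<le> ennreal (?q + (1 / ?q / 2) * (2 * ?q\<^sup>2))"
      using d2[of n] q by (intro ennreal_leI add_left_mono mult_left_mono) auto
    also have "?q + (1 / ?q / 2) * (2 * ?q\<^sup>2) = 2 * ?q" using q(1) by (simp add: power2_eq_square)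
    finally show ?thesis .
  qed
  have "(\<integral>\<^sup>+\<zeta>. (\<Sum>n. ennreal (d n \<zeta>)) \<partial>circle) = (\<Sum>n. \<integral>\<^sup>+\<zeta>. ennreal (d n \<zeta>) \<partial>circle)"
    by (rule nn_integral_suminf) measurable
  also have "\<dots> \<le> (\<Sum>n. ennreal (2 * (1/2) ^ n))"
    by (intro suminf_le d1 summableI)
  also have "\<dots> = ennreal (\<Sum>n. 2 * (1/2) ^ n)"
    by (rule suminf_ennreal2) (auto intro!: summable_mult summable_geometric)
  finally have "(\<integral>\<^sup>+\<zeta>. (\<Sum>n. ennreal (d n \<zeta>)) \<partial>circle) \<noteq> \<infinity>"
    by (auto simp: top_unique)
  then have "AE \<zeta> in circle. (\<Sum>n. ennreal (d n \<zeta>)) \<noteq> \<infinity>"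
    by (intro nn_integral_PInf_AE) measurable
  then have conv: "AE \<zeta> in circle. convergent (\<lambda>n. e (of_real (R n) * \<zeta>))"
  proof eventually_elim
    case (elim \<zeta>)
    then have "summable (\<lambda>n. d n \<zeta>)"
      by (intro summable_suminf_not_top) (auto simp: d_def)
    then have "summable (\<lambda>n. e (of_real (R (Suc n)) * \<zeta>) - e (of_real (R n) * \<zeta>))"
      unfolding d_def by (rule summable_norm_cancel)
    then have "convergent (\<lambda>n. \<Sum>i<n. e (of_real (R (Suc i)) * \<zeta>) - e (of_real (R i) * \<zeta>))"
      by (simp add: summable_iff_convergent)
    then have "convergent (\<lambda>n. e (of_real (R n) * \<zeta>) - e (of_real (R 0) * \<zeta>))"
      by (simp only: sum_lessThan_telescope[of "\<lambda>n. e (of_real (R n) * \<zeta>)"])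
    then show ?case by (simp only: convergent_diff_const_right_iff)
  qed
  show thesis
  proof (rule that[of "\<lambda>\<zeta>. lim (\<lambda>n. e (of_real (R n) * \<zeta>))" R])
    show "(\<lambda>\<zeta>. lim (\<lambda>n. e (of_real (R n) * \<zeta>))) \<in> borel_measurable circle"
      by (intro borel_measurable_lim_metric measurable_radial R)
    show "AE \<zeta> in circle. (\<lambda>n. e (of_real (R n) * \<zeta>)) \<longlonglongrightarrow> lim (\<lambda>n. e (of_real (R n) * \<zeta>))"
      using conv by eventually_elim (simp add: convergent_LIMSEQ_iff)
    show "R \<longlonglongrightarrow> 1"
    proof (rule tendsto_sandwich[OF _ _ _ tendsto_const])
      have "(\<lambda>n. 1 - 1 / real (Suc n)) \<longlonglongrightarrow> 1 - 0"
        by (intro tendsto_diff tendsto_const LIMSEQ_Suc lim_1_over_n)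
      then show "(\<lambda>n. 1 - 1 / real (Suc n)) \<longlonglongrightarrow> 1" by simp
    qed (use R in \<open>auto intro!: always_eventually less_imp_le\<close>)
  qed (use R in auto)
qed

text \<open>All three claims are limits of statements about the dilations, by dominated convergence
  with majorant |g| B. The last one says that multiplication by \<open>v\<close> on the circle is
  multiplication by \<open>e\<close> in the disk.\<close>

lemma boundary_mult:
  assumes v: "v \<in> borel_measurable circle" and R: "\<And>n::nat. 0 \<le> R n" "\<And>n. R n < 1" "R \<longlonglongrightarrow> 1"
    and lim: "AE \<zeta> in circle. (\<lambda>n. e (of_real (R n) * \<zeta>)) \<longlonglongrightarrow> v \<zeta>"
  shows "AE \<zeta> in circle. cmod (v \<zeta>) \<le> B"
    "\<And>f. f \<in> hardy2 \<Longrightarrow> (\<lambda>\<zeta>. f \<zeta> * v \<zeta>) \<in> hardy2"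
    "\<And>f z. f \<in> hardy2 \<Longrightarrow> cmod z < 1 \<Longrightarrow> disk_ext (\<lambda>\<zeta>. f \<zeta> * v \<zeta>) z = e z * disk_ext f z"
proof -
  have Bn: "0 \<le> B" using bounded[of 0] norm_ge_zero[of "e 0"] by (simp del: norm_ge_zero)
  show vB: "AE \<zeta> in circle. cmod (v \<zeta>) \<le> B"
    using lim AE_space
  proof eventually_elim
    case (elim \<zeta>)
    show ?case
      by (rule LIMSEQ_le_const2[OF tendsto_norm[OF elim(1)]])
        (use bounded[OF norm_radial[OF R(1,2) elim(2)]] in auto)
  qed
  have L: "(\<lambda>n. \<integral>\<zeta>. g \<zeta> * e (of_real (R n) * \<zeta>) \<partial>circle) \<longlonglongrightarrow> (\<integral>\<zeta>. g \<zeta> * v \<zeta> \<partial>circle)"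
    if g: "integrable circle g" for g
  proof (rule integral_dominated_convergence)
    show "integrable circle (\<lambda>\<zeta>. cmod (g \<zeta>) * B)" using g by auto
    show "AE \<zeta> in circle. (\<lambda>n. g \<zeta> * e (of_real (R n) * \<zeta>)) \<longlonglongrightarrow> g \<zeta> * v \<zeta>"
      using lim by eventually_elim (intro tendsto_intros)
    show "AE \<zeta> in circle. norm (g \<zeta> * e (of_real (R n) * \<zeta>)) \<le> cmod (g \<zeta>) * B" for n
      by (rule AE_I2, subst norm_mult, intro mult_left_mono bounded norm_radial R) auto
  qed (use g v measurable_radial[OF R(1,2)] in auto)
  fix f assume f: "f \<in> hardy2"
  then have fi: "integrable circle f" and f0: "\<forall>n\<ge>1. (\<integral>\<zeta>. f \<zeta> * \<zeta> ^ n \<partial>circle) = 0"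
    by (auto simp: hardy2_def L2_integrable)
  show "(\<lambda>\<zeta>. f \<zeta> * v \<zeta>) \<in> hardy2"
  proof -
    have fm: "f \<in> borel_measurable circle" and f2: "integrable circle (\<lambda>\<zeta>. (cmod (f \<zeta>))\<^sup>2)"
      using f by (auto simp: hardy2_def L2_def)
    have "integrable circle (\<lambda>\<zeta>. (cmod (f \<zeta> * v \<zeta>))\<^sup>2)"
    proof (rule Bochner_Integration.integrable_bound)
      show "integrable circle (\<lambda>\<zeta>. (cmod (f \<zeta>))\<^sup>2 * B\<^sup>2)" using f2 by auto
      show "AE \<zeta> in circle. norm ((cmod (f \<zeta> * v \<zeta>))\<^sup>2) \<le> norm ((cmod (f \<zeta>))\<^sup>2 * B\<^sup>2)"
        using vB by eventually_elim (auto simp: norm_mult power_mult_distrib intro!: mult_left_mono power_mono)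
    qed (use fm v in measurable)
    moreover have "(\<integral>\<zeta>. f \<zeta> * v \<zeta> * \<zeta> ^ n \<partial>circle) = 0" if n: "n \<ge> 1" for n
    proof -
      have "integrable circle (\<lambda>\<zeta>. f \<zeta> * \<zeta> ^ n)"
        by (rule integrable_mult_bounded[OF fi, of _ 1]) (auto simp: norm_circle norm_power)
      from L[OF this] have "(\<integral>\<zeta>. f \<zeta> * \<zeta> ^ n * v \<zeta> \<partial>circle) = 0"
        unfolding integral_radial_mult_zero[OF fi f0 R(1,2) n] using LIMSEQ_unique tendsto_const by blast
      then show ?thesis by (simp add: mult_ac)
    qed
    ultimately show ?thesis using fm v by (auto simp: hardy2_def L2_def)
  qed
  fix z :: complex assume z: "cmod z < 1"
  have "(\<lambda>n. disk_ext (\<lambda>\<zeta>. f \<zeta> * e (of_real (R n) * \<zeta>)) z) \<longlonglongrightarrow> disk_ext (\<lambda>\<zeta>. f \<zeta> * v \<zeta>) z"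
    using L[OF integrable_cauchy[OF fi z]] by (simp add: disk_ext_def)
  then have 1: "(\<lambda>n. e (of_real (R n) * z) * disk_ext f z) \<longlonglongrightarrow> disk_ext (\<lambda>\<zeta>. f \<zeta> * v \<zeta>) z"
    unfolding disk_ext_mult_radial[OF fi f0 R(1,2) z] .
  have "isCont e z"
    using holo z continuous_on_interior[of "ball 0 1" e z] by (simp add: holomorphic_on_imp_continuous_on)
  moreover have "(\<lambda>n. of_real (R n) * z) \<longlonglongrightarrow> of_real 1 * z"
    by (intro tendsto_intros R)
  ultimately have "(\<lambda>n. e (of_real (R n) * z)) \<longlonglongrightarrow> e z"
    using isCont_tendsto_compose by fastforce
  then have "(\<lambda>n. e (of_real (R n) * z) * disk_ext f z) \<longlonglongrightarrow> e z * disk_ext f z"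
    by (intro tendsto_intros)
  with 1 show "disk_ext (\<lambda>\<zeta>. f \<zeta> * v \<zeta>) z = e z * disk_ext f z"
    using LIMSEQ_unique by blast
qed

end

section \<open>Outer functions and the Toeplitz form\<close>

lemma L2_measurable: "f \<in> L2 M \<Longrightarrow> f \<in> borel_measurable M"
  by (simp add: L2_def)

lemma L2_square: "f \<in> L2 M \<Longrightarrow> integrable M (\<lambda>x. (cmod (f x))\<^sup>2)"
  by (simp add: L2_def)

lemma L2_cmult: "f \<in> L2 M \<Longrightarrow> (\<lambda>x. c * f x) \<in> L2 M"
  by (auto simp: L2_def norm_mult power_mult_distrib)

lemma L2_add:
  assumes f: "f \<in> L2 M" and g: "g \<in> L2 M"
  shows "(\<lambda>x. f x + g x) \<in> L2 M"
proof -
  note [measurable] = L2_measurable[OF f] L2_measurable[OF g]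
  have "integrable M (\<lambda>x. (cmod (f x + g x))\<^sup>2)"
  proof (rule Bochner_Integration.integrable_bound)
    show "integrable M (\<lambda>x. 2 * (cmod (f x))\<^sup>2 + 2 * (cmod (g x))\<^sup>2)"
      using L2_square[OF f] L2_square[OF g] by auto
    show "AE x in M. norm ((cmod (f x + g x))\<^sup>2) \<le> norm (2 * (cmod (f x))\<^sup>2 + 2 * (cmod (g x))\<^sup>2)"
    proof (rule AE_I2)
      fix x
      have "(cmod (f x + g x))\<^sup>2 \<le> (cmod (f x) + cmod (g x))\<^sup>2"
        by (intro power_mono norm_triangle_ineq) auto
      also have "\<dots> \<le> 2 * (cmod (f x))\<^sup>2 + 2 * (cmod (g x))\<^sup>2"
        using zero_le_power2[of "cmod (f x) - cmod (g x)"] unfolding power2_diff power2_sum by linarith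
      finally show "norm ((cmod (f x + g x))\<^sup>2) \<le> norm (2 * (cmod (f x))\<^sup>2 + 2 * (cmod (g x))\<^sup>2)" by simp
    qed
  qed measurable
  then show ?thesis by (simp add: L2_def)
qed

lemma L2_lincomb: "f \<in> L2 M \<Longrightarrow> g \<in> L2 M \<Longrightarrow> (\<lambda>x. a * f x + b * g x) \<in> L2 M"
  by (intro L2_add L2_cmult)

lemma L2_integrable_inner:
  assumes f: "f \<in> L2 M" and g: "g \<in> L2 M"
  shows "integrable M (\<lambda>x. f x * cnj (g x))"
proof (rule Bochner_Integration.integrable_bound)
  note [measurable] = L2_measurable[OF f] L2_measurable[OF g]
  show "(\<lambda>x. f x * cnj (g x)) \<in> borel_measurable M" by measurable
  show "integrable M (\<lambda>x. (cmod (f x))\<^sup>2 + (cmod (g x))\<^sup>2)"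
    using L2_square[OF f] L2_square[OF g] by auto
  show "AE x in M. norm (f x * cnj (g x)) \<le> norm ((cmod (f x))\<^sup>2 + (cmod (g x))\<^sup>2)"
  proof (rule AE_I2)
    fix x
    have "0 \<le> cmod (f x) * cmod (g x)" by simp
    then have "cmod (f x) * cmod (g x) \<le> (cmod (f x))\<^sup>2 + (cmod (g x))\<^sup>2"
      using zero_le_power2[of "cmod (f x) - cmod (g x)"] unfolding power2_diff by linarith
    then show "norm (f x * cnj (g x)) \<le> norm ((cmod (f x))\<^sup>2 + (cmod (g x))\<^sup>2)" by (simp add: norm_mult)
  qed
qed

lemma L2_inner_cnj: "L2_inner M g f = cnj (L2_inner M f g)"
  unfolding L2_inner_def by (simp add: mult.commute flip: Bochner_Integration.integral_cnj)

lemma L2_inner_lincomb_left: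
  assumes "f \<in> L2 M" "g \<in> L2 M" "h \<in> L2 M"
  shows "L2_inner M (\<lambda>x. a * f x + b * g x) h = a * L2_inner M f h + b * L2_inner M g h"
proof -
  have "L2_inner M (\<lambda>x. a * f x + b * g x) h = (\<integral>x. a * (f x * cnj (h x)) + b * (g x * cnj (h x)) \<partial>M)"
    unfolding L2_inner_def by (simp add: distrib_right mult.assoc)
  also have "\<dots> = a * L2_inner M f h + b * L2_inner M g h"
    unfolding L2_inner_def using assms
    by (subst Bochner_Integration.integral_add) (auto intro: L2_integrable_inner)
  finally show ?thesis .
qed

lemma L2_inner_lincomb_right:
  assumes "f \<in> L2 M" "g \<in> L2 M" "h \<in> L2 M"
  shows "L2_inner M h (\<lambda>x. a * f x + b * g x) = cnj a * L2_inner M h f + cnj b * L2_inner M h g"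
  by (subst (1 2 3) L2_inner_cnj) (simp add: L2_inner_lincomb_left[OF assms])

lemma L2_inner_self: "L2_inner M f f = of_real (\<integral>x. (cmod (f x))\<^sup>2 \<partial>M)"
  unfolding L2_inner_def complex_norm_square[symmetric] by (rule integral_complex_of_real)

lemma L2_inner_cong_AE:
  assumes "f \<in> L2 M" "f' \<in> L2 M" "g \<in> L2 M" "g' \<in> L2 M" "AE x in M. f x = f' x" "AE x in M. g x = g' x"
  shows "L2_inner M f g = L2_inner M f' g'"
  unfolding L2_inner_def
proof (rule integral_cong_AE)
  show "AE x in M. f x * cnj (g x) = f' x * cnj (g' x)"
    using assms(5,6) by eventually_elim simp
qed (rule borel_measurable_integrable[OF L2_integrable_inner]; fact)+

lemma hardy2_L2: "f \<in> hardy2 \<Longrightarrow> f \<in> L2 circle"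
  by (simp add: hardy2_def)

lemma hardy2_integrable: "f \<in> hardy2 \<Longrightarrow> integrable circle f"
  by (simp add: hardy2_L2 L2_integrable)

lemma hardy2_moment: "f \<in> hardy2 \<Longrightarrow> \<forall>n\<ge>1. (\<integral>\<zeta>. f \<zeta> * \<zeta> ^ n \<partial>circle) = 0"
  by (simp add: hardy2_def)

lemma integrable_mult_power:
  assumes "integrable circle f"
  shows "integrable circle (\<lambda>\<zeta>. f \<zeta> * \<zeta> ^ n)"
  by (rule integrable_mult_bounded[OF assms, of _ 1]) (auto simp: norm_circle norm_power)

lemma hardy2_lincomb:
  assumes f: "f \<in> hardy2" and g: "g \<in> hardy2"
  shows "(\<lambda>x. a * f x + b * g x) \<in> hardy2"
proof -
  have "(\<integral>\<zeta>. (a * f \<zeta> + b * g \<zeta>) * \<zeta> ^ n \<partial>circle) = 0" if n: "n \<ge> 1" for n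
  proof -
    have "(\<integral>\<zeta>. (a * f \<zeta> + b * g \<zeta>) * \<zeta> ^ n \<partial>circle) = (\<integral>\<zeta>. a * (f \<zeta> * \<zeta> ^ n) + b * (g \<zeta> * \<zeta> ^ n) \<partial>circle)"
      by (simp add: distrib_right mult.assoc)
    also have "\<dots> = a * (\<integral>\<zeta>. f \<zeta> * \<zeta> ^ n \<partial>circle) + b * (\<integral>\<zeta>. g \<zeta> * \<zeta> ^ n \<partial>circle)"
      by (subst Bochner_Integration.integral_add
          [OF integrable_mult_right[OF integrable_mult_power[OF hardy2_integrable[OF f]]]
            integrable_mult_right[OF integrable_mult_power[OF hardy2_integrable[OF g]]]])
        (simp only: integral_mult_right_zero)
    finally show ?thesis using hardy2_moment[OF f] hardy2_moment[OF g] n by simp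
  qed
  then show ?thesis using f g by (auto simp: hardy2_def L2_lincomb)
qed

lemma disk_ext_lincomb:
  assumes "integrable circle f" "integrable circle g" "cmod z < 1"
  shows "disk_ext (\<lambda>x. a * f x + b * g x) z = a * disk_ext f z + b * disk_ext g z"
proof -
  have "disk_ext (\<lambda>x. a * f x + b * g x) z = (\<integral>\<zeta>. a * (f \<zeta> / (1 - z * cnj \<zeta>)) + b * (g \<zeta> / (1 - z * cnj \<zeta>)) \<partial>circle)"
    unfolding disk_ext_def by (simp add: add_divide_distrib)
  also have "\<dots> = a * disk_ext f z + b * disk_ext g z"
    unfolding disk_ext_def
    by (subst Bochner_Integration.integral_add) (simp_all add: integrable_cauchy assms del: times_divide_eq_right)
  finally show ?thesis .
qed

lemma hardy2_eq_AE:
  assumes f: "f \<in> hardy2" and g: "g \<in> hardy2" and eq: "\<And>z. cmod z < 1 \<Longrightarrow> disk_ext f z = disk_ext g z"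
  shows "AE \<zeta> in circle. f \<zeta> = g \<zeta>"
proof -
  have d: "(\<lambda>x. 1 * f x + (-1) * g x) \<in> hardy2" by (rule hardy2_lincomb[OF f g])
  have "AE \<zeta> in circle. 1 * f \<zeta> + (-1) * g \<zeta> = 0"
    by (rule hardy_AE_zero[OF hardy2_integrable[OF d] hardy2_moment[OF d]])
      (subst disk_ext_lincomb[OF hardy2_integrable[OF f] hardy2_integrable[OF g]], auto simp: eq)
  then show ?thesis by eventually_elim simp
qed

lemma disk_ext_cong_AE:
  assumes "f \<in> borel_measurable circle" "g \<in> borel_measurable circle" "AE \<zeta> in circle. f \<zeta> = g \<zeta>"
  shows "disk_ext f z = disk_ext g z"
  unfolding disk_ext_def by (rule integral_cong_AE) (use assms in auto)

section \<open>Szego kernels, the reproducing kernels of the Hardy space\<close>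

definition szego :: "complex \<Rightarrow> complex \<Rightarrow> complex" where
  "szego w \<zeta> = 1 / (1 - cnj w * \<zeta>)"

lemma L2_inner_szego: "L2_inner circle f (szego w) = disk_ext f w"
  unfolding L2_inner_def disk_ext_def szego_def by simp

lemma szego_bound:
  assumes "cmod w < 1" "\<zeta> \<in> space circle"
  shows "cmod (szego w \<zeta>) \<le> 1 / (1 - cmod w)"
proof -
  have "1 - cmod w \<le> cmod (cnj (1 - w * cnj \<zeta>))"
    unfolding complex_mod_cnj by (rule norm_cauchy_denom(1)[OF assms(1) norm_circle[OF assms(2)]])
  then show ?thesis using assms(1) by (simp add: szego_def norm_divide frac_le)
qed

lemma szego_hardy2:
  assumes w: "cmod w < 1"
  shows "szego w \<in> hardy2"
proof -
  have m: "szego w \<in> borel_measurable circle" unfolding szego_def by measurable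
  have "integrable circle (\<lambda>x. (cmod (szego w x))\<^sup>2)"
    by (rule circle.integrable_const_bound[of _ "(1 / (1 - cmod w))\<^sup>2"])
      (use m szego_bound[OF w] in \<open>auto simp del: power_divide intro!: power_mono\<close>)
  moreover have "(\<integral>\<zeta>. szego w \<zeta> * \<zeta> ^ n \<partial>circle) = 0" if n: "n \<ge> 1" for n
  proof -
    have i: "integrable circle (\<lambda>\<zeta>. \<zeta> ^ n)"
      by (rule circle.integrable_const_bound[of _ 1]) (auto simp: norm_power norm_circle)
    have "(\<lambda>k. cnj w ^ k * 0) sums (\<integral>\<zeta>. \<zeta> ^ n / (1 - cnj w * \<zeta>) \<partial>circle)"
      using cauchy_series(1)[OF i, of "cnj w"] w n integral_circle_power by (simp flip: power_add)
    then show ?thesis using sums_unique2[OF _ sums_zero] by (simp add: szego_def)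
  qed
  ultimately show ?thesis using m by (simp add: hardy2_def L2_def)
qed

text \<open>The integrand is |k_w|^2, which is the Poisson kernel at \<open>w\<close> divided by 1 -
  |w|^2; the kernel has mass 1.\<close>

lemma disk_ext_szego_self:
  assumes w: "cmod w < 1"
  shows "disk_ext (szego w) w = 1 / (1 - (cmod w)\<^sup>2)"
proof -
  have "disk_ext (szego w) w = (\<integral>\<zeta>. of_real (poisson w \<zeta> / (1 - (cmod w)\<^sup>2)) \<partial>circle)"
    unfolding disk_ext_def
  proof (rule Bochner_Integration.integral_cong[OF refl])
    fix \<zeta>
    have "(cmod (1 - w * cnj \<zeta>))\<^sup>2 = (1 - w * cnj \<zeta>) * (1 - cnj w * \<zeta>)"
      by (subst complex_norm_square) simp
    moreover have "poisson w \<zeta> / (1 - (cmod w)\<^sup>2) = 1 / (cmod (1 - w * cnj \<zeta>))\<^sup>2"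
      using w by (simp add: poisson_def abs_square_eq_1)
    ultimately show "szego w \<zeta> / (1 - w * cnj \<zeta>) = of_real (poisson w \<zeta> / (1 - (cmod w)\<^sup>2))"
      by (simp add: szego_def mult.commute)
  qed
  also have "\<dots> = of_real ((\<integral>\<zeta>. poisson w \<zeta> \<partial>circle) / (1 - (cmod w)\<^sup>2))"
    by (simp only: integral_complex_of_real integral_divide_zero)
  finally show ?thesis by (simp add: integral_poisson[OF w])
qed

text \<open>The outer function whose squared boundary modulus is exp of \<open>\<rho>\<close>.
  Parametrizing by the logarithm makes reciprocals and quotients of outer functions correspond to
  negation and subtraction of \<open>\<rho>\<close>.\<close>

definition outer :: "(complex \<Rightarrow> real) \<Rightarrow> complex \<Rightarrow> complex" where
  "outer \<rho> z = exp (1 / 2 * (\<integral>\<zeta>. complex_of_real (\<rho> \<zeta>) * herglotz (z * cnj \<zeta>) \<partial>circle))"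

lemma outer_fun_eq: "outer_fun \<omega> lam = outer (\<lambda>\<zeta>. ln (\<omega> \<zeta> - lam))"
  by (simp add: fun_eq_iff outer_fun_def outer_def)

text \<open>The Herglotz kernel is twice the Cauchy kernel minus 1, so holomorphy of the exponent
  reduces to that of \<open>disk_ext\<close>.\<close>

lemma herglotz_integral:
  assumes \<rho>: "integrable circle \<rho>" and z: "cmod z < 1"
  shows "integrable circle (\<lambda>\<zeta>. complex_of_real (\<rho> \<zeta>) * herglotz (z * cnj \<zeta>))"
    "(\<integral>\<zeta>. complex_of_real (\<rho> \<zeta>) * herglotz (z * cnj \<zeta>) \<partial>circle) = 2 * disk_ext (\<lambda>\<zeta>. of_real (\<rho> \<zeta>)) z - of_real (\<integral>\<zeta>. \<rho> \<zeta> \<partial>circle)"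
proof -
  have i: "integrable circle (\<lambda>\<zeta>. complex_of_real (\<rho> \<zeta>))" using \<rho> by simp
  have i2: "integrable circle (\<lambda>\<zeta>. 2 * (of_real (\<rho> \<zeta>) / (1 - z * cnj \<zeta>)) - of_real (\<rho> \<zeta>))"
    by (intro Bochner_Integration.integrable_diff integrable_mult_right integrable_cauchy i z)
  have e: "complex_of_real (\<rho> \<zeta>) * herglotz (z * cnj \<zeta>) = 2 * (of_real (\<rho> \<zeta>) / (1 - z * cnj \<zeta>)) - of_real (\<rho> \<zeta>)"
    if "\<zeta> \<in> space circle" for \<zeta>
    using norm_cauchy_denom(2)[OF z norm_circle[OF that]] by (simp add: herglotz_def field_simps)
  show "integrable circle (\<lambda>\<zeta>. complex_of_real (\<rho> \<zeta>) * herglotz (z * cnj \<zeta>))"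
    by (rule Bochner_Integration.integrable_cong[OF refl e, THEN iffD2], assumption, rule i2)
  have "(\<integral>\<zeta>. complex_of_real (\<rho> \<zeta>) * herglotz (z * cnj \<zeta>) \<partial>circle) =
    (\<integral>\<zeta>. 2 * (of_real (\<rho> \<zeta>) / (1 - z * cnj \<zeta>)) - of_real (\<rho> \<zeta>) \<partial>circle)"
    by (rule Bochner_Integration.integral_cong[OF refl e])
  also have "\<dots> = 2 * disk_ext (\<lambda>\<zeta>. of_real (\<rho> \<zeta>)) z - of_real (\<integral>\<zeta>. \<rho> \<zeta> \<partial>circle)"
    unfolding disk_ext_def
    by (subst Bochner_Integration.integral_diff[OF integrable_mult_right[OF integrable_cauchy[OF i z]] i])
      (simp only: integral_mult_right_zero integral_complex_of_real)
  finally show "(\<integral>\<zeta>. complex_of_real (\<rho> \<zeta>) * herglotz (z * cnj \<zeta>) \<partial>circle) = 2 * disk_ext (\<lambda>\<zeta>. of_real (\<rho> \<zeta>)) z - of_real (\<integral>\<zeta>. \<rho> \<zeta> \<partial>circle)" .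
qed

lemma outer_holomorphic:
  assumes "integrable circle \<rho>"
  shows "outer \<rho> holomorphic_on ball 0 1"
proof -
  have "(\<lambda>z. exp (1 / 2 * (2 * disk_ext (\<lambda>\<zeta>. of_real (\<rho> \<zeta>)) z - of_real (\<integral>\<zeta>. \<rho> \<zeta> \<partial>circle)))) holomorphic_on ball 0 1"
    by (intro holomorphic_intros disk_ext_holomorphic) (use assms in simp)
  then show ?thesis
    by (rule holomorphic_transform) (simp only: outer_def herglotz_integral(2)[OF assms] mem_ball_0)
qed

text \<open>The real part of the Herglotz kernel is the Poisson kernel, and squaring the modulus
  cancels the factor 1/2 in the exponent.\<close>

lemma norm_outer:
  assumes "integrable circle \<rho>" "cmod z < 1"
  shows "(cmod (outer \<rho> z))\<^sup>2 = exp (\<integral>\<zeta>. \<rho> \<zeta> * poisson z \<zeta> \<partial>circle)"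
proof -
  have "(\<integral>\<zeta>. \<rho> \<zeta> * poisson z \<zeta> \<partial>circle) = (\<integral>\<zeta>. Re (complex_of_real (\<rho> \<zeta>) * herglotz (z * cnj \<zeta>)) \<partial>circle)"
    by (rule Bochner_Integration.integral_cong[OF refl]) (simp add: Re_herglotz[OF assms(2) norm_circle])
  also have "\<dots> = Re (\<integral>\<zeta>. complex_of_real (\<rho> \<zeta>) * herglotz (z * cnj \<zeta>) \<partial>circle)"
    by (rule integral_Re[OF herglotz_integral(1)[OF assms]])
  finally show ?thesis by (simp add: outer_def flip: exp_double)
qed

lemma outer_add:
  assumes "integrable circle \<rho>" "integrable circle \<sigma>" "cmod z < 1"
  shows "outer (\<lambda>\<zeta>. \<rho> \<zeta> + \<sigma> \<zeta>) z = outer \<rho> z * outer \<sigma> z"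
proof -
  have "(\<integral>\<zeta>. complex_of_real (\<rho> \<zeta> + \<sigma> \<zeta>) * herglotz (z * cnj \<zeta>) \<partial>circle) =
    (\<integral>\<zeta>. complex_of_real (\<rho> \<zeta>) * herglotz (z * cnj \<zeta>) \<partial>circle) + (\<integral>\<zeta>. complex_of_real (\<sigma> \<zeta>) * herglotz (z * cnj \<zeta>) \<partial>circle)"
    by (simp add: distrib_right Bochner_Integration.integral_add[OF herglotz_integral(1)[OF assms(1,3)] herglotz_integral(1)[OF assms(2,3)]])
  then show ?thesis by (simp add: outer_def add_divide_distrib exp_add)
qed

lemma outer_minus: "outer (\<lambda>\<zeta>. - \<rho> \<zeta>) z = 1 / outer \<rho> z"
  by (simp add: outer_def exp_minus inverse_eq_divide)

lemma outer_nonzero: "outer \<rho> z \<noteq> 0"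
  by (simp add: outer_def)

text \<open>An upper bound on \<open>\<rho>\<close> bounds its Poisson integrals, hence the outer
  function, so a boundary function exists. Its modulus is identified by \<open>norm_outer\<close>:
  the Poisson means of \<open>\<rho>\<close> converge to \<open>\<rho>\<close> in L^1, hence almost
  everywhere along a further subsequence of the same radii.\<close>

lemma outer_boundary:
  assumes \<rho>: "integrable circle \<rho>" and b: "AE \<zeta> in circle. \<rho> \<zeta> \<le> b"
  obtains v where "v \<in> borel_measurable circle" "AE \<zeta> in circle. (cmod (v \<zeta>))\<^sup>2 = exp (\<rho> \<zeta>)"
    "\<And>f. f \<in> hardy2 \<Longrightarrow> (\<lambda>\<zeta>. f \<zeta> * v \<zeta>) \<in> hardy2"
    "\<And>f z. f \<in> hardy2 \<Longrightarrow> cmod z < 1 \<Longrightarrow> disk_ext (\<lambda>\<zeta>. f \<zeta> * v \<zeta>) z = outer \<rho> z * disk_ext f z"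
proof -
  have i\<rho>: "integrable circle (\<lambda>\<zeta>. complex_of_real (\<rho> \<zeta>))" using \<rho> by simp
  have ip: "integrable circle (\<lambda>\<zeta>. \<rho> \<zeta> * poisson z \<zeta>)" if z: "cmod z < 1" for z
    using integrable_poisson[OF i\<rho> z] by (simp only: of_real_mult[symmetric] complex_of_real_integrable_eq)
  have bd: "cmod (outer \<rho> z) \<le> exp (b / 2)" if z: "cmod z < 1" for z
  proof -
    have "(\<integral>\<zeta>. \<rho> \<zeta> * poisson z \<zeta> \<partial>circle) \<le> (\<integral>\<zeta>. b * poisson z \<zeta> \<partial>circle)"
    proof (rule integral_mono_AE[OF ip[OF z]])
      show "AE \<zeta> in circle. \<rho> \<zeta> * poisson z \<zeta> \<le> b * poisson z \<zeta>"
        using b by eventually_elim (intro mult_right_mono poisson_nonneg z)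
    qed (use integrable_poisson_real[OF z] in auto)
    also have "\<dots> = b" using integral_poisson[OF z] by simp
    finally have "(cmod (outer \<rho> z))\<^sup>2 \<le> (exp (b / 2))\<^sup>2"
      by (simp add: norm_outer[OF \<rho> z] flip: exp_double)
    then show ?thesis by (rule power2_le_imp_le) simp
  qed
  interpret bounded_holomorphic_disk "outer \<rho>" "exp (b / 2)"
    by unfold_locales (use outer_holomorphic[OF \<rho>] bd in auto)
  obtain v R where v: "v \<in> borel_measurable circle" and R: "\<And>n::nat. 0 \<le> R n" "\<And>n. R n < 1" "R \<longlonglongrightarrow> 1"
    and lim: "AE \<zeta> in circle. (\<lambda>n. outer \<rho> (of_real (R n) * \<zeta>)) \<longlonglongrightarrow> v \<zeta>"
    by (rule boundary_function) (rule that)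
  have "((\<lambda>r. \<integral>\<eta>. cmod (poisson_int (\<lambda>\<zeta>. of_real (\<rho> \<zeta>)) (of_real r * \<eta>) - of_real (\<rho> \<eta>)) \<partial>circle) \<longlongrightarrow> 0) (at_left 1)"
    using radial_L1_integrable[OF i\<rho>] by (simp add: radial_L1_def)
  moreover have "filterlim R (at_left 1) sequentially"
    using R less_imp_neq[OF R(2)] by (auto simp: filterlim_at)
  ultimately have "(\<lambda>n. \<integral>\<eta>. cmod (poisson_int (\<lambda>\<zeta>. of_real (\<rho> \<zeta>)) (of_real (R n) * \<eta>) - of_real (\<rho> \<eta>)) \<partial>circle) \<longlonglongrightarrow> 0"
    by (rule filterlim_compose)
  then have "\<exists>s::nat\<Rightarrow>nat. strict_mono s \<and> (AE \<eta> in circle. (\<lambda>n. poisson_int (\<lambda>\<zeta>. of_real (\<rho> \<zeta>)) (of_real (R (s n)) * \<eta>) - of_real (\<rho> \<eta>)) \<longlonglongrightarrow> 0)"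
    by (intro tendsto_L1_AE_subseq Bochner_Integration.integrable_diff poisson_int_L1 i\<rho> R)
  then obtain s where s: "strict_mono (s :: nat \<Rightarrow> nat)"
    and lim2: "AE \<eta> in circle. (\<lambda>n. poisson_int (\<lambda>\<zeta>. of_real (\<rho> \<zeta>)) (of_real (R (s n)) * \<eta>) - of_real (\<rho> \<eta>)) \<longlonglongrightarrow> 0" by blast
  have "AE \<zeta> in circle. (cmod (v \<zeta>))\<^sup>2 = exp (\<rho> \<zeta>)"
    using lim lim2 AE_space
  proof eventually_elim
    case (elim \<eta>)
    have "(\<lambda>n. outer \<rho> (of_real (R (s n)) * \<eta>)) \<longlonglongrightarrow> v \<eta>"
      using LIMSEQ_subseq_LIMSEQ[OF elim(1) s] by (simp add: o_def)
    then have 1: "(\<lambda>n. (cmod (outer \<rho> (of_real (R (s n)) * \<eta>)))\<^sup>2) \<longlonglongrightarrow> (cmod (v \<eta>))\<^sup>2"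
      by (intro tendsto_intros)
    have 2: "(cmod (outer \<rho> (of_real (R (s n)) * \<eta>)))\<^sup>2 = exp (Re (poisson_int (\<lambda>\<zeta>. of_real (\<rho> \<zeta>)) (of_real (R (s n)) * \<eta>)))" for n
    proof -
      have z: "cmod (of_real (R (s n)) * \<eta>) < 1" by (rule norm_radial[OF R(1,2) elim(3)])
      have "poisson_int (\<lambda>\<zeta>. of_real (\<rho> \<zeta>)) (of_real (R (s n)) * \<eta>) = of_real (\<integral>\<zeta>. \<rho> \<zeta> * poisson (of_real (R (s n)) * \<eta>) \<zeta> \<partial>circle)"
        unfolding poisson_int_def of_real_mult[symmetric] by (rule integral_complex_of_real)
      then show ?thesis by (simp add: norm_outer[OF \<rho> z])
    qed
    have "(\<lambda>n. poisson_int (\<lambda>\<zeta>. of_real (\<rho> \<zeta>)) (of_real (R (s n)) * \<eta>)) \<longlonglongrightarrow> of_real (\<rho> \<eta>)"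
      using elim(2) by (rule LIM_zero_cancel)
    then have "(\<lambda>n. exp (Re (poisson_int (\<lambda>\<zeta>. of_real (\<rho> \<zeta>)) (of_real (R (s n)) * \<eta>)))) \<longlonglongrightarrow> exp (Re (of_real (\<rho> \<eta>)))"
      by (intro tendsto_intros)
    with 1 show ?case unfolding 2 using LIMSEQ_unique by fastforce
  qed
  from that[OF v this boundary_mult(2,3)[OF v R lim]] show thesis .
qed


section \<open>The form domain and the operator of a fixed symbol\<close>

locale toeplitz_symbol =
  fixes \<omega> :: "complex \<Rightarrow> real" and \<gamma> :: real
  assumes integrable_symbol: "integrable circle \<omega>"
    and ess_inf_symbol: "ess_inf circle \<omega> = ereal \<gamma>"
begin

lemma symbol_ge: "AE \<zeta> in circle. \<gamma> \<le> \<omega> \<zeta>"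
proof -
  have "esssup circle (\<lambda>x. - ereal (\<omega> x)) = - ereal \<gamma>"
    using ess_inf_symbol unfolding ess_inf_def by (simp add: ereal_uminus_eq_reorder)
  with esssup_AE[of "\<lambda>x. - ereal (\<omega> x)" circle] have "AE \<zeta> in circle. - ereal (\<omega> \<zeta>) \<le> - ereal \<gamma>" by simp
  then show ?thesis by eventually_elim simp
qed

lemma symbol_measurable [measurable]: "\<omega> \<in> borel_measurable circle"
  using integrable_symbol by auto

text \<open>Below, the logarithm is bounded by ln (gamma - lam), as omega >= gamma almost
  everywhere; above, it grows at most linearly and omega is integrable.\<close>

lemma integrable_ln_symbol:
  assumes "lam < \<gamma>"
  shows "integrable circle (\<lambda>\<zeta>. ln (\<omega> \<zeta> - lam))"
proof (rule Bochner_Integration.integrable_bound)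
  show "integrable circle (\<lambda>\<zeta>. \<bar>\<omega> \<zeta> - lam\<bar> + \<bar>ln (\<gamma> - lam)\<bar>)"
    using integrable_symbol by auto
  show "AE \<zeta> in circle. norm (ln (\<omega> \<zeta> - lam)) \<le> norm (\<bar>\<omega> \<zeta> - lam\<bar> + \<bar>ln (\<gamma> - lam)\<bar>)"
    using symbol_ge
  proof eventually_elim
    case (elim \<zeta>)
    have "ln (\<gamma> - lam) \<le> ln (\<omega> \<zeta> - lam)" "ln (\<omega> \<zeta> - lam) \<le> \<omega> \<zeta> - lam"
      using elim assms ln_le_minus_one[of "\<omega> \<zeta> - lam"] by auto
    then show ?case by simp
  qed
qed measurable

text \<open>\<open>u\<close> is the boundary function of 1 / F_lam. The reciprocal is used because
  it is bounded and therefore multiplies all of \<open>hardy2\<close>, whereas F_lam need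
  not.\<close>

definition inv_outer_props :: "real \<Rightarrow> (complex \<Rightarrow> complex) \<Rightarrow> bool" where
  "inv_outer_props lam u \<longleftrightarrow> u \<in> borel_measurable circle \<and>
     (AE \<zeta> in circle. (cmod (u \<zeta>))\<^sup>2 * (\<omega> \<zeta> - lam) = 1) \<and>
     (\<forall>f\<in>hardy2. (\<lambda>\<zeta>. f \<zeta> * u \<zeta>) \<in> hardy2) \<and>
     (\<forall>f\<in>hardy2. \<forall>z. cmod z < 1 \<longrightarrow>
        outer_fun \<omega> lam z * disk_ext (\<lambda>\<zeta>. f \<zeta> * u \<zeta>) z = disk_ext f z)"

definition inv_outer :: "real \<Rightarrow> complex \<Rightarrow> complex" where
  "inv_outer lam = (SOME u. inv_outer_props lam u)"

lemma inv_outer: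
  assumes lam: "lam < \<gamma>"
  shows "inv_outer lam \<in> borel_measurable circle"
    "AE \<zeta> in circle. (cmod (inv_outer lam \<zeta>))\<^sup>2 * (\<omega> \<zeta> - lam) = 1"
    "f \<in> hardy2 \<Longrightarrow> (\<lambda>\<zeta>. f \<zeta> * inv_outer lam \<zeta>) \<in> hardy2"
    "f \<in> hardy2 \<Longrightarrow> cmod z < 1 \<Longrightarrow>
       outer_fun \<omega> lam z * disk_ext (\<lambda>\<zeta>. f \<zeta> * inv_outer lam \<zeta>) z = disk_ext f z"
proof -
  have i: "integrable circle (\<lambda>\<zeta>. - ln (\<omega> \<zeta> - lam))" using integrable_ln_symbol[OF lam] by simp
  have b: "AE \<zeta> in circle. - ln (\<omega> \<zeta> - lam) \<le> - ln (\<gamma> - lam)"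
    using symbol_ge by eventually_elim (use lam in auto)
  obtain v where v: "v \<in> borel_measurable circle" "AE \<zeta> in circle. (cmod (v \<zeta>))\<^sup>2 = exp (- ln (\<omega> \<zeta> - lam))"
    "\<And>f. f \<in> hardy2 \<Longrightarrow> (\<lambda>\<zeta>. f \<zeta> * v \<zeta>) \<in> hardy2"
    "\<And>f z. f \<in> hardy2 \<Longrightarrow> cmod z < 1 \<Longrightarrow> disk_ext (\<lambda>\<zeta>. f \<zeta> * v \<zeta>) z = outer (\<lambda>\<zeta>. - ln (\<omega> \<zeta> - lam)) z * disk_ext f z"
    by (rule outer_boundary[OF i b]) (rule that)
  have "AE \<zeta> in circle. (cmod (v \<zeta>))\<^sup>2 * (\<omega> \<zeta> - lam) = 1"
    using v(2) symbol_ge by eventually_elim (use lam in \<open>simp add: exp_minus\<close>)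
  with v have "inv_outer_props lam v"
    by (simp add: inv_outer_props_def outer_fun_eq outer_minus outer_nonzero)
  then have "inv_outer_props lam (inv_outer lam)"
    unfolding inv_outer_def by (rule someI[of "inv_outer_props lam"])
  then show "inv_outer lam \<in> borel_measurable circle"
    "AE \<zeta> in circle. (cmod (inv_outer lam \<zeta>))\<^sup>2 * (\<omega> \<zeta> - lam) = 1"
    "f \<in> hardy2 \<Longrightarrow> (\<lambda>\<zeta>. f \<zeta> * inv_outer lam \<zeta>) \<in> hardy2"
    "f \<in> hardy2 \<Longrightarrow> cmod z < 1 \<Longrightarrow>
       outer_fun \<omega> lam z * disk_ext (\<lambda>\<zeta>. f \<zeta> * inv_outer lam \<zeta>) z = disk_ext f z"
    by (auto simp: inv_outer_props_def)
qed

text \<open>Together with \<open>form_domainD\<close>: for each lam below gamma the form domain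
  consists of the multiples of Hardy functions by \<open>inv_outer lam\<close>, up to null
  sets.\<close>

lemma form_domainI:
  assumes lam: "lam < \<gamma>" and f: "f \<in> hardy2" and g: "g \<in> hardy2"
    and eq: "AE \<zeta> in circle. f \<zeta> = g \<zeta> * inv_outer lam \<zeta>"
  shows "f \<in> toeplitz_form_domain \<omega>"
proof -
  have "disk_ext f z = disk_ext (\<lambda>\<zeta>. g \<zeta> * inv_outer lam \<zeta>) z" for z
    by (rule disk_ext_cong_AE[OF _ _ eq])
      (use L2_measurable[OF hardy2_L2] f inv_outer(3)[OF lam g] in auto)
  then have "\<forall>z\<in>ball 0 1. outer_fun \<omega> lam z * disk_ext f z = disk_ext g z"
    using inv_outer(4)[OF lam g] by auto
  then show ?thesis
    using f g lam ess_inf_symbol by (auto simp: toeplitz_form_domain_def)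
qed

text \<open>Membership comes with some parameter lam' that may differ from \<open>lam\<close>. The
  quotient of the outer functions for \<open>lam\<close> and lam' is again outer and bounded,
  because (omega - lam) / (omega - lam') is at most 1 + |lam' - lam| / (gamma - lam'); multiplying
  by its boundary function \<open>w\<close> changes the parameter.\<close>

lemma form_domainD:
  assumes lam: "lam < \<gamma>" and f: "f \<in> toeplitz_form_domain \<omega>"
  obtains g where "g \<in> hardy2" "AE \<zeta> in circle. f \<zeta> = g \<zeta> * inv_outer lam \<zeta>"
proof -
  obtain lam' g' where l': "lam' < \<gamma>" and fh: "f \<in> hardy2" and g': "g' \<in> hardy2"
    and eq: "\<And>z. cmod z < 1 \<Longrightarrow> outer_fun \<omega> lam' z * disk_ext f z = disk_ext g' z"
    using f ess_inf_symbol by (auto simp: toeplitz_form_domain_def)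
  note i = integrable_ln_symbol[OF lam] and i' = integrable_ln_symbol[OF l']
  have b: "AE \<zeta> in circle. ln (\<omega> \<zeta> - lam) + - ln (\<omega> \<zeta> - lam') \<le> ln (1 + \<bar>lam' - lam\<bar> / (\<gamma> - lam'))"
    using symbol_ge
  proof eventually_elim
    case (elim \<zeta>)
    have "(\<omega> \<zeta> - lam) / (\<omega> \<zeta> - lam') = 1 + (lam' - lam) / (\<omega> \<zeta> - lam')"
      using elim l' by (simp add: field_simps)
    also have "\<dots> \<le> 1 + \<bar>lam' - lam\<bar> / (\<gamma> - lam')"
      using elim l' by (intro add_left_mono frac_le) auto
    finally have "ln ((\<omega> \<zeta> - lam) / (\<omega> \<zeta> - lam')) \<le> ln (1 + \<bar>lam' - lam\<bar> / (\<gamma> - lam'))"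
      using elim l' lam by (subst ln_le_cancel_iff) (auto intro!: add_pos_nonneg)
    then show ?case using elim l' lam by (simp add: ln_div)
  qed
  have i2: "integrable circle (\<lambda>\<zeta>. - ln (\<omega> \<zeta> - lam'))" using i' by simp
  obtain w where w: "\<And>f. f \<in> hardy2 \<Longrightarrow> (\<lambda>\<zeta>. f \<zeta> * w \<zeta>) \<in> hardy2"
    "\<And>f z. f \<in> hardy2 \<Longrightarrow> cmod z < 1 \<Longrightarrow> disk_ext (\<lambda>\<zeta>. f \<zeta> * w \<zeta>) z =
       outer (\<lambda>\<zeta>. ln (\<omega> \<zeta> - lam) + - ln (\<omega> \<zeta> - lam')) z * disk_ext f z"
    by (rule outer_boundary[OF Bochner_Integration.integrable_add[OF i i2] b]) (rule that)
  let ?g = "\<lambda>\<zeta>. g' \<zeta> * w \<zeta>"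
  have g: "?g \<in> hardy2" by (rule w(1)[OF g'])
  have "AE \<zeta> in circle. f \<zeta> = ?g \<zeta> * inv_outer lam \<zeta>"
  proof (rule hardy2_eq_AE[OF fh inv_outer(3)[OF lam g]])
    fix z :: complex assume z: "cmod z < 1"
    have "outer_fun \<omega> lam z * disk_ext (\<lambda>\<zeta>. ?g \<zeta> * inv_outer lam \<zeta>) z = disk_ext ?g z"
      by (rule inv_outer(4)[OF lam g z])
    also have "\<dots> = outer_fun \<omega> lam z * (1 / outer_fun \<omega> lam' z) * disk_ext g' z"
      by (simp only: w(2)[OF g' z] outer_add[OF i i2 z] outer_minus outer_fun_eq)
    also have "\<dots> = outer_fun \<omega> lam z * disk_ext f z"
      using eq[OF z] outer_nonzero[of "\<lambda>\<zeta>. ln (\<omega> \<zeta> - lam')" z]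
      by (simp add: outer_fun_eq field_simps)
    finally show "disk_ext f z = disk_ext (\<lambda>\<zeta>. ?g \<zeta> * inv_outer lam \<zeta>) z"
      using outer_nonzero[of "\<lambda>\<zeta>. ln (\<omega> \<zeta> - lam)" z] by (simp add: outer_fun_eq)
  qed
  with g that show thesis by blast
qed

lemma form_domain_hardy2: "f \<in> toeplitz_form_domain \<omega> \<Longrightarrow> f \<in> hardy2"
  by (simp add: toeplitz_form_domain_def)

lemma form_domain_lincomb:
  assumes f: "f \<in> toeplitz_form_domain \<omega>" and g: "g \<in> toeplitz_form_domain \<omega>"
  shows "(\<lambda>x. a * f x + b * g x) \<in> toeplitz_form_domain \<omega>"
proof -
  have lam: "\<gamma> - 1 < \<gamma>" by simp
  obtain f' where f': "f' \<in> hardy2" "AE \<zeta> in circle. f \<zeta> = f' \<zeta> * inv_outer (\<gamma> - 1) \<zeta>"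
    by (rule form_domainD[OF lam f])
  obtain g' where g': "g' \<in> hardy2" "AE \<zeta> in circle. g \<zeta> = g' \<zeta> * inv_outer (\<gamma> - 1) \<zeta>"
    by (rule form_domainD[OF lam g])
  have "AE \<zeta> in circle. a * f \<zeta> + b * g \<zeta> = (a * f' \<zeta> + b * g' \<zeta>) * inv_outer (\<gamma> - 1) \<zeta>"
    using f'(2) g'(2) by eventually_elim (simp add: distrib_right)
  then show ?thesis
    by (rule form_domainI[OF lam, rotated 2]) (intro hardy2_lincomb form_domain_hardy2 f g f' g')+
qed

text \<open>With $f = f' u$ and $g = g' u$, where $|u|^2 = 1/(\omega - \lambda)$ on the circle, the form shifted
  by $\lambda$ becomes the inner product of \<open>f'\<close> and \<open>g'\<close>.\<close>

lemma form_product: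
  assumes lam: "lam < \<gamma>"
    and f: "AE \<zeta> in circle. f \<zeta> = f' \<zeta> * inv_outer lam \<zeta>" and g: "AE \<zeta> in circle. g \<zeta> = g' \<zeta> * inv_outer lam \<zeta>"
  shows "AE \<zeta> in circle. of_real (\<omega> \<zeta>) * f \<zeta> * cnj (g \<zeta>) = of_real lam * (f \<zeta> * cnj (g \<zeta>)) + f' \<zeta> * cnj (g' \<zeta>)"
  using f g inv_outer(2)[OF lam]
proof eventually_elim
  case (elim \<zeta>)
  let ?u = "inv_outer lam \<zeta>"
  have u: "?u * cnj ?u * (of_real (\<omega> \<zeta>) - of_real lam) = 1"
    using arg_cong[OF elim(3), of complex_of_real] by (simp only: of_real_mult of_real_diff complex_norm_square of_real_1)
  have "of_real (\<omega> \<zeta>) * f \<zeta> * cnj (g \<zeta>) - of_real lam * (f \<zeta> * cnj (g \<zeta>)) =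
    (?u * cnj ?u * (of_real (\<omega> \<zeta>) - of_real lam)) * (f' \<zeta> * cnj (g' \<zeta>))"
    by (simp add: elim(1,2) algebra_simps)
  then show ?case unfolding u by (simp add: algebra_simps)
qed

lemma form_integrable:
  assumes f: "f \<in> toeplitz_form_domain \<omega>" and g: "g \<in> toeplitz_form_domain \<omega>"
  shows "integrable circle (\<lambda>\<zeta>. of_real (\<omega> \<zeta>) * f \<zeta> * cnj (g \<zeta>))"
proof -
  have lam: "\<gamma> - 1 < \<gamma>" by simp
  obtain f' where f': "f' \<in> hardy2" "AE \<zeta> in circle. f \<zeta> = f' \<zeta> * inv_outer (\<gamma> - 1) \<zeta>"
    by (rule form_domainD[OF lam f])
  obtain g' where g': "g' \<in> hardy2" "AE \<zeta> in circle. g \<zeta> = g' \<zeta> * inv_outer (\<gamma> - 1) \<zeta>"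
    by (rule form_domainD[OF lam g])
  have [measurable]: "f \<in> borel_measurable circle" "g \<in> borel_measurable circle"
    "f' \<in> borel_measurable circle" "g' \<in> borel_measurable circle"
    using form_domain_hardy2 f g f' g' by (auto intro: L2_measurable hardy2_L2)
  have "integrable circle (\<lambda>\<zeta>. of_real (\<gamma> - 1) * (f \<zeta> * cnj (g \<zeta>)) + f' \<zeta> * cnj (g' \<zeta>))"
    by (intro Bochner_Integration.integrable_add integrable_mult_right L2_integrable_inner hardy2_L2 form_domain_hardy2 f g f' g')
  then show ?thesis
    by (subst integrable_cong_AE[OF _ _ form_product[OF lam f'(2) g'(2)]]) measurable
qed

lemma form_lincomb_left:
  assumes f: "f \<in> toeplitz_form_domain \<omega>" and g: "g \<in> toeplitz_form_domain \<omega>" and h: "h \<in> toeplitz_form_domain \<omega>"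
  shows "toeplitz_form \<omega> (\<lambda>x. a * f x + b * g x) h = a * toeplitz_form \<omega> f h + b * toeplitz_form \<omega> g h"
proof -
  have "toeplitz_form \<omega> (\<lambda>x. a * f x + b * g x) h =
    (\<integral>\<zeta>. a * (of_real (\<omega> \<zeta>) * f \<zeta> * cnj (h \<zeta>)) + b * (of_real (\<omega> \<zeta>) * g \<zeta> * cnj (h \<zeta>)) \<partial>circle)"
    unfolding toeplitz_form_def by (rule Bochner_Integration.integral_cong[OF refl]) (simp add: algebra_simps)
  also have "\<dots> = a * toeplitz_form \<omega> f h + b * toeplitz_form \<omega> g h"
    unfolding toeplitz_form_def
    by (subst Bochner_Integration.integral_add[OF integrable_mult_right[OF form_integrable[OF f h]] integrable_mult_right[OF form_integrable[OF g h]]])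
      (simp only: integral_mult_right_zero)
  finally show ?thesis .
qed

lemma form_cnj: "toeplitz_form \<omega> g f = cnj (toeplitz_form \<omega> f g)"
  unfolding toeplitz_form_def by (simp add: mult_ac flip: Bochner_Integration.integral_cnj)

lemma toeplitz_lincomb:
  assumes "(f, h) \<in> toeplitz \<omega>" "(f', h') \<in> toeplitz \<omega>"
  shows "(\<lambda>x. a * f x + b * f' x, \<lambda>x. a * h x + b * h' x) \<in> toeplitz \<omega>"
  using assms by (auto simp: toeplitz_def hardy2_lincomb form_domain_lincomb form_lincomb_left
      L2_inner_lincomb_left hardy2_L2 form_domain_hardy2)

lemma toeplitz_hardy2:
  assumes "(f, h) \<in> toeplitz \<omega>"
  shows "f \<in> hardy2" "h \<in> hardy2"
  using assms by (auto simp: toeplitz_def form_domain_hardy2)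

lemma toeplitz_symmetric:
  assumes "(f, h) \<in> toeplitz \<omega>" "(f', h') \<in> toeplitz \<omega>"
  shows "L2_inner circle h f' = L2_inner circle f h'"
proof -
  have "L2_inner circle h f' = toeplitz_form \<omega> f f'" "L2_inner circle h' f = toeplitz_form \<omega> f' f"
    using assms by (auto simp: toeplitz_def)
  then have "L2_inner circle h f' = cnj (L2_inner circle h' f)"
    by (simp only: form_cnj[of f f'])
  also have "\<dots> = L2_inner circle f h'" by (rule L2_inner_cnj[symmetric])
  finally show ?thesis .
qed

lemma toeplitz_bounded_below:
  assumes "(f, h) \<in> toeplitz \<omega>"
  shows "\<gamma> * Re (L2_inner circle f f) \<le> Re (L2_inner circle h f)"
proof -
  have fd: "f \<in> toeplitz_form_domain \<omega>" and eq: "L2_inner circle h f = toeplitz_form \<omega> f f"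
    using assms by (auto simp: toeplitz_def)
  note fL = hardy2_L2[OF form_domain_hardy2[OF fd]]
  have i: "integrable circle (\<lambda>\<zeta>. complex_of_real (\<omega> \<zeta>) * f \<zeta> * cnj (f \<zeta>))" by (rule form_integrable[OF fd fd])
  have e: "Re (complex_of_real (\<omega> \<zeta>) * f \<zeta> * cnj (f \<zeta>)) = \<omega> \<zeta> * (cmod (f \<zeta>))\<^sup>2" for \<zeta>
    by (simp add: mult.assoc flip: complex_norm_square)
  have "\<gamma> * Re (L2_inner circle f f) = (\<integral>\<zeta>. \<gamma> * (cmod (f \<zeta>))\<^sup>2 \<partial>circle)"
    by (simp add: L2_inner_self)
  also have "\<dots> \<le> (\<integral>\<zeta>. \<omega> \<zeta> * (cmod (f \<zeta>))\<^sup>2 \<partial>circle)"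
  proof (rule integral_mono_AE)
    show "integrable circle (\<lambda>\<zeta>. \<omega> \<zeta> * (cmod (f \<zeta>))\<^sup>2)" using integrable_Re[OF i] unfolding e .
    show "AE \<zeta> in circle. \<gamma> * (cmod (f \<zeta>))\<^sup>2 \<le> \<omega> \<zeta> * (cmod (f \<zeta>))\<^sup>2"
      using symbol_ge by eventually_elim (auto intro: mult_right_mono)
  qed (use L2_square[OF fL] in auto)
  also have "\<dots> = Re (toeplitz_form \<omega> f f)"
    unfolding toeplitz_form_def e[symmetric] by (rule integral_Re[OF i])
  finally show ?thesis by (simp only: eq)
qed

text \<open>The identity $(T - \lambda)(k_w / F_\lambda) = \overline{F_\lambda(w)}\, k_w$.\<close>

lemma toeplitz_szego:
  assumes lam: "lam < \<gamma>" and w: "cmod w < 1"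
  shows "(\<lambda>\<zeta>. szego w \<zeta> * inv_outer lam \<zeta>,
     \<lambda>\<zeta>. of_real lam * (szego w \<zeta> * inv_outer lam \<zeta>) + cnj (outer_fun \<omega> lam w) * szego w \<zeta>) \<in> toeplitz \<omega>"
proof -
  let ?u = "inv_outer lam" and ?k = "szego w" and ?c = "cnj (outer_fun \<omega> lam w)"
  let ?p = "\<lambda>\<zeta>. ?k \<zeta> * ?u \<zeta>"
  have k: "?k \<in> hardy2" by (rule szego_hardy2[OF w])
  have p: "?p \<in> hardy2" by (rule inv_outer(3)[OF lam k])
  have pd: "?p \<in> toeplitz_form_domain \<omega>" by (rule form_domainI[OF lam p k]) simp
  have "L2_inner circle (\<lambda>\<zeta>. of_real lam * ?p \<zeta> + ?c * ?k \<zeta>) g = toeplitz_form \<omega> ?p g"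
    if gd: "g \<in> toeplitz_form_domain \<omega>" for g
  proof -
    obtain g' where g': "g' \<in> hardy2" "AE \<zeta> in circle. g \<zeta> = g' \<zeta> * ?u \<zeta>"
      by (rule form_domainD[OF lam gd])
    have g: "g \<in> hardy2" by (rule form_domain_hardy2[OF gd])
    note L = hardy2_L2[OF g] hardy2_L2[OF g'(1)] hardy2_L2[OF p] hardy2_L2[OF k]
    have "toeplitz_form \<omega> ?p g = (\<integral>\<zeta>. of_real lam * (?p \<zeta> * cnj (g \<zeta>)) + ?k \<zeta> * cnj (g' \<zeta>) \<partial>circle)"
      unfolding toeplitz_form_def
    proof (rule integral_cong_AE[OF _ _ form_product[OF lam _ g'(2)]])
      show "(\<lambda>\<zeta>. of_real (\<omega> \<zeta>) * ?p \<zeta> * cnj (g \<zeta>)) \<in> borel_measurable circle"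
        using form_integrable[OF pd gd] by (rule borel_measurable_integrable)
      show "(\<lambda>\<zeta>. of_real lam * (?p \<zeta> * cnj (g \<zeta>)) + ?k \<zeta> * cnj (g' \<zeta>)) \<in> borel_measurable circle"
        by (intro borel_measurable_integrable Bochner_Integration.integrable_add integrable_mult_right L2_integrable_inner L)
    qed simp
    also have "\<dots> = of_real lam * L2_inner circle ?p g + L2_inner circle ?k g'"
      unfolding L2_inner_def
      by (subst Bochner_Integration.integral_add[OF integrable_mult_right[OF L2_integrable_inner[OF L(3,1)]] L2_integrable_inner[OF L(4,2)]])
        (simp only: integral_mult_right_zero)
    \<comment> \<open>Reproducing property: both inner products are conjugated values at
      \<open>w\<close>, and g'(w) = F_lam(w) g(w).\<close>
    also have "L2_inner circle ?k g' = ?c * L2_inner circle ?k g"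
    proof -
      have "disk_ext g w = disk_ext (\<lambda>\<zeta>. g' \<zeta> * ?u \<zeta>) w"
        by (rule disk_ext_cong_AE[OF _ _ g'(2)]) (use L2_measurable[OF hardy2_L2] g inv_outer(3)[OF lam g'(1)] in auto)
      then have "disk_ext g' w = outer_fun \<omega> lam w * disk_ext g w"
        using inv_outer(4)[OF lam g'(1) w] by simp
      then show ?thesis by (subst (1 2) L2_inner_cnj) (simp add: L2_inner_szego)
    qed
    finally show ?thesis by (simp only: L2_inner_lincomb_left[OF L(3,4,1)])
  qed
  then show ?thesis using pd by (auto simp: toeplitz_def intro: hardy2_lincomb p k)
qed

lemma disk_ext_szego_inv_outer:
  assumes lam: "lam < \<gamma>" and w: "cmod w < 1"
  shows "disk_ext (\<lambda>\<zeta>. szego w \<zeta> * inv_outer lam \<zeta>) w = 1 / (outer_fun \<omega> lam w * (1 - (cmod w)\<^sup>2))"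
proof -
  have "outer_fun \<omega> lam w * disk_ext (\<lambda>\<zeta>. szego w \<zeta> * inv_outer lam \<zeta>) w = 1 / (1 - (cmod w)\<^sup>2)"
    unfolding inv_outer(4)[OF lam szego_hardy2[OF w] w] disk_ext_szego_self[OF w] by simp
  moreover have "outer_fun \<omega> lam w \<noteq> 0" by (simp add: outer_fun_eq outer_nonzero)
  ultimately have "disk_ext (\<lambda>\<zeta>. szego w \<zeta> * inv_outer lam \<zeta>) w = 1 / (1 - (cmod w)\<^sup>2) / outer_fun \<omega> lam w"
    by (metis nonzero_mult_div_cancel_left)
  then show ?thesis by simp
qed

end

section \<open>Projection-valued measures\<close>

text \<open>Young's inequality under the integral; the free parameter \<open>t\<close> lets the
  first factor tend to 0 while the second stays fixed.\<close>

lemma norm_L2_inner_le: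
  assumes f: "f \<in> L2 M" and g: "g \<in> L2 M" and t: "t > 0"
  shows "cmod (L2_inner M f g) \<le> (\<integral>x. (cmod (f x))\<^sup>2 \<partial>M) / (2 * t) + t / 2 * (\<integral>x. (cmod (g x))\<^sup>2 \<partial>M)"
proof -
  have "cmod (L2_inner M f g) \<le> (\<integral>x. cmod (f x * cnj (g x)) \<partial>M)"
    unfolding L2_inner_def by (rule integral_norm_bound)
  also have "\<dots> \<le> (\<integral>x. (cmod (f x))\<^sup>2 / (2 * t) + t / 2 * (cmod (g x))\<^sup>2 \<partial>M)"
  proof (rule integral_mono)
    show "integrable M (\<lambda>x. cmod (f x * cnj (g x)))"
      by (intro integrable_norm L2_integrable_inner f g)
    show "integrable M (\<lambda>x. (cmod (f x))\<^sup>2 / (2 * t) + t / 2 * (cmod (g x))\<^sup>2)"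
      using L2_square[OF f] L2_square[OF g] by auto
    fix x
    have "0 \<le> (cmod (f x) - t * cmod (g x))\<^sup>2" by simp
    then have "2 * t * (cmod (f x) * cmod (g x)) \<le> (cmod (f x))\<^sup>2 + (t * cmod (g x))\<^sup>2"
      by (simp add: power2_diff mult_ac)
    then have "2 * t * (cmod (f x) * cmod (g x)) / (2 * t) \<le> ((cmod (f x))\<^sup>2 + (t * cmod (g x))\<^sup>2) / (2 * t)"
      using t by (intro divide_right_mono) auto
    then show "cmod (f x * cnj (g x)) \<le> (cmod (f x))\<^sup>2 / (2 * t) + t / 2 * (cmod (g x))\<^sup>2"
      using t by (simp add: norm_mult add_divide_distrib power_mult_distrib power2_eq_square mult_ac)
  qed
  also have "\<dots> = (\<integral>x. (cmod (f x))\<^sup>2 \<partial>M) / (2 * t) + t / 2 * (\<integral>x. (cmod (g x))\<^sup>2 \<partial>M)"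
    using L2_square[OF f] L2_square[OF g] by (subst Bochner_Integration.integral_add) auto
  finally show ?thesis .
qed

lemma L2_inner_tendsto_0:
  assumes d: "\<And>n::nat. d n \<in> L2 M" and g: "g \<in> L2 M" and lim: "(\<lambda>n. L2_norm M (d n)) \<longlonglongrightarrow> 0"
  shows "(\<lambda>n. L2_inner M (d n) g) \<longlonglongrightarrow> 0"
proof (rule tendstoI)
  fix e :: real assume e: "e > 0"
  let ?G = "\<integral>x. (cmod (g x))\<^sup>2 \<partial>M" and ?D = "\<lambda>n. \<integral>x. (cmod (d n x))\<^sup>2 \<partial>M"
  have G: "0 \<le> ?G" by simp
  \<comment> \<open>Makes the term with \<open>g\<close> at most e/2; the added 1 covers the case
    that \<open>g\<close> has norm 0.\<close>
  define t where "t = e / (?G + 1)"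
  have t: "t > 0" using e G by (simp add: t_def add_nonneg_pos)
  have tG: "t / 2 * ?G \<le> e / 2"
  proof -
    have "t * ?G \<le> t * (?G + 1)" using t by simp
    also have "\<dots> = e"
    proof -
      have "?G + 1 \<noteq> 0" using G by linarith
      then show ?thesis by (simp add: t_def)
    qed
    finally show ?thesis by simp
  qed
  have "(\<lambda>n. (L2_norm M (d n))\<^sup>2) \<longlonglongrightarrow> 0\<^sup>2" by (intro tendsto_intros lim)
  then have "?D \<longlonglongrightarrow> 0" by (simp add: L2_norm_def)
  then have "(\<lambda>n. ?D n / (2 * t)) \<longlonglongrightarrow> 0 / (2 * t)" by (intro tendsto_intros) (use t in auto)
  then have "\<forall>\<^sub>F n in sequentially. ?D n / (2 * t) < e / 2"
    using order_tendstoD(2)[of "\<lambda>n. ?D n / (2 * t)" 0 sequentially "e / 2"] e by simp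
  then show "\<forall>\<^sub>F n in sequentially. dist (L2_inner M (d n) g) 0 < e"
  proof eventually_elim
    case (elim n)
    then show ?case using norm_L2_inner_le[OF d[of n] g t] tG by simp
  qed
qed

text \<open>Polarization produces a difference of positive measures. Stating it as a sum of measures
  keeps everything nonnegative and allows integration of unbounded functions.\<close>

lemma nn_integral_measure_add:
  assumes sets: "sets N1 = sets N" "sets N2 = sets N" "sets N3 = sets N"
    and add: "\<And>C. C \<in> sets N \<Longrightarrow> emeasure N1 C = emeasure N2 C + emeasure N3 C"
    and F: "F \<in> borel_measurable N"
  shows "(\<integral>\<^sup>+x. F x \<partial>N1) = (\<integral>\<^sup>+x. F x \<partial>N2) + (\<integral>\<^sup>+x. F x \<partial>N3)"
  using F
proof (induction rule: borel_measurable_induct)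
  case (cong f g)
  have sp: "space N1 = space N" "space N2 = space N" "space N3 = space N"
    using sets[THEN sets_eq_imp_space_eq] by auto
  have "(\<integral>\<^sup>+x. f x \<partial>K) = (\<integral>\<^sup>+x. g x \<partial>K)" if "space K = space N" for K
    by (rule nn_integral_cong) (use cong that in auto)
  then show ?case using cong sp by simp
next
  case (set A)
  then show ?case by (simp add: sets add)
next
  case (mult f c)
  then have "f \<in> borel_measurable N1" "f \<in> borel_measurable N2" "f \<in> borel_measurable N3"
    using sets by (auto cong: measurable_cong_sets)
  with mult show ?case by (simp add: nn_integral_cmult distrib_left)
next
  case (add f g)
  then have "f \<in> borel_measurable N1" "f \<in> borel_measurable N2" "f \<in> borel_measurable N3"
    "g \<in> borel_measurable N1" "g \<in> borel_measurable N2" "g \<in> borel_measurable N3"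
    using sets by (auto cong: measurable_cong_sets)
  with add show ?case by (simp add: nn_integral_add add_ac)
next
  case (seq U)
  have m: "U i \<in> borel_measurable K" if "sets K = sets N" for i K
    using seq(1)[of i] that by (auto cong: measurable_cong_sets)
  have S: "(\<integral>\<^sup>+x. (SUP i. U i) x \<partial>K) = (SUP i. \<integral>\<^sup>+x. U i x \<partial>K)" if "sets K = sets N" for K
    using nn_integral_monotone_convergence_SUP[OF seq(3) m[OF that]] by (simp add: image_comp)
  have inc: "incseq (\<lambda>i. \<integral>\<^sup>+x. U i x \<partial>K)" for K
    using seq(3) by (auto simp: incseq_def le_fun_def intro!: nn_integral_mono)
  show ?case
    unfolding S[OF sets(1)] S[OF sets(2)] S[OF sets(3)] seq.IH
    by (rule ennreal_SUP_add[OF inc inc])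
qed

locale pvm =
  fixes M :: "'a measure" and H :: "('a \<Rightarrow> complex) set"
    and E :: "real set \<Rightarrow> ('a \<Rightarrow> complex) \<Rightarrow> ('a \<Rightarrow> complex)"
  assumes pvm: "projection_valued_measure M H E"
    and H_L2: "H \<subseteq> L2 M"
    and H_lincomb: "\<And>f g a b. f \<in> H \<Longrightarrow> g \<in> H \<Longrightarrow> (\<lambda>x. a * f x + b * g x) \<in> H"
begin

definition form :: "real set \<Rightarrow> ('a \<Rightarrow> complex) \<Rightarrow> ('a \<Rightarrow> complex) \<Rightarrow> complex" where
  "form A f g = L2_inner M (E A f) g"

lemma in_L2 [simp]: "f \<in> H \<Longrightarrow> f \<in> L2 M"
  using H_L2 by blast

lemma E_in: "A \<in> sets borel \<Longrightarrow> f \<in> H \<Longrightarrow> E A f \<in> H"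
  by (rule pvm[unfolded projection_valued_measure_def, THEN conjunct1, rule_format])

lemma E_idem: "A \<in> sets borel \<Longrightarrow> f \<in> H \<Longrightarrow> AE x in M. E A (E A f) x = E A f x"
  by (rule pvm[unfolded projection_valued_measure_def, THEN conjunct2, THEN conjunct2, THEN conjunct1, rule_format])

lemma form_sym: "A \<in> sets borel \<Longrightarrow> f \<in> H \<Longrightarrow> g \<in> H \<Longrightarrow> form A f g = L2_inner M f (E A g)"
  unfolding form_def
  by (rule pvm[unfolded projection_valued_measure_def, THEN conjunct2, THEN conjunct2, THEN conjunct2, THEN conjunct1, rule_format])

lemma E_UNIV: "f \<in> H \<Longrightarrow> AE x in M. E UNIV f x = f x"
  by (rule pvm[unfolded projection_valued_measure_def, THEN conjunct2, THEN conjunct2, THEN conjunct2, THEN conjunct2, THEN conjunct1, rule_format])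

lemma E_additive:
  "range A \<subseteq> sets borel \<Longrightarrow> disjoint_family A \<Longrightarrow> f \<in> H \<Longrightarrow>
    (\<lambda>n::nat. L2_norm M (\<lambda>x. E (\<Union>i. A i) f x - (\<Sum>i<n. E (A i) f x))) \<longlonglongrightarrow> 0"
  by (rule pvm[unfolded projection_valued_measure_def, THEN conjunct2, THEN conjunct2, THEN conjunct2, THEN conjunct2, THEN conjunct2, rule_format])

lemma form_cnj:
  assumes "A \<in> sets borel" "f \<in> H" "g \<in> H"
  shows "form A g f = cnj (form A f g)"
  unfolding form_sym[OF assms] by (simp add: form_def L2_inner_cnj[of M f])

lemma form_lincomb_left:
  assumes "A \<in> sets borel" "f \<in> H" "g \<in> H" "h \<in> H"
  shows "form A (\<lambda>x. a * f x + b * g x) h = a * form A f h + b * form A g h"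
  unfolding form_sym[OF assms(1) H_lincomb[OF assms(2,3)] assms(4)] form_sym[OF assms(1,2,4)] form_sym[OF assms(1,3,4)]
  by (rule L2_inner_lincomb_left) (use assms E_in in auto)

lemma form_lincomb_right:
  assumes "A \<in> sets borel" "f \<in> H" "g \<in> H" "h \<in> H"
  shows "form A h (\<lambda>x. a * f x + b * g x) = cnj a * form A h f + cnj b * form A h g"
  unfolding form_def by (rule L2_inner_lincomb_right) (use assms E_in in auto)

lemma form_UNIV: "f \<in> H \<Longrightarrow> g \<in> H \<Longrightarrow> form UNIV f g = L2_inner M f g"
  unfolding form_def by (rule L2_inner_cong_AE) (use E_UNIV E_in[of UNIV] in auto)

lemma form_self:
  assumes "A \<in> sets borel" "f \<in> H"
  shows "form A f f = of_real (\<integral>x. (cmod (E A f x))\<^sup>2 \<partial>M)"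
proof -
  note e = E_in[OF assms]
  have "L2_inner M (E A f) (E A f) = form A (E A f) f"
    using form_sym[OF assms(1) e assms(2)] by simp
  also have "\<dots> = form A f f"
    unfolding form_def by (rule L2_inner_cong_AE) (use E_idem[OF assms] e E_in[OF assms(1) e] assms in auto)
  finally show ?thesis by (simp add: L2_inner_self)
qed

text \<open>Strong convergence of the partial sums, tested against a fixed vector. The induction
  identifies the inner product of the remainder.\<close>

lemma form_sums:
  assumes A: "range A \<subseteq> sets borel" "disjoint_family A" and f: "f \<in> H" and g: "g \<in> H"
  shows "(\<lambda>i::nat. form (A i) f g) sums form (\<Union>i. A i) f g"
proof -
  have Ai: "A i \<in> sets borel" for i using A by auto
  have U: "(\<Union>i. A i) \<in> sets borel" using Ai by auto
  note gL = in_L2[OF g]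
  let ?d = "\<lambda>n x. E (\<Union>i. A i) f x - (\<Sum>i<n. E (A i) f x)"
  have d: "?d n \<in> L2 M \<and> L2_inner M (?d n) g = form (\<Union>i. A i) f g - (\<Sum>i<n. form (A i) f g)" for n
  proof (induction n)
    case 0
    then show ?case using E_in[OF U f] by (simp add: form_def)
  next
    case (Suc n)
    have e: "?d (Suc n) = (\<lambda>x. 1 * ?d n x + (-1) * E (A n) f x)" by (auto simp: fun_eq_iff)
    have L: "E (A n) f \<in> L2 M" using E_in[OF Ai f] by simp
    show ?case unfolding e
      using Suc L2_lincomb[OF conjunct1[OF Suc] L, of 1 "-1"] L2_inner_lincomb_left[OF conjunct1[OF Suc] L gL, of 1 "-1"]
      by (simp add: form_def)
  qed
  have "(\<lambda>n. L2_inner M (?d n) g) \<longlonglongrightarrow> 0"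
    by (rule L2_inner_tendsto_0[OF _ gL E_additive[OF A f]]) (use d in auto)
  then have "(\<lambda>n. form (\<Union>i. A i) f g - (\<Sum>i<n. form (A i) f g)) \<longlonglongrightarrow> 0" using d by simp
  then have "(\<lambda>n. form (\<Union>i. A i) f g - (form (\<Union>i. A i) f g - (\<Sum>i<n. form (A i) f g))) \<longlonglongrightarrow> form (\<Union>i. A i) f g - 0"
    by (intro tendsto_diff tendsto_const)
  then show ?thesis by (simp add: sums_def)
qed

text \<open>The constant family of empty sets is disjoint, and a convergent series with constant
  terms has zero terms.\<close>

lemma form_empty: "f \<in> H \<Longrightarrow> g \<in> H \<Longrightarrow> form {} f g = 0"
proof -
  assume fg: "f \<in> H" "g \<in> H"
  have "(\<lambda>i::nat. form {} f g) sums form {} f g"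
    using form_sums[of "\<lambda>_. {}" f g] fg by (simp add: disjoint_family_on_def)
  then have "(\<lambda>i::nat. form {} f g) \<longlonglongrightarrow> 0" by (intro summable_LIMSEQ_zero sums_summable)
  then show "form {} f g = 0" by (simp add: LIMSEQ_const_iff)
qed

lemma form_Un:
  assumes "A \<in> sets borel" "B \<in> sets borel" "A \<inter> B = {}" "f \<in> H" "g \<in> H"
  shows "form (A \<union> B) f g = form A f g + form B f g"
proof -
  have "(\<lambda>i. form (binaryset A B i) f g) sums form (\<Union>i. binaryset A B i) f g"
    by (rule form_sums) (use assms in \<open>auto simp: range_binaryset_eq disjoint_family_on_def binaryset_def\<close>)
  moreover have "(\<lambda>i. form (binaryset A B i) f g) sums (form A f g + form B f g)"
    using binaryset_sums[of "\<lambda>A. form A f g" A B] form_empty assms by simp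
  ultimately show ?thesis using sums_unique2 by (simp add: UN_binaryset_eq)
qed

abbreviation \<mu> :: "('a \<Rightarrow> complex) \<Rightarrow> real measure" where
  "\<mu> \<equiv> scalar_spectral_measure M E"

definition m :: "('a \<Rightarrow> complex) \<Rightarrow> real set \<Rightarrow> real" where
  "m f A = Re (form A f f)"

lemma m_eq: "A \<in> sets borel \<Longrightarrow> f \<in> H \<Longrightarrow> m f A = (\<integral>x. (cmod (E A f x))\<^sup>2 \<partial>M)"
  by (simp add: m_def form_self)

lemma m_nonneg: "A \<in> sets borel \<Longrightarrow> f \<in> H \<Longrightarrow> 0 \<le> m f A"
  by (simp add: m_eq)

lemma form_self_m: "A \<in> sets borel \<Longrightarrow> f \<in> H \<Longrightarrow> form A f f = of_real (m f A)"
  by (simp add: m_eq form_self)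

lemma space_\<mu> [simp]: "space (\<mu> f) = UNIV"
  by (simp add: scalar_spectral_measure_def)

lemma sets_\<mu> [simp, measurable_cong]: "sets (\<mu> f) = sets borel"
  unfolding scalar_spectral_measure_def using sets.sigma_sets_eq[of "borel :: real measure"] by (simp add: sets_measure_of_conv)

lemma emeasure_\<mu>:
  assumes f: "f \<in> H" and A: "A \<in> sets borel"
  shows "emeasure (\<mu> f) A = ennreal (m f A)"
proof -
  have "emeasure (measure_of UNIV (sets borel) (\<lambda>A. ennreal (Re (L2_inner M (E A f) f)))) A = ennreal (Re (L2_inner M (E A f) f))"
  proof (rule emeasure_measure_of_sigma)
    show "sigma_algebra UNIV (sets (borel :: real measure))"
      using sets.sigma_algebra_axioms[of "borel :: real measure"] by simp
    show "positive (sets borel) (\<lambda>A. ennreal (Re (L2_inner M (E A f) f)))"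
      using form_empty[OF f f] by (simp add: positive_def form_def)
    show "countably_additive (sets borel) (\<lambda>A. ennreal (Re (L2_inner M (E A f) f)))"
      unfolding countably_additive_def
    proof (intro allI impI)
      fix A :: "nat \<Rightarrow> real set" assume A: "range A \<subseteq> sets borel" "disjoint_family A"
      have "(\<lambda>i. Re (form (A i) f f)) sums Re (form (\<Union>i. A i) f f)"
        by (rule sums_Re[OF form_sums[OF A f f]])
      then have s: "(\<lambda>i. m f (A i)) sums m f (\<Union>i. A i)" by (simp add: m_def)
      have "(\<Sum>i. ennreal (m f (A i))) = ennreal (\<Sum>i. m f (A i))"
        by (rule suminf_ennreal2) (use A m_nonneg f s sums_summable in auto)
      then show "(\<Sum>i. ennreal (Re (L2_inner M (E (A i) f) f))) = ennreal (Re (L2_inner M (E (\<Union>i. A i) f) f))"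
        using s by (simp add: m_def form_def sums_iff)
    qed
  qed (rule A)
  then show ?thesis by (simp add: scalar_spectral_measure_def m_def form_def)
qed

lemma finite_\<mu>: "f \<in> H \<Longrightarrow> finite_measure (\<mu> f)"
  by (rule finite_measureI) (simp add: emeasure_\<mu>)

lemma measure_\<mu>: "f \<in> H \<Longrightarrow> A \<in> sets borel \<Longrightarrow> measure (\<mu> f) A = m f A"
  by (simp add: measure_def emeasure_\<mu> m_nonneg)

text \<open>Orthogonality of projections for disjoint sets is not part of the definition. It follows
  by counting mass: idempotence puts the whole squared norm of E(A) f on \<open>A\<close> already,
  leaving none for \<open>C\<close>.\<close>

lemma form_E_disjoint:
  assumes A: "A \<in> sets borel" and C: "C \<in> sets borel" and AC: "A \<inter> C = {}" and f: "f \<in> H" and g: "g \<in> H"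
  shows "form C (E A f) g = 0"
proof -
  note e = E_in[OF A f]
  interpret finite_measure "\<mu> (E A f)" by (rule finite_\<mu>[OF e])
  have "m (E A f) A + m (E A f) C = measure (\<mu> (E A f)) (A \<union> C)"
    using finite_measure_Union[of A C] A C AC by (simp add: measure_\<mu>[OF e])
  also have "\<dots> \<le> measure (\<mu> (E A f)) UNIV" by (rule finite_measure_mono) auto
  also have "\<dots> = m (E A f) A"
  proof -
    have "form UNIV (E A f) (E A f) = L2_inner M (E A f) (E A f)" by (rule form_UNIV[OF e e])
    also have "\<dots> = form A (E A f) (E A f)"
      unfolding form_def by (rule L2_inner_cong_AE) (use E_idem[OF A f] e E_in[OF A e] in auto)
    finally show ?thesis by (simp add: measure_\<mu>[OF e] m_def)
  qed
  finally have "m (E A f) C = 0"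
    using m_nonneg[OF C e] by linarith
  then have "(\<integral>x. (cmod (E C (E A f) x))\<^sup>2 \<partial>M) = 0"
    by (simp only: m_eq[OF C e])
  then have "AE x in M. E C (E A f) x = 0"
    using integral_nonneg_eq_0_iff_AE[OF L2_square[OF in_L2[OF E_in[OF C e]]]] by simp
  then show ?thesis
    unfolding form_def L2_inner_def by (intro integral_eq_zero_AE) auto
qed

text \<open>Apply additivity over \<open>A\<close> and its complement to the pair f, E(C) g. The
  part of \<open>f\<close> in the range of E(-A) is invisible to \<open>C\<close> by
  \<open>form_E_disjoint\<close>.\<close>

lemma form_E_subset:
  assumes A: "A \<in> sets borel" and C: "C \<in> sets borel" and CA: "C \<subseteq> A" and f: "f \<in> H" and g: "g \<in> H"
  shows "form C (E A f) g = form C f g"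
proof -
  have A': "- A \<in> sets borel" using A by auto
  note e = E_in[OF C g]
  have "form C f g = form UNIV f (E C g)" using form_UNIV[OF f e] form_sym[OF C f g] by simp
  also have "\<dots> = form A f (E C g) + form (- A) f (E C g)"
    using form_Un[OF A A' _ f e] by (simp add: Compl_partition)
  also have "\<dots> = form C (E A f) g + form C (E (- A) f) g"
    by (simp add: form_sym[OF C E_in[OF A f] g] form_sym[OF C E_in[OF A' f] g]) (simp add: form_def)
  also have "form C (E (- A) f) g = 0"
    by (rule form_E_disjoint[OF A' C _ f g]) (use CA in auto)
  finally show ?thesis by simp
qed

end

section \<open>The resolvent in the spectral representation\<close>

context pvm
begin

lemma m_lincomb:
  assumes C: "C \<in> sets borel" and f: "f \<in> H" and g: "g \<in> H"
  shows "m (\<lambda>x. of_real a * f x + of_real b * g x) C = a\<^sup>2 * m f C + b\<^sup>2 * m g C + 2 * a * b * Re (form C f g)"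
proof -
  note fg = H_lincomb[OF f g, of "of_real a" "of_real b"]
  have "form C (\<lambda>x. of_real a * f x + of_real b * g x) (\<lambda>x. of_real a * f x + of_real b * g x) =
    of_real a * (of_real a * form C f f + of_real b * form C f g) +
    of_real b * (of_real a * form C g f + of_real b * form C g g)"
    by (simp add: form_lincomb_left[OF C f g fg] form_lincomb_right[OF C f g f] form_lincomb_right[OF C f g g])
  then show ?thesis
    by (simp add: m_def form_cnj[OF C f g] power2_eq_square algebra_simps)
qed

lemma m_empty [simp]: "f \<in> H \<Longrightarrow> m f {} = 0"
  by (simp add: m_def form_empty)

text \<open>The scalar measure of E(A) f is that of \<open>f\<close> restricted to
  \<open>A\<close>.\<close>

lemma m_E:
  assumes A: "A \<in> sets borel" and C: "C \<in> sets borel" and f: "f \<in> H"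
  shows "m (E A f) C = m f (A \<inter> C)"
proof -
  have i: "A \<inter> C \<in> sets borel" "C - A \<in> sets borel" using A C by auto
  note e = E_in[OF A f]
  have "form C (E A f) (E A f) = form (A \<inter> C) (E A f) (E A f) + form (C - A) (E A f) (E A f)"
  proof -
    have "(A \<inter> C) \<union> (C - A) = C" "(A \<inter> C) \<inter> (C - A) = {}" by auto
    then show ?thesis using form_Un[OF i _ e e] by simp
  qed
  also have "form (C - A) (E A f) (E A f) = 0" by (rule form_E_disjoint[OF A i(2) _ f e]) auto
  also have "form (A \<inter> C) (E A f) (E A f) = form (A \<inter> C) f (E A f)"
    by (rule form_E_subset[OF A i(1) _ f e]) auto
  also have "\<dots> = cnj (form (A \<inter> C) (E A f) f)" by (rule form_cnj[OF i(1) e f])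
  also have "form (A \<inter> C) (E A f) f = form (A \<inter> C) f f"
    by (rule form_E_subset[OF A i(1) _ f f]) auto
  finally show ?thesis by (simp add: m_def)
qed

text \<open>Proportional set functions on the subsets of \<open>A\<close> give equal measures after
  inserting densities; the integrals agree because the measures do, with no integrability to
  check.\<close>

lemma integral_restrict_scaled:
  fixes F :: "real \<Rightarrow> real"
  assumes A: "A \<in> sets borel" and x: "x \<in> H" and y: "y \<in> H" and c: "0 \<le> c"
    and eq: "\<And>C. C \<in> sets borel \<Longrightarrow> C \<subseteq> A \<Longrightarrow> m x C = c * m y C"
    and F: "F \<in> borel_measurable borel"
  shows "(\<integral>t. indicator A t * F t \<partial>\<mu> x) = c * (\<integral>t. indicator A t * F t \<partial>\<mu> y)"
proof -
  note [measurable] = A F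
  have "density (\<mu> x) (\<lambda>t. ennreal (indicator A t)) = density (\<mu> y) (\<lambda>t. ennreal (c * indicator A t))"
  proof (rule measure_eqI)
    fix C assume "C \<in> sets (density (\<mu> x) (\<lambda>t. ennreal (indicator A t)))"
    then have C [measurable]: "C \<in> sets borel" by simp
    then have AC: "A \<inter> C \<in> sets borel" by auto
    have "emeasure (density (\<mu> y) (\<lambda>t. ennreal (c * indicator A t))) C = (\<integral>\<^sup>+t. ennreal c * indicator (A \<inter> C) t \<partial>\<mu> y)"
      by (subst emeasure_density) (auto intro!: nn_integral_cong split: split_indicator)
    also have "\<dots> = ennreal (m x (A \<inter> C))"
      using AC c by (simp add: nn_integral_cmult_indicator emeasure_\<mu>[OF y AC] eq[OF AC] ennreal_mult m_nonneg[OF AC y])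
    also have "\<dots> = emeasure (density (\<mu> x) (\<lambda>t. ennreal (indicator A t))) C"
      using emeasure_restricted[of A "\<mu> x" C] A C by (simp add: emeasure_\<mu>[OF x AC] ennreal_indicator)
    finally show "emeasure (density (\<mu> x) (\<lambda>t. ennreal (indicator A t))) C = emeasure (density (\<mu> y) (\<lambda>t. ennreal (c * indicator A t))) C" ..
  qed simp
  then have "(\<integral>t. F t \<partial>density (\<mu> x) (\<lambda>t. ennreal (indicator A t))) = (\<integral>t. F t \<partial>density (\<mu> y) (\<lambda>t. ennreal (c * indicator A t)))"
    by simp
  then show ?thesis
    using c by (simp add: integral_density mult.assoc)
qed

lemma integrable_bounded_\<mu>:
  fixes F :: "real \<Rightarrow> real"
  assumes x: "x \<in> H" and F: "F \<in> borel_measurable borel" and A: "A \<in> sets borel" "\<And>t. t \<in> A \<Longrightarrow> \<bar>F t\<bar> \<le> B"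
  shows "integrable (\<mu> x) (\<lambda>t. indicator A t * F t)"
proof -
  interpret finite_measure "\<mu> x" by (rule finite_\<mu>[OF x])
  note [measurable] = F A(1)
  show ?thesis
    by (rule integrable_const_bound[of _ "\<bar>B\<bar>"]) (use A(2) in \<open>force intro!: AE_I2 split: split_indicator\<close>)+
qed

lemma integral_indicator_\<mu>: "x \<in> H \<Longrightarrow> A \<in> sets borel \<Longrightarrow> (\<integral>t. indicator A t \<partial>\<mu> x) = m x A"
  by (simp add: measure_\<mu>)

end

text \<open>The graph \<open>T\<close> enters only through linearity, symmetry and the lower bound;
  the link with \<open>E\<close> is the domain criterion and the quadratic identity contained in
  \<open>spectral\<close>.\<close>

locale spectral_operator = pvm M H E
  for M :: "'a measure" and H E +
  fixes T :: "(('a \<Rightarrow> complex) \<times> ('a \<Rightarrow> complex)) set" and \<gamma> :: real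
  assumes spectral: "is_spectral_measure M H T E"
    and T_in: "\<And>f h. (f, h) \<in> T \<Longrightarrow> f \<in> H \<and> h \<in> H"
    and T_lincomb: "\<And>f h f' h' a b. (f, h) \<in> T \<Longrightarrow> (f', h') \<in> T \<Longrightarrow>
      (\<lambda>x. a * f x + b * f' x, \<lambda>x. a * h x + b * h' x) \<in> T"
    and T_symmetric: "\<And>f h f' h'. (f, h) \<in> T \<Longrightarrow> (f', h') \<in> T \<Longrightarrow> L2_inner M h f' = L2_inner M f h'"
    and T_below: "\<And>f h. (f, h) \<in> T \<Longrightarrow> \<gamma> * Re (L2_inner M f f) \<le> Re (L2_inner M h f)"
begin

lemma Domain_iff: "f \<in> H \<Longrightarrow> f \<in> Domain T \<longleftrightarrow> integrable (\<mu> f) (\<lambda>t. t\<^sup>2)"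
  using spectral by (simp add: is_spectral_measure_def)

lemma T_quadratic: "(f, h) \<in> T \<Longrightarrow> L2_inner M h f = complex_of_real (\<integral>t. t \<partial>\<mu> f)"
  using spectral by (auto simp: is_spectral_measure_def)

lemma integrable_id_Domain:
  assumes "(f, h) \<in> T"
  shows "integrable (\<mu> f) (\<lambda>t. t)"
proof -
  have f: "f \<in> H" using T_in[OF assms] by simp
  interpret finite_measure "\<mu> f" by (rule finite_\<mu>[OF f])
  have "integrable (\<mu> f) (\<lambda>t. t\<^sup>2)" using Domain_iff[OF f] assms by auto
  then show ?thesis by (rule square_integrable_imp_integrable[rotated]) simp
qed

text \<open>The scalar measure of E(A) f is carried by the bounded set \<open>A\<close>, so t^2 is
  integrable and the domain criterion applies.\<close>

lemma E_bounded_Domain: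
  assumes A: "A \<in> sets borel" "A \<subseteq> {a..b}" and f: "f \<in> H"
  obtains h where "(E A f, h) \<in> T"
proof -
  note e = E_in[OF A(1) f]
  interpret finite_measure "\<mu> (E A f)" by (rule finite_\<mu>[OF e])
  have "emeasure (\<mu> (E A f)) (- A) = 0"
    using A(1) f by (simp add: emeasure_\<mu>[OF e] m_E[OF A(1) _ f])
  then have "AE t in \<mu> (E A f). t \<in> A"
    by (intro AE_I[of _ _ "- A"]) (use A(1) in auto)
  then have "AE t in \<mu> (E A f). norm (t\<^sup>2) \<le> (\<bar>a\<bar> + \<bar>b\<bar>)\<^sup>2"
  proof eventually_elim
    case (elim t)
    have "\<bar>t\<bar> \<le> \<bar>a\<bar> + \<bar>b\<bar>" using subsetD[OF A(2) elim] by auto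
    then show ?case by (simp add: abs_le_square_iff[symmetric])
  qed
  then have "integrable (\<mu> (E A f)) (\<lambda>t. t\<^sup>2)" by (rule integrable_const_bound) simp
  then have "E A f \<in> Domain T" using Domain_iff[OF e] by simp
  with that show thesis by blast
qed

text \<open>For the vector E([a,b]) f the quadratic form is at most b times its squared norm, but
  also at least gamma times it; as b < gamma, the vector has norm 0.\<close>

lemma m_below_zero:
  assumes f: "f \<in> H" and b: "b < \<gamma>"
  shows "m f {a..b} = 0"
proof -
  have A: "{a..b} \<in> sets borel" by simp
  obtain h where h: "(E {a..b} f, h) \<in> T" by (rule E_bounded_Domain[OF A order_refl f])
  note e = E_in[OF A f]
  interpret finite_measure "\<mu> (E {a..b} f)" by (rule finite_\<mu>[OF e])
  have total: "m (E {a..b} f) UNIV = m f {a..b}" by (simp add: m_E[OF A _ f])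
  have "emeasure (\<mu> (E {a..b} f)) (- {a..b}) = 0"
    using f by (simp add: emeasure_\<mu>[OF e] m_E[OF A _ f])
  then have AE: "AE t in \<mu> (E {a..b} f). t \<le> b"
    by (intro AE_I[of _ _ "- {a..b}"]) auto
  have "\<gamma> * m (E {a..b} f) UNIV = \<gamma> * Re (L2_inner M (E {a..b} f) (E {a..b} f))"
    by (simp add: m_def form_UNIV[OF e e])
  also have "\<dots> \<le> (\<integral>t. t \<partial>\<mu> (E {a..b} f))"
    using T_below[OF h] T_quadratic[OF h] by simp
  also have "\<dots> \<le> (\<integral>t. b \<partial>\<mu> (E {a..b} f))"
    by (rule integral_mono_AE[OF integrable_id_Domain[OF h] _ AE]) simp
  also have "\<dots> = b * m (E {a..b} f) UNIV" by (simp add: measure_\<mu>[OF e])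
  finally have "(\<gamma> - b) * m f {a..b} \<le> 0" by (simp add: total algebra_simps)
  then show ?thesis using b m_nonneg[OF A f] by (simp add: mult_le_0_iff)
qed

lemma AE_ge: 
  assumes f: "f \<in> H"
  shows "AE t in \<mu> f. \<gamma> \<le> t"
proof -
  have "{..<\<gamma>} = (\<Union>n. {- real n .. \<gamma> - 1 / real (Suc n)})"
  proof (intro equalityI subsetI)
    fix t assume "t \<in> {..<\<gamma>}"
    then have t: "0 < \<gamma> - t" by simp
    obtain n1 where n1: "inverse (real (Suc n1)) < \<gamma> - t" using reals_Archimedean[OF t] by blast
    obtain n2 where n2: "- t < real n2" using reals_Archimedean2 by blast
    have "inverse (real (Suc (max n1 n2))) \<le> inverse (real (Suc n1))" by simp
    then have "t \<in> {- real (max n1 n2) .. \<gamma> - 1 / real (Suc (max n1 n2))}"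
      using n1 n2 by (auto simp: inverse_eq_divide)
    then show "t \<in> (\<Union>n. {- real n .. \<gamma> - 1 / real (Suc n)})" by blast
  next
    fix t assume "t \<in> (\<Union>n. {- real n .. \<gamma> - 1 / real (Suc n)})"
    then obtain n where n: "t \<le> \<gamma> - 1 / real (Suc n)" by auto
    have "0 < 1 / real (Suc n)" by simp
    with n show "t \<in> {..<\<gamma>}" by (simp only: lessThan_iff)
  qed
  moreover have "(\<Union>n. {- real n .. \<gamma> - 1 / real (Suc n)}) \<in> null_sets (\<mu> f)"
    by (intro null_sets_UN null_setsI) (auto simp: emeasure_\<mu>[OF f] m_below_zero[OF f])
  ultimately have "{..<\<gamma>} \<in> null_sets (\<mu> f)" by simp
  then have "AE t in \<mu> f. t \<notin> {..<\<gamma>}" by (rule AE_not_in)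
  then show ?thesis by eventually_elim simp
qed

text \<open>Real polarization of $t \mapsto \int t \, d\mu$ along \<open>E A g \<plusminus> f\<close>; outside \<open>A\<close> both spectral
  measures coincide with the one of \<open>f\<close>, so these parts cancel.\<close>

lemma polarization:
  assumes T: "(f, h) \<in> T" and g: "g \<in> H" and A: "A \<in> sets borel" "A \<subseteq> {a..b}"
  shows "4 * Re (form A g h) =
    (\<integral>t. indicator A t * t \<partial>\<mu> (\<lambda>x. of_real 1 * g x + of_real 1 * f x)) -
    (\<integral>t. indicator A t * t \<partial>\<mu> (\<lambda>x. of_real 1 * g x + of_real (-1) * f x))"
proof -
  have f: "f \<in> H" and h: "h \<in> H" using T_in[OF T] by auto
  have A': "- A \<in> sets borel" using A by auto
  obtain h1 where T1: "(E A g, h1) \<in> T" by (rule E_bounded_Domain[OF A g])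
  note e = E_in[OF A(1) g]
  have h1: "h1 \<in> H" using T_in[OF T1] by auto
  \<comment> \<open>\<open>p s\<close> lies in the domain since E(A) g does, while
    \<open>y s\<close> need not. On subsets of \<open>A\<close> their scalar measures coincide, so
    integrals over \<open>A\<close> can be moved to \<open>y s\<close>.\<close>
  define p where "p s = (\<lambda>x. complex_of_real 1 * E A g x + complex_of_real s * f x)" for s
  define q where "q s = (\<lambda>x. complex_of_real 1 * h1 x + complex_of_real s * h x)" for s
  define y where "y s = (\<lambda>x. complex_of_real 1 * g x + complex_of_real s * f x)" for s
  have pT: "(p s, q s) \<in> T" for s unfolding p_def q_def by (rule T_lincomb[OF T1 T])
  have pH: "p s \<in> H" for s using T_in[OF pT] by auto
  have yH: "y s \<in> H" for s unfolding y_def by (rule H_lincomb[OF g f])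
  have inA: "m (p s) C = 1 * m (y s) C" if C: "C \<in> sets borel" "C \<subseteq> A" for C s
    using that unfolding p_def y_def m_lincomb[OF C(1) e f] m_lincomb[OF C(1) g f]
    by (simp add: m_E[OF A(1) C(1) g] form_E_subset[OF A(1) C g f] Int_absorb1)
  have outA: "m (p s) C = s\<^sup>2 * m f C" if C: "C \<in> sets borel" "C \<subseteq> - A" for C s
  proof -
    have AC: "A \<inter> C = {}" using C by auto
    show ?thesis unfolding p_def m_lincomb[OF C(1) e f]
      using form_empty[OF g g]
      by (simp add: m_E[OF A(1) C(1) g] form_E_disjoint[OF A(1) C(1) AC g f] AC) (simp add: m_def)
  qed
  have split: "(\<integral>t. t \<partial>\<mu> (p s)) = (\<integral>t. indicator A t * t \<partial>\<mu> (y s)) + s\<^sup>2 * (\<integral>t. indicator (- A) t * t \<partial>\<mu> f)" for s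
  proof -
    have i: "integrable (\<mu> (p s)) (\<lambda>t. indicator B t * t)" if "B \<in> sets borel" for B
      using integrable_mult_indicator[OF _ integrable_id_Domain[OF pT[of s]], of B] that by simp
    have "(\<integral>t. t \<partial>\<mu> (p s)) = (\<integral>t. indicator A t * t + indicator (- A) t * t \<partial>\<mu> (p s))"
      by (rule Bochner_Integration.integral_cong) (auto split: split_indicator)
    also have "\<dots> = (\<integral>t. indicator A t * t \<partial>\<mu> (p s)) + (\<integral>t. indicator (- A) t * t \<partial>\<mu> (p s))"
      by (rule Bochner_Integration.integral_add[OF i[OF A(1)] i[OF A']])
    also have "(\<integral>t. indicator A t * t \<partial>\<mu> (p s)) = 1 * (\<integral>t. indicator A t * t \<partial>\<mu> (y s))"
      by (rule integral_restrict_scaled[OF A(1) pH yH _ inA]) auto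
    also have "(\<integral>t. indicator (- A) t * t \<partial>\<mu> (p s)) = s\<^sup>2 * (\<integral>t. indicator (- A) t * t \<partial>\<mu> f)"
      by (rule integral_restrict_scaled[OF A' pH f _ outA]) auto
    finally show ?thesis by simp
  qed
  have "L2_inner M (q s) (p s) = L2_inner M h1 (E A g) + of_real s * L2_inner M h1 f + of_real s * L2_inner M h (E A g) + of_real (s\<^sup>2) * L2_inner M h f" for s
  proof -
    have "L2_inner M (q s) (p s) = of_real 1 * L2_inner M h1 (p s) + of_real s * L2_inner M h (p s)"
      unfolding q_def by (rule L2_inner_lincomb_left) (use h1 h pH in auto)
    also have "L2_inner M k (p s) = L2_inner M k (E A g) + of_real s * L2_inner M k f" if "k \<in> H" for k
      unfolding p_def using e f that by (subst L2_inner_lincomb_right) auto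
    from this[OF h1] this[OF h]
    have "of_real 1 * L2_inner M h1 (p s) + of_real s * L2_inner M h (p s) =
      of_real 1 * (L2_inner M h1 (E A g) + of_real s * L2_inner M h1 f) + of_real s * (L2_inner M h (E A g) + of_real s * L2_inner M h f)"
      by simp
    finally show ?thesis by (simp add: algebra_simps power2_eq_square)
  qed
  from this[of 1] this[of "-1"]
  have "Re (L2_inner M (q 1) (p 1)) - Re (L2_inner M (q (-1)) (p (-1))) = 2 * Re (L2_inner M h1 f) + 2 * Re (L2_inner M h (E A g))"
    by simp
  \<comment> \<open>Symmetry of \<open>T\<close> makes the two cross terms conjugate, so each
    contributes twice the real part of \<open>form A g h\<close>.\<close>
  also have "L2_inner M h1 f = L2_inner M (E A g) h" by (rule T_symmetric[OF T1 T])
  also have "L2_inner M h (E A g) = cnj (L2_inner M (E A g) h)" by (rule L2_inner_cnj)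
  finally have "4 * Re (form A g h) = Re (L2_inner M (q 1) (p 1)) - Re (L2_inner M (q (-1)) (p (-1)))"
    by (simp add: form_def)
  also have "\<dots> = (\<integral>t. t \<partial>\<mu> (p 1)) - (\<integral>t. t \<partial>\<mu> (p (-1)))"
    by (simp add: T_quadratic[OF pT])
  also have "\<dots> = (\<integral>t. indicator A t * t \<partial>\<mu> (y 1)) - (\<integral>t. indicator A t * t \<partial>\<mu> (y (-1)))"
    by (simp add: split)
  finally show ?thesis unfolding y_def .
qed

lemma polarization_shift:
  assumes T: "(f, h) \<in> T" and g: "g \<in> H" and A: "A \<in> sets borel" "A \<subseteq> {a..b}"
    and \<kappa>: "\<kappa> = (\<lambda>x. of_real 1 * h x + of_real (- lam) * f x)"
  shows "4 * Re (form A g \<kappa>) =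
    (\<integral>t. indicator A t * (t - lam) \<partial>\<mu> (\<lambda>x. of_real 1 * g x + of_real 1 * f x)) -
    (\<integral>t. indicator A t * (t - lam) \<partial>\<mu> (\<lambda>x. of_real 1 * g x + of_real (-1) * f x))"
proof -
  have f: "f \<in> H" and h: "h \<in> H" using T_in[OF T] by auto
  define y where "y s = (\<lambda>x. complex_of_real 1 * g x + complex_of_real s * f x)" for s
  have yH: "y s \<in> H" for s unfolding y_def by (rule H_lincomb[OF g f])
  have "form A g \<kappa> = form A g h - of_real lam * form A g f"
    unfolding \<kappa> by (simp add: form_lincomb_right[OF A(1) h f g] del: of_real_minus of_real_1) simp
  then have "4 * Re (form A g \<kappa>) = 4 * Re (form A g h) - lam * (4 * Re (form A g f))" by simp
  also have "4 * Re (form A g f) = m (y 1) A - m (y (-1)) A"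
    unfolding y_def m_lincomb[OF A(1) g f] by simp
  also have "4 * Re (form A g h) = (\<integral>t. indicator A t * t \<partial>\<mu> (y 1)) - (\<integral>t. indicator A t * t \<partial>\<mu> (y (-1)))"
    unfolding y_def by (rule polarization[OF T g A])
  finally have *: "4 * Re (form A g \<kappa>) = ((\<integral>t. indicator A t * t \<partial>\<mu> (y 1)) - lam * m (y 1) A) - ((\<integral>t. indicator A t * t \<partial>\<mu> (y (-1))) - lam * m (y (-1)) A)"
    by (simp add: algebra_simps)
  have "(\<integral>t. indicator A t * (t - lam) \<partial>\<mu> (y s)) = (\<integral>t. indicator A t * t \<partial>\<mu> (y s)) - lam * m (y s) A" for s
  proof -
    have i: "integrable (\<mu> (y s)) (\<lambda>t. indicator A t * t)"
      by (rule integrable_bounded_\<mu>[OF yH _ A(1), of _ "\<bar>a\<bar> + \<bar>b\<bar>"]) (use A(2) in \<open>auto dest!: subsetD\<close>)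
    have i2: "integrable (\<mu> (y s)) (\<lambda>t. lam * (indicator A t * 1))"
      by (intro integrable_mult_right integrable_bounded_\<mu>[OF yH _ A(1), of _ 1]) auto
    have "(\<integral>t. indicator A t * (t - lam) \<partial>\<mu> (y s)) = (\<integral>t. indicator A t * t - lam * (indicator A t * 1) \<partial>\<mu> (y s))"
      by (rule Bochner_Integration.integral_cong) (auto simp: algebra_simps)
    also have "\<dots> = (\<integral>t. indicator A t * t \<partial>\<mu> (y s)) - lam * (\<integral>t. indicator A t \<partial>\<mu> (y s))"
      by (subst Bochner_Integration.integral_diff[OF i i2]) simp
    finally show ?thesis by (simp only: integral_indicator_\<mu>[OF yH A(1)])
  qed
  with * show ?thesis by (simp only: y_def)
qed

text \<open>Polarization with g = f: the vector f + f has four times the measure of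
  \<open>f\<close>, and f - f has measure 0.\<close>

lemma form_shift:
  assumes T: "(f, h) \<in> T" and A: "A \<in> sets borel" "A \<subseteq> {a..b}"
    and \<kappa>: "\<kappa> = (\<lambda>x. of_real 1 * h x + of_real (- lam) * f x)"
  shows "Re (form A f \<kappa>) = (\<integral>t. indicator A t * (t - lam) \<partial>\<mu> f)"
proof -
  have f: "f \<in> H" using T_in[OF T] by auto
  note y = H_lincomb[OF f f]
  have c: "m (\<lambda>x. of_real 1 * f x + of_real s * f x) C = (1 + s)\<^sup>2 * m f C" if "C \<in> sets borel" for C s
    unfolding m_lincomb[OF that f f] form_self_m[OF that f] by (simp add: power2_eq_square algebra_simps)
  have "(\<integral>t. indicator A t * (t - lam) \<partial>\<mu> (\<lambda>x. of_real 1 * f x + of_real s * f x)) =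
    (1 + s)\<^sup>2 * (\<integral>t. indicator A t * (t - lam) \<partial>\<mu> f)" for s
    by (rule integral_restrict_scaled[OF A(1) y f _ c]) auto
  from this[of 1] this[of "-1"] polarization_shift[OF T f A \<kappa>] show ?thesis by simp
qed

text \<open>Polarization is used twice. With g = kappa it expresses the mass of kappa on
  \<open>A\<close> by integrating t - lam against the difference of the measures of kappa + f and
  kappa - f. That difference is four times Re (E(.) kappa, f), which by \<open>form_shift\<close>
  has density 4 (t - lam) on \<open>A\<close>. The choice of \<open>A\<close> inside [gamma, b]
  makes t - lam nonnegative and bounded, so all measures involved are positive and all integrals
  finite.\<close>

lemma emeasure_shift_bounded:
  assumes T: "(f, h) \<in> T" and A: "A \<in> sets borel" "A \<subseteq> {\<gamma>..b}" and lam: "lam < \<gamma>"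
    and \<kappa>: "\<kappa> = (\<lambda>x. of_real 1 * h x + of_real (- lam) * f x)"
  shows "emeasure (\<mu> \<kappa>) A = (\<integral>\<^sup>+t. ennreal ((t - lam)\<^sup>2) * indicator A t \<partial>\<mu> f)"
proof -
  note [measurable] = A(1)
  have f: "f \<in> H" and h: "h \<in> H" using T_in[OF T] by auto
  have kH: "\<kappa> \<in> H" unfolding \<kappa> by (rule H_lincomb[OF h f])
  define y where "y s = (\<lambda>x. complex_of_real 1 * \<kappa> x + complex_of_real s * f x)" for s
  have yH: "y s \<in> H" for s unfolding y_def by (rule H_lincomb[OF kH f])
  have pos: "0 \<le> t - lam" "t - lam \<le> \<bar>b\<bar> + \<bar>lam\<bar>" if "t \<in> A" for t
    using subsetD[OF A(2) that] lam by auto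
  have int: "integrable (\<mu> x) (\<lambda>t. indicator B t * (t - lam))" if "x \<in> H" "B \<in> sets borel" "B \<subseteq> A" for x B
    by (rule integrable_bounded_\<mu>[OF that(1) _ that(2), of _ "\<bar>b\<bar> + \<bar>lam\<bar>"]) (use pos that(3) in \<open>auto simp: abs_le_iff\<close>, fastforce+)
  have nn: "(\<integral>\<^sup>+t. ennreal (indicator B t * (t - lam)) \<partial>\<mu> x) = ennreal (\<integral>t. indicator B t * (t - lam) \<partial>\<mu> x)"
    if "x \<in> H" "B \<in> sets borel" "B \<subseteq> A" for x B
    by (rule nn_integral_eq_integral[OF int[OF that]]) (use pos that in \<open>auto intro!: AE_I2 split: split_indicator\<close>)
  let ?N = "\<lambda>s. density (\<mu> (y s)) (indicator A)"
  let ?N3 = "density (\<mu> f) (\<lambda>t. ennreal (4 * (indicator A t * (t - lam))))"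
  define I where "I s = (\<integral>t. indicator A t * (t - lam) \<partial>\<mu> (y s))" for s
  have "(\<integral>\<^sup>+t. ennreal (t - lam) \<partial>?N 1) = (\<integral>\<^sup>+t. ennreal (t - lam) \<partial>?N (-1)) + (\<integral>\<^sup>+t. ennreal (t - lam) \<partial>?N3)"
  proof (rule nn_integral_measure_add[where N = borel])
    fix C :: "real set" assume C [measurable]: "C \<in> sets borel"
    have AC: "A \<inter> C \<in> sets borel" "A \<inter> C \<subseteq> A" using A(1) C by auto
    have "0 \<le> (\<integral>t. indicator (A \<inter> C) t * (t - lam) \<partial>\<mu> f)"
      by (rule integral_nonneg_AE) (use pos in \<open>auto intro!: AE_I2 split: split_indicator\<close>)
    also have "\<dots> = Re (form (A \<inter> C) f \<kappa>)"
      by (rule form_shift[OF T AC(1) _ \<kappa>, of \<gamma> b, symmetric]) (use A(2) in auto)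
    finally have nn0: "0 \<le> Re (form (A \<inter> C) \<kappa> f)" by (simp add: form_cnj[OF AC(1) kH f])
    have "emeasure ?N3 C = (\<integral>\<^sup>+t. 4 * ennreal (indicator (A \<inter> C) t * (t - lam)) \<partial>\<mu> f)"
      using pos by (subst emeasure_density) (auto intro!: nn_integral_cong simp: ennreal_mult split: split_indicator)
    also have "\<dots> = 4 * ennreal (\<integral>t. indicator (A \<inter> C) t * (t - lam) \<partial>\<mu> f)"
      by (subst nn_integral_cmult) (auto simp: nn[OF f AC])
    also have "(\<integral>t. indicator (A \<inter> C) t * (t - lam) \<partial>\<mu> f) = Re (form (A \<inter> C) f \<kappa>)"
      by (rule form_shift[OF T AC(1) _ \<kappa>, of \<gamma> b, symmetric]) (use A(2) in auto)
    also have "4 * ennreal \<dots> = ennreal (4 * Re (form (A \<inter> C) \<kappa> f))"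
      using nn0 by (simp add: form_cnj[OF AC(1) kH f] ennreal_mult)
    finally have N3: "emeasure ?N3 C = ennreal (4 * Re (form (A \<inter> C) \<kappa> f))" .
    have "m (y 1) (A \<inter> C) = m (y (-1)) (A \<inter> C) + 4 * Re (form (A \<inter> C) \<kappa> f)"
      unfolding y_def m_lincomb[OF AC(1) kH f] by simp
    then show "emeasure (?N 1) C = emeasure (?N (-1)) C + emeasure ?N3 C"
      unfolding N3 using A(1) C AC
      by (simp add: emeasure_restricted emeasure_\<mu>[OF yH AC(1)] ennreal_plus m_nonneg[OF AC(1) yH] nn0)
  qed auto
  also have "(\<integral>\<^sup>+t. ennreal (t - lam) \<partial>?N3) = 4 * (\<integral>\<^sup>+t. ennreal ((t - lam)\<^sup>2) * indicator A t \<partial>\<mu> f)"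
  proof -
    have "(\<integral>\<^sup>+t. ennreal (t - lam) \<partial>?N3) = (\<integral>\<^sup>+t. ennreal (4 * (indicator A t * (t - lam))) * ennreal (t - lam) \<partial>\<mu> f)"
      by (rule nn_integral_density) auto
    also have "\<dots> = (\<integral>\<^sup>+t. 4 * (ennreal ((t - lam)\<^sup>2) * indicator A t) \<partial>\<mu> f)"
      using pos by (intro nn_integral_cong) (auto simp: ennreal_mult power2_eq_square mult.assoc split: split_indicator)
    also have "\<dots> = 4 * (\<integral>\<^sup>+t. ennreal ((t - lam)\<^sup>2) * indicator A t \<partial>\<mu> f)"
      by (rule nn_integral_cmult) auto
    finally show ?thesis .
  qed
  finally have pre: "(\<integral>\<^sup>+t. ennreal (t - lam) \<partial>?N 1) =
    (\<integral>\<^sup>+t. ennreal (t - lam) \<partial>?N (-1)) + 4 * (\<integral>\<^sup>+t. ennreal ((t - lam)\<^sup>2) * indicator A t \<partial>\<mu> f)" .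
  have NI: "(\<integral>\<^sup>+t. ennreal (t - lam) \<partial>?N s) = ennreal (I s)" for s
  proof -
    have "(\<integral>\<^sup>+t. ennreal (t - lam) \<partial>?N s) = (\<integral>\<^sup>+t. indicator A t * ennreal (t - lam) \<partial>\<mu> (y s))"
      by (rule nn_integral_density) auto
    also have "\<dots> = (\<integral>\<^sup>+t. ennreal (indicator A t * (t - lam)) \<partial>\<mu> (y s))"
      by (intro nn_integral_cong) (auto split: split_indicator)
    finally show ?thesis using nn[OF yH A(1) order_refl] by (simp add: I_def)
  qed
  note eq = pre[unfolded NI]
  \<comment> \<open>Both integrals are finite reals, so the common summand can be cancelled after
    passing to \<open>ennreal\<close>.\<close>
  have "4 * m \<kappa> A = I 1 - I (-1)"
    using polarization_shift[OF T kH A \<kappa>] unfolding I_def y_def m_def .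
  moreover have "0 \<le> I (-1)" unfolding I_def
    by (rule integral_nonneg_AE) (use pos in \<open>auto intro!: AE_I2 split: split_indicator\<close>)
  ultimately have "ennreal (I (-1)) + 4 * ennreal (m \<kappa> A) = ennreal (I 1)"
    using m_nonneg[OF A(1) kH] by (simp flip: ennreal_numeral ennreal_mult ennreal_plus)
  with eq have "4 * ennreal (m \<kappa> A) = 4 * (\<integral>\<^sup>+t. ennreal ((t - lam)\<^sup>2) * indicator A t \<partial>\<mu> f)"
    by (simp add: ennreal_add_left_cancel)
  then show ?thesis
    by (simp add: emeasure_\<mu>[OF kH A(1)] ennreal_mult_cancel_left)
qed

text \<open>Exhaust by bounded pieces of [gamma, infinity), outside of which both measures
  vanish.\<close>

lemma \<mu>_shift:
  assumes T: "(f, h) \<in> T" and lam: "lam < \<gamma>"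
    and \<kappa>: "\<kappa> = (\<lambda>x. of_real 1 * h x + of_real (- lam) * f x)"
  shows "\<mu> \<kappa> = density (\<mu> f) (\<lambda>t. ennreal ((t - lam)\<^sup>2))" (is "_ = ?N")
proof (rule measure_eqI)
  have f: "f \<in> H" and h: "h \<in> H" using T_in[OF T] by auto
  have kH: "\<kappa> \<in> H" unfolding \<kappa> by (rule H_lincomb[OF h f])
  fix A assume "A \<in> sets (\<mu> \<kappa>)"
  then have A: "A \<in> sets borel" by simp
  let ?A = "\<lambda>n::nat. A \<inter> {\<gamma>..real n}"
  have inc: "incseq ?A" by (auto simp: incseq_def)
  have U: "(\<Union>n. ?A n) = A \<inter> {\<gamma>..}" by (auto intro: real_arch_simple)
  have An: "?A n \<in> sets borel" for n using A by auto
  have eq: "emeasure (\<mu> \<kappa>) (?A n) = emeasure ?N (?A n)" for n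
    by (subst emeasure_shift_bounded[OF T An _ lam \<kappa>]) (use An in \<open>auto simp: emeasure_density\<close>)
  have 1: "emeasure (\<mu> \<kappa>) A = emeasure (\<mu> \<kappa>) (A \<inter> {\<gamma>..})"
    by (rule emeasure_eq_AE) (use AE_ge[OF kH] A in auto)
  have 2: "emeasure ?N A = emeasure ?N (A \<inter> {\<gamma>..})"
  proof (rule emeasure_eq_AE)
    show "AE t in ?N. t \<in> A \<longleftrightarrow> t \<in> A \<inter> {\<gamma>..}"
      by (subst AE_density) (use AE_ge[OF f] in auto)
  qed (use A in auto)
  show "emeasure (\<mu> \<kappa>) A = emeasure ?N A"
    unfolding 1 2 U[symmetric]
    by (subst (1 2) SUP_emeasure_incseq[symmetric]) (use inc An eq in auto)
qed simp

text \<open>With kappa = (T - lam) f, dividing the density (t - lam)^2 by t - lam leaves the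
  quadratic form of T - lam at \<open>f\<close>. The right-hand side is what ((T - lam)^(-1) kappa,
  kappa) should be, obtained from the preimage \<open>f\<close> alone.\<close>

lemma resolvent_integral:
  assumes T: "(f, h) \<in> T" and lam: "lam < \<gamma>"
    and \<kappa>: "\<kappa> = (\<lambda>x. of_real 1 * h x + of_real (- lam) * f x)"
  shows "(\<integral>t. 1 / (t - lam) \<partial>\<mu> \<kappa>) = Re (L2_inner M \<kappa> f)"
proof -
  have f: "f \<in> H" and h: "h \<in> H" using T_in[OF T] by auto
  interpret finite_measure "\<mu> f" by (rule finite_\<mu>[OF f])
  note it = integrable_id_Domain[OF T]
  have "(\<integral>t. 1 / (t - lam) \<partial>\<mu> \<kappa>) = (\<integral>t. (t - lam)\<^sup>2 *\<^sub>R (1 / (t - lam)) \<partial>\<mu> f)"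
    unfolding \<mu>_shift[OF T lam \<kappa>] by (rule integral_density) auto
  also have "\<dots> = (\<integral>t. t - lam \<partial>\<mu> f)"
    by (rule integral_cong_AE) (use AE_ge[OF f] lam in \<open>auto simp: power2_eq_square elim!: eventually_mono\<close>)
  also have "\<dots> = (\<integral>t. t \<partial>\<mu> f) - lam * m f UNIV"
    by (subst Bochner_Integration.integral_diff[OF it]) (simp_all add: measure_\<mu>[OF f])
  also have "(\<integral>t. t \<partial>\<mu> f) = Re (L2_inner M h f)" by (simp add: T_quadratic[OF T])
  also have "m f UNIV = Re (L2_inner M f f)" by (simp add: m_def form_UNIV[OF f f])
  also have "Re (L2_inner M h f) - lam * Re (L2_inner M f f) = Re (L2_inner M \<kappa> f)"
    unfolding \<kappa> using f h by (subst L2_inner_lincomb_left) auto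
  finally show ?thesis .
qed

end

section \<open>Analytic continuation of the resolvent\<close>

text \<open>Differentiation under the integral sign: the mean value inequality on a ball bounds the
  difference quotients by the majorant of the derivative, and dominated convergence applies along
  sequences.\<close>

lemma holomorphic_integral:
  fixes g :: "complex \<Rightarrow> 'a \<Rightarrow> complex"
  assumes U: "open U" and int: "\<And>z. z \<in> U \<Longrightarrow> integrable M (g z)" and m': "\<And>z. z \<in> U \<Longrightarrow> g' z \<in> borel_measurable M"
    and der: "AE x in M. \<forall>z\<in>U. ((\<lambda>z. g z x) has_field_derivative g' z x) (at z)"
    and dom: "\<And>z0. z0 \<in> U \<Longrightarrow> \<exists>r>0. \<exists>B. ball z0 r \<subseteq> U \<and> integrable M B \<and> (AE x in M. \<forall>z\<in>ball z0 r. cmod (g' z x) \<le> B x)"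
  shows "(\<lambda>z. \<integral>x. g z x \<partial>M) holomorphic_on U"
  unfolding holomorphic_on_open[OF U]
proof
  fix z0 assume z0: "z0 \<in> U"
  obtain r B where r: "r > 0" "ball z0 r \<subseteq> U" and B: "integrable M B"
    and le: "AE x in M. \<forall>z\<in>ball z0 r. cmod (g' z x) \<le> B x" using dom[OF z0] by blast
  have "((\<lambda>z. ((\<integral>x. g z x \<partial>M) - (\<integral>x. g z0 x \<partial>M)) / (z - z0)) \<longlongrightarrow> (\<integral>x. g' z0 x \<partial>M)) (at z0)"
    unfolding tendsto_at_iff_sequentially
  proof (intro allI impI)
    fix X assume X: "\<forall>i. X i \<in> UNIV - {z0}" "X \<longlonglongrightarrow> z0"
    have "\<forall>\<^sub>F i in sequentially. X i \<in> ball z0 r"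
      using X(2) r(1) by (intro topological_tendstoD) auto
    then obtain N where N: "\<And>i. i \<ge> N \<Longrightarrow> X i \<in> ball z0 r" by (auto simp: eventually_sequentially)
    \<comment> \<open>Dropping finitely many terms keeps the sequence in the ball where the majorant
      is valid.\<close>
    define Y where "Y i = X (i + N)" for i
    have Y: "Y i \<in> ball z0 r" "Y i \<noteq> z0" for i using N X(1) by (auto simp: Y_def)
    have YU: "Y i \<in> U" for i using Y r(2) by blast
    have Yl: "Y \<longlonglongrightarrow> z0" unfolding Y_def using X(2) by (rule LIMSEQ_ignore_initial_segment)
    have "(\<lambda>i. \<integral>x. (g (Y i) x - g z0 x) / (Y i - z0) \<partial>M) \<longlonglongrightarrow> (\<integral>x. g' z0 x \<partial>M)"
    proof (rule integral_dominated_convergence[OF m'[OF z0] _ B])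
      show "(\<lambda>x. (g (Y i) x - g z0 x) / (Y i - z0)) \<in> borel_measurable M" for i
        using int[OF YU[of i]] int[OF z0] by auto
      show "AE x in M. (\<lambda>i. (g (Y i) x - g z0 x) / (Y i - z0)) \<longlonglongrightarrow> g' z0 x"
        using der
      proof eventually_elim
        case (elim x)
        then have "((\<lambda>z. (g z x - g z0 x) / (z - z0)) \<longlongrightarrow> g' z0 x) (at z0)"
          using z0 by (simp add: has_field_derivative_iff)
        then show ?case using Y Yl unfolding tendsto_at_iff_sequentially by (auto simp: o_def)
      qed
      show "AE x in M. norm ((g (Y i) x - g z0 x) / (Y i - z0)) \<le> B x" for i
        using der le
      proof eventually_elim
        case (elim x)
        have "((\<lambda>z. g z x) has_field_derivative g' z x) (at z within ball z0 r)" if "z \<in> ball z0 r" for z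
          using that elim(1) r(2) has_field_derivative_at_within by blast
        then have "cmod (g (Y i) x - g z0 x) \<le> B x * cmod (Y i - z0)"
          by (rule field_differentiable_bound[of "ball z0 r" "\<lambda>z. g z x" "\<lambda>z. g' z x", rotated])
            (use elim r Y in auto)
        then show ?case using Y(2)[of i] by (simp add: norm_divide divide_le_eq)
      qed
    qed
    also have "(\<lambda>i. \<integral>x. (g (Y i) x - g z0 x) / (Y i - z0) \<partial>M) = (\<lambda>i. ((\<integral>x. g (Y i) x \<partial>M) - (\<integral>x. g z0 x \<partial>M)) / (Y i - z0))"
      by (simp add: Bochner_Integration.integral_diff[OF int[OF YU] int[OF z0]])
    finally show "((\<lambda>z. ((\<integral>x. g z x \<partial>M) - (\<integral>x. g z0 x \<partial>M)) / (z - z0)) \<circ> X) \<longlonglongrightarrow> (\<integral>x. g' z0 x \<partial>M)"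
      unfolding Y_def o_def by (rule LIMSEQ_offset)
  qed
  then show "\<exists>f'. ((\<lambda>z. \<integral>x. g z x \<partial>M) has_field_derivative f') (at z0)"
    by (auto simp: has_field_derivative_iff)
qed

text \<open>A connected region that contains both the ray where the formula is known and the upper
  half-plane where it is wanted. For z in it and t >= gamma, the number t - z avoids the cut of
  \<open>Ln\<close>.\<close>

definition slit_domain :: "real \<Rightarrow> complex set" where
  "slit_domain \<gamma> = {z. Re z < \<gamma>} \<union> {z. Im z > 0}"

lemma open_slit_domain: "open (slit_domain \<gamma>)"
  unfolding slit_domain_def by (intro open_Un open_halfspace_Re_lt open_halfspace_Im_gt)

lemma connected_slit_domain: "connected (slit_domain \<gamma>)"
proof -
  have "Complex (\<gamma> - 1) 1 \<in> {z. Re z < \<gamma>} \<inter> {z. Im z > 0}" by simp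
  then show ?thesis unfolding slit_domain_def
    by (intro connected_Un convex_connected convex_halfspace_Re_lt convex_halfspace_Im_gt) blast
qed

lemma slit_domain_nonpos:
  assumes "z \<in> slit_domain \<gamma>" "\<gamma> \<le> t"
  shows "complex_of_real t - z \<notin> \<real>\<^sub>\<le>\<^sub>0"
  using assms by (auto simp: slit_domain_def complex_nonpos_Reals_iff)

text \<open>Half the distance from \<open>z0\<close> to the boundary of a half-plane containing it
  serves both as radius and as lower bound, which gives locally uniform majorants for the
  kernels.\<close>

lemma slit_domain_dist:
  assumes "z0 \<in> slit_domain \<gamma>"
  obtains d where "d > 0" "ball z0 d \<subseteq> slit_domain \<gamma>"
    "\<And>z t. z \<in> ball z0 d \<Longrightarrow> \<gamma> \<le> t \<Longrightarrow> d \<le> cmod (of_real t - z)"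
proof (cases "Re z0 < \<gamma>")
  case True
  define d where "d = (\<gamma> - Re z0) / 2"
  have d: "d > 0" "2 * d = \<gamma> - Re z0" using True by (auto simp: d_def)
  have Re: "Re z < \<gamma> - d" if "z \<in> ball z0 d" for z
    using that abs_Re_le_cmod[of "z0 - z"] d by (auto simp: dist_norm)
  have "d \<le> cmod (of_real t - z)" if "z \<in> ball z0 d" "\<gamma> \<le> t" for z t
    using Re[OF that(1)] that(2) abs_Re_le_cmod[of "of_real t - z"] by auto
  moreover have "ball z0 d \<subseteq> slit_domain \<gamma>" using Re d by (force simp: slit_domain_def)
  ultimately show thesis using that d by blast
next
  case False
  define d where "d = Im z0 / 2"
  have d: "d > 0" "2 * d = Im z0" using False assms by (auto simp: d_def slit_domain_def)
  have Im: "Im z > d" if "z \<in> ball z0 d" for z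
    using that abs_Im_le_cmod[of "z0 - z"] d by (auto simp: dist_norm)
  have "d \<le> cmod (of_real t - z)" if "z \<in> ball z0 d" "\<gamma> \<le> t" for z t
    using Im[OF that(1)] abs_Im_le_cmod[of "of_real t - z"] by auto
  moreover have "ball z0 d \<subseteq> slit_domain \<gamma>" using Im d by (force simp: slit_domain_def)
  ultimately show thesis using that d by blast
qed

lemma abs_ln_le_add:
  fixes d x :: real
  assumes "0 < d" "d \<le> x"
  shows "\<bar>ln x\<bar> \<le> x + \<bar>ln d\<bar>"
proof -
  have "ln d \<le> ln x" "ln x \<le> x" using assms ln_le_minus_one[of x] by auto
  then show ?thesis using assms by linarith
qed

text \<open>Instance in mind: \<open>\<mu>\<close> is the scalar spectral measure of k_w,
  \<open>\<nu>\<close> the law of omega under the Poisson measure at w, and K = 1 / (1 - |w|^2). The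
  rest of the analysis takes place on the line only.\<close>

locale stieltjes_exp =
  fixes \<mu> \<nu> :: "real measure" and \<gamma> K :: real
  assumes finite_mu: "finite_measure \<mu>" and sets_mu [simp, measurable_cong]: "sets \<mu> = sets borel"
    and prob_nu: "prob_space \<nu>" and sets_nu [simp, measurable_cong]: "sets \<nu> = sets borel"
    and mu_ge: "AE t in \<mu>. \<gamma> \<le> t" and nu_ge: "AE s in \<nu>. \<gamma> \<le> s"
    and moment: "integrable \<nu> (\<lambda>s. s)" and nondegenerate: "\<And>c. \<not> (AE s in \<nu>. s = c)"
    and K: "K > 0"
    and transform: "\<And>x. x < \<gamma> \<Longrightarrow> (\<integral>t. 1 / (t - x) \<partial>\<mu>) = K * exp (- (\<integral>s. ln (s - x) \<partial>\<nu>))"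
begin

interpretation mu: finite_measure \<mu> by (rule finite_mu)
interpretation nu: prob_space \<nu> by (rule prob_nu)

lemma space_mu [simp]: "space \<mu> = UNIV" and space_nu [simp]: "space \<nu> = UNIV"
  using sets_eq_imp_space_eq[OF sets_mu] sets_eq_imp_space_eq[OF sets_nu] by auto

lemma integrable_cauchy_kernel:
  assumes "z \<in> slit_domain \<gamma>"
  shows "integrable \<mu> (\<lambda>t. 1 / (complex_of_real t - z))"
proof -
  obtain d where d: "d > 0" "\<And>z' t. z' \<in> ball z d \<Longrightarrow> \<gamma> \<le> t \<Longrightarrow> d \<le> cmod (of_real t - z')"
    by (rule slit_domain_dist[OF assms]) (rule that)
  show ?thesis
  proof (rule mu.integrable_const_bound[of _ "1 / d"])
    show "AE t in \<mu>. norm (1 / (complex_of_real t - z)) \<le> 1 / d"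
      using mu_ge by eventually_elim (use d in \<open>auto simp: norm_divide intro!: frac_le\<close>)
  qed measurable
qed

lemma norm_Ln_le: "z \<noteq> 0 \<Longrightarrow> cmod (Ln z) \<le> \<bar>ln (cmod z)\<bar> + pi"
  using cmod_le[of "Ln z"] Im_Ln_le_pi[of z] mpi_less_Im_Ln[of z] by (auto simp: abs_le_iff)

text \<open>Large values of s are controlled by the first moment of \<open>\<nu>\<close>, small
  values of |s - z| by the distance of z to [gamma, infinity), and the argument by pi.\<close>

lemma integrable_Ln:
  assumes "z \<in> slit_domain \<gamma>"
  shows "integrable \<nu> (\<lambda>s. Ln (complex_of_real s - z))"
proof -
  obtain d where d: "d > 0" "\<And>z' t. z' \<in> ball z d \<Longrightarrow> \<gamma> \<le> t \<Longrightarrow> d \<le> cmod (of_real t - z')"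
    by (rule slit_domain_dist[OF assms]) (rule that)
  show ?thesis
  proof (rule Bochner_Integration.integrable_bound)
    show "integrable \<nu> (\<lambda>s. \<bar>s\<bar> + cmod z + \<bar>ln d\<bar> + pi)" using moment by auto
    show "AE s in \<nu>. norm (Ln (complex_of_real s - z)) \<le> norm (\<bar>s\<bar> + cmod z + \<bar>ln d\<bar> + pi)"
      using nu_ge
    proof eventually_elim
      case (elim s)
      have 1: "d \<le> cmod (of_real s - z)" using d elim by auto
      then have "of_real s - z \<noteq> 0" using d(1) by auto
      then show ?case
        using norm_Ln_le[of "of_real s - z"] abs_ln_le_add[OF d(1) 1] norm_triangle_ineq4[of "of_real s" z] by simp
    qed
  qed measurable
qed

lemma cauchy_transform_holomorphic: "(\<lambda>z. \<integral>t. 1 / (complex_of_real t - z) \<partial>\<mu>) holomorphic_on slit_domain \<gamma>"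
proof (rule holomorphic_integral[where g' = "\<lambda>z t. 1 / (complex_of_real t - z)\<^sup>2"])
  show "AE t in \<mu>. \<forall>z\<in>slit_domain \<gamma>. ((\<lambda>z. 1 / (complex_of_real t - z)) has_field_derivative 1 / (complex_of_real t - z)\<^sup>2) (at z)"
    using mu_ge
  proof eventually_elim
    case (elim t)
    show ?case
    proof
      fix z assume "z \<in> slit_domain \<gamma>"
      from slit_domain_nonpos[OF this elim] have "complex_of_real t - z \<noteq> 0" by auto
      then show "((\<lambda>z. 1 / (complex_of_real t - z)) has_field_derivative 1 / (complex_of_real t - z)\<^sup>2) (at z)"
        by (auto intro!: derivative_eq_intros simp: power2_eq_square)
    qed
  qed
  fix z0 assume "z0 \<in> slit_domain \<gamma>"
  from slit_domain_dist[OF this] obtain d where d: "d > 0" "ball z0 d \<subseteq> slit_domain \<gamma>"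
    "\<And>z t. z \<in> ball z0 d \<Longrightarrow> \<gamma> \<le> t \<Longrightarrow> d \<le> cmod (of_real t - z)" by blast
  have "AE t in \<mu>. \<forall>z\<in>ball z0 d. cmod (1 / (complex_of_real t - z)\<^sup>2) \<le> 1 / d\<^sup>2"
    using mu_ge
  proof eventually_elim
    case (elim t)
    show ?case
      using d(1) d(3)[OF _ elim] by (auto simp: norm_divide norm_power intro!: frac_le power_mono)
  qed
  then show "\<exists>r>0. \<exists>B. ball z0 r \<subseteq> slit_domain \<gamma> \<and> integrable \<mu> B \<and> (AE t in \<mu>. \<forall>z\<in>ball z0 r. cmod (1 / (complex_of_real t - z)\<^sup>2) \<le> B t)"
    using d by (intro exI[of _ d] conjI exI[of _ "\<lambda>_. 1 / d\<^sup>2"]) auto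
qed (auto intro: open_slit_domain integrable_cauchy_kernel)

lemma log_potential_holomorphic: "(\<lambda>z. \<integral>s. Ln (complex_of_real s - z) \<partial>\<nu>) holomorphic_on slit_domain \<gamma>"
proof (rule holomorphic_integral[where g' = "\<lambda>z s. - 1 / (complex_of_real s - z)"])
  show "AE s in \<nu>. \<forall>z\<in>slit_domain \<gamma>. ((\<lambda>z. Ln (complex_of_real s - z)) has_field_derivative - 1 / (complex_of_real s - z)) (at z)"
    using nu_ge
  proof eventually_elim
    case (elim s)
    show ?case
    proof
      fix z assume "z \<in> slit_domain \<gamma>"
      from slit_domain_nonpos[OF this elim]
      show "((\<lambda>z. Ln (complex_of_real s - z)) has_field_derivative - 1 / (complex_of_real s - z)) (at z)"
        by (auto intro!: derivative_eq_intros simp: divide_inverse)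
    qed
  qed
  fix z0 assume "z0 \<in> slit_domain \<gamma>"
  from slit_domain_dist[OF this] obtain d where d: "d > 0" "ball z0 d \<subseteq> slit_domain \<gamma>"
    "\<And>z t. z \<in> ball z0 d \<Longrightarrow> \<gamma> \<le> t \<Longrightarrow> d \<le> cmod (of_real t - z)" by blast
  have "AE s in \<nu>. \<forall>z\<in>ball z0 d. cmod (- 1 / (complex_of_real s - z)) \<le> 1 / d"
    using nu_ge
  proof eventually_elim
    case (elim t)
    show ?case
      using d(1) d(3)[OF _ elim] by (auto simp: norm_divide intro!: frac_le)
  qed
  then show "\<exists>r>0. \<exists>B. ball z0 r \<subseteq> slit_domain \<gamma> \<and> integrable \<nu> B \<and> (AE s in \<nu>. \<forall>z\<in>ball z0 r. cmod (- 1 / (complex_of_real s - z)) \<le> B s)"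
    using d by (intro exI[of _ d] conjI exI[of _ "\<lambda>_. 1 / d"]) auto
qed (auto intro: open_slit_domain integrable_Ln)

lemma transform_slit_domain:
  assumes "z \<in> slit_domain \<gamma>"
  shows "(\<integral>t. 1 / (complex_of_real t - z) \<partial>\<mu>) = K * exp (- (\<integral>s. Ln (complex_of_real s - z) \<partial>\<nu>))"
proof -
  let ?f = "\<lambda>z. (\<integral>t. 1 / (complex_of_real t - z) \<partial>\<mu>) - K * exp (- (\<integral>s. Ln (complex_of_real s - z) \<partial>\<nu>))"
  have "?f z = 0"
  \<comment> \<open>The identity theorem needs an accumulation point of the zero set inside the
    domain; any real point below gamma would do.\<close>
  proof (rule analytic_continuation[of ?f "slit_domain \<gamma>" "complex_of_real ` {..<\<gamma>}" "of_real (\<gamma> - 1)"])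
    show "?f holomorphic_on slit_domain \<gamma>"
      by (intro holomorphic_intros cauchy_transform_holomorphic log_potential_holomorphic)
    show "complex_of_real (\<gamma> - 1) islimpt complex_of_real ` {..<\<gamma>}"
    proof (rule islimptI)
      fix T assume "complex_of_real (\<gamma> - 1) \<in> T" "open T"
      then obtain e where e: "e > 0" "ball (complex_of_real (\<gamma> - 1)) e \<subseteq> T" using openE by blast
      have "complex_of_real (\<gamma> - 1 - e / 2) \<in> ball (complex_of_real (\<gamma> - 1)) e"
        using e(1) by (simp add: dist_norm norm_of_real flip: of_real_diff)
      with e show "\<exists>y\<in>complex_of_real ` {..<\<gamma>}. y \<in> T \<and> y \<noteq> complex_of_real (\<gamma> - 1)"
        by (intro bexI[of _ "complex_of_real (\<gamma> - 1 - e / 2)"]) (auto simp del: of_real_diff)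
    qed
    fix x assume "x \<in> complex_of_real ` {..<\<gamma>}"
    then obtain x' where x': "x = of_real x'" "x' < \<gamma>" by auto
    have "(\<integral>t. 1 / (complex_of_real t - x) \<partial>\<mu>) = of_real (\<integral>t. 1 / (t - x') \<partial>\<mu>)"
      unfolding x' integral_complex_of_real[symmetric] by simp
    moreover have "(\<integral>s. Ln (complex_of_real s - x) \<partial>\<nu>) = (\<integral>s. complex_of_real (ln (s - x')) \<partial>\<nu>)"
    proof (rule integral_cong_AE)
      show "AE s in \<nu>. Ln (complex_of_real s - x) = complex_of_real (ln (s - x'))"
        using nu_ge by eventually_elim (use x' in \<open>simp add: Ln_of_real flip: of_real_diff\<close>)
    qed measurable
    ultimately show "?f x = 0"
      by (simp only: transform[OF x'(2)] integral_complex_of_real) (simp flip: exp_of_real)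
  qed (use assms in \<open>auto simp: open_slit_domain connected_slit_domain\<close>, auto simp: slit_domain_def)
  then show ?thesis by simp
qed

end

section \<open>Absolute continuity on the real line\<close>

text \<open>\<open>0 powr (- a)\<close> is 0 in HOL, so the value at 0 is set to infinity: the
  kernel must dominate |u + iy|^(-a) for every y > 0.\<close>

definition singular_kernel :: "real \<Rightarrow> real \<Rightarrow> ennreal" where
  "singular_kernel a u = (if u = 0 then \<infinity> else ennreal (\<bar>u\<bar> powr (- a)))"

lemma singular_kernel_measurable [measurable]: "singular_kernel a \<in> borel_measurable borel"
  unfolding singular_kernel_def by measurable

lemma nn_integral_singular_kernel:
  assumes a: "a < 1" and R: "0 \<le> R"
  shows "(\<integral>\<^sup>+u. indicator {-R..R} u * singular_kernel a u \<partial>lborel) < \<infinity>"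
proof -
  let ?h = "\<lambda>u. indicator {0..R} u * ennreal (u powr (- a))"
  have "((\<lambda>u. u powr (- a)) has_integral R powr (- a + 1) / (- a + 1)) {0..R}"
    by (rule has_integral_powr_from_0) (use a R in auto)
  then have "(\<integral>\<^sup>+u. ennreal (u powr (- a)) * indicator {0..R} u \<partial>lborel) = ennreal (R powr (- a + 1) / (- a + 1))"
    by (intro nn_integral_has_integral_lebesgue') auto
  then have h: "(\<integral>\<^sup>+u. ?h u \<partial>lborel) = ennreal (R powr (- a + 1) / (- a + 1))"
    by (simp only: mult.commute)
  have hm: "?h \<in> borel_measurable borel" by measurable
  have h': "(\<integral>\<^sup>+u. ?h (- u) \<partial>lborel) = (\<integral>\<^sup>+u. ?h u \<partial>lborel)"
    using nn_integral_real_affine[OF hm, of "-1" 0] by simp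
  have "(\<integral>\<^sup>+u. indicator {-R..R} u * singular_kernel a u \<partial>lborel) \<le> (\<integral>\<^sup>+u. ?h u + ?h (- u) \<partial>lborel)"
  proof (rule nn_integral_mono_AE)
    show "AE u in lborel. indicator {-R..R} u * singular_kernel a u \<le> ?h u + ?h (- u)"
      using AE_lborel_singleton[of "0::real"]
    proof eventually_elim
      case (elim u)
      then show ?case by (cases "u > 0") (auto simp: singular_kernel_def split: split_indicator)
    qed
  qed
  also have "\<dots> = (\<integral>\<^sup>+u. ?h u \<partial>lborel) + (\<integral>\<^sup>+u. ?h (- u) \<partial>lborel)"
    by (rule nn_integral_add) measurable
  also have "\<dots> < \<infinity>" unfolding h' h by simp
  finally show ?thesis .
qed

lemma ennreal_integral_le_nn_integral:
  assumes "integrable M f"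
  shows "ennreal (\<integral>x. f x \<partial>M) \<le> (\<integral>\<^sup>+x. ennreal (f x) \<partial>M)"
proof -
  have i: "integrable M (\<lambda>x. max 0 (f x))" using assms by auto
  have "(\<integral>x. f x \<partial>M) \<le> (\<integral>x. max 0 (f x) \<partial>M)" by (rule integral_mono[OF assms i]) auto
  then have "ennreal (\<integral>x. f x \<partial>M) \<le> ennreal (\<integral>x. max 0 (f x) \<partial>M)" by (rule ennreal_leI)
  also have "\<dots> = (\<integral>\<^sup>+x. ennreal (max 0 (f x)) \<partial>M)"
    by (rule nn_integral_eq_integral[OF i, symmetric]) auto
  also have "\<dots> = (\<integral>\<^sup>+x. ennreal (f x) \<partial>M)"
    by (rule nn_integral_cong) (auto simp: max_def ennreal_neg)
  finally show ?thesis .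
qed

text \<open>Jensen's inequality for the restriction of the measure to \<open>A\<close>, of total mass \<open>a\<close>, in the
  unnormalized form obtained by integrating $e^X \geq e^c (1 + X - c)$.\<close>

lemma exp_integral_le:
  fixes X :: "'a \<Rightarrow> real"
  assumes "finite_measure M" and A: "A \<in> sets M" and X: "integrable M (\<lambda>x. indicator A x * X x)"
    and a: "measure M A = a" and c: "(\<integral>x. indicator A x * X x \<partial>M) = a * c"
  shows "ennreal (a * exp c) \<le> (\<integral>\<^sup>+x. indicator A x * ennreal (exp (X x)) \<partial>M)"
proof -
  interpret finite_measure M by fact
  have iA: "integrable M (\<lambda>x. (1 - c) * indicator A x)"
    using A by (intro integrable_mult_right integrable_real_indicator) (auto simp: less_top[symmetric])
  have i: "integrable M (\<lambda>x. exp c * ((1 - c) * indicator A x + indicator A x * X x))"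
    by (intro integrable_mult_right Bochner_Integration.integrable_add iA X)
  have "(\<integral>x. exp c * ((1 - c) * indicator A x + indicator A x * X x) \<partial>M) =
      exp c * ((1 - c) * (\<integral>x. indicator A x \<partial>M) + (\<integral>x. indicator A x * X x \<partial>M))"
    by (simp only: integral_mult_right_zero Bochner_Integration.integral_add[OF iA X])
  also have "(\<integral>x. indicator A x \<partial>M) = a" using A a by simp
  also have "exp c * ((1 - c) * a + (\<integral>x. indicator A x * X x \<partial>M)) = a * exp c"
    unfolding c by (simp add: algebra_simps)
  finally have eq: "a * exp c = (\<integral>x. exp c * ((1 - c) * indicator A x + indicator A x * X x) \<partial>M)" ..
  have "ennreal (a * exp c) \<le> (\<integral>\<^sup>+x. ennreal (exp c * ((1 - c) * indicator A x + indicator A x * X x)) \<partial>M)"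
    unfolding eq by (rule ennreal_integral_le_nn_integral[OF i])
  also have "\<dots> \<le> (\<integral>\<^sup>+x. indicator A x * ennreal (exp (X x)) \<partial>M)"
  proof (rule nn_integral_mono)
    fix x
    have "exp c * (1 + (X x - c)) \<le> exp c * exp (X x - c)"
      by (intro mult_left_mono exp_ge_add_one_self) auto
    also have "\<dots> = exp (X x)" by (simp flip: exp_add)
    finally have "exp c * (1 - c + X x) \<le> exp (X x)" by (simp add: algebra_simps)
    then show "ennreal (exp c * ((1 - c) * indicator A x + indicator A x * X x)) \<le> indicator A x * ennreal (exp (X x))"
      by (auto intro!: ennreal_leI split: split_indicator)
  qed
  finally show ?thesis .
qed

section \<open>Majorants for the Cauchy transform and inversion\<close>

context stieltjes_exp
begin

interpretation mu: finite_measure \<mu> by (rule finite_mu)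
interpretation nu: prob_space \<nu> by (rule prob_nu)

definition cauchy_tr :: "complex \<Rightarrow> complex" where
  "cauchy_tr z = (\<integral>t. 1 / (complex_of_real t - z) \<partial>\<mu>)"

lemma upper_half_slit: "y > 0 \<Longrightarrow> Complex x y \<in> slit_domain \<gamma>"
  by (simp add: slit_domain_def)

lemma norm_cauchy_tr:
  assumes y: "y > 0"
  shows "integrable \<nu> (\<lambda>s. ln (cmod (of_real s - Complex x y)))"
    "cmod (cauchy_tr (Complex x y)) = K * exp (- (\<integral>s. ln (cmod (of_real s - Complex x y)) \<partial>\<nu>))"
proof -
  have e: "Re (Ln (of_real s - Complex x y)) = ln (cmod (of_real s - Complex x y))" for s
    by (rule Re_Ln) (use y in \<open>auto simp: complex_eq_iff\<close>)
  note i = integrable_Ln[OF upper_half_slit[OF y, of x]]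
  show "integrable \<nu> (\<lambda>s. ln (cmod (of_real s - Complex x y)))"
    using integrable_Re[OF i] unfolding e .
  have "cmod (cauchy_tr (Complex x y)) = K * exp (- Re (\<integral>s. Ln (of_real s - Complex x y) \<partial>\<nu>))"
    unfolding cauchy_tr_def transform_slit_domain[OF upper_half_slit[OF y]] using K by (simp add: norm_mult)
  also have "Re (\<integral>s. Ln (of_real s - Complex x y) \<partial>\<nu>) = (\<integral>s. Re (Ln (of_real s - Complex x y)) \<partial>\<nu>)"
    by (rule integral_Re[OF i, symmetric])
  finally show "cmod (cauchy_tr (Complex x y)) = K * exp (- (\<integral>s. ln (cmod (of_real s - Complex x y)) \<partial>\<nu>))"
    unfolding e .
qed

text \<open>The imaginary part of the Cauchy kernel is pi times the Poisson kernel of the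
  half-plane.\<close>

lemma poisson_integral_le:
  assumes y: "y > 0"
  shows "(\<integral>\<^sup>+t. ennreal (y / ((t - x)\<^sup>2 + y\<^sup>2)) \<partial>\<mu>) \<le> ennreal (cmod (cauchy_tr (Complex x y)))"
proof -
  note i = integrable_cauchy_kernel[OF upper_half_slit[OF y, of x]]
  have e: "Im (1 / (of_real t - Complex x y)) = y / ((t - x)\<^sup>2 + y\<^sup>2)" for t
    by (simp add: Im_divide)
  have "(\<integral>\<^sup>+t. ennreal (y / ((t - x)\<^sup>2 + y\<^sup>2)) \<partial>\<mu>) = ennreal (\<integral>t. Im (1 / (of_real t - Complex x y)) \<partial>\<mu>)"
    unfolding e[symmetric]
    by (rule nn_integral_eq_integral[OF integrable_Im[OF i]]) (use y in \<open>auto simp: e\<close>)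
  also have "(\<integral>t. Im (1 / (of_real t - Complex x y)) \<partial>\<mu>) = Im (cauchy_tr (Complex x y))"
    unfolding cauchy_tr_def by (rule integral_Im[OF i])
  also have "ennreal \<dots> \<le> ennreal (cmod (cauchy_tr (Complex x y)))"
    by (intro ennreal_leI) (use abs_Im_le_cmod[of "cauchy_tr (Complex x y)"] in simp)
  finally show ?thesis .
qed

text \<open>If every set {|s - x0| >= 1/(n+1)} were null, \<open>\<nu>\<close> would be concentrated
  at \<open>x0\<close>. The factor 2 leaves a margin: s stays at distance at least eta from every x
  within eta of \<open>x0\<close>.\<close>

lemma nu_away:
  obtains \<eta> where "\<eta> > 0" "measure \<nu> {s. 2 * \<eta> \<le> \<bar>s - x0\<bar>} > 0"
proof -
  have "\<exists>n. measure \<nu> {s. 1 / real (Suc n) \<le> \<bar>s - x0\<bar>} \<noteq> 0"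
  proof (rule ccontr)
    assume "\<nexists>n. measure \<nu> {s. 1 / real (Suc n) \<le> \<bar>s - x0\<bar>} \<noteq> 0"
    then have "emeasure \<nu> {s. 1 / real (Suc n) \<le> \<bar>s - x0\<bar>} = 0" for n
      by (simp add: nu.emeasure_eq_measure)
    then have "AE s in \<nu>. \<not> 1 / real (Suc n) \<le> \<bar>s - x0\<bar>" for n
      by (intro AE_I[of _ _ "{s. 1 / real (Suc n) \<le> \<bar>s - x0\<bar>}"]) auto
    then have "AE s in \<nu>. \<forall>n. \<not> 1 / real (Suc n) \<le> \<bar>s - x0\<bar>" by (simp add: AE_all_countable)
    then have "AE s in \<nu>. s = x0"
    proof eventually_elim
      case (elim s)
      show ?case
      proof (rule ccontr)
        assume "s \<noteq> x0"
        then obtain n where "inverse (real (Suc n)) < \<bar>s - x0\<bar>" using reals_Archimedean[of "\<bar>s - x0\<bar>"] by auto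
        with elim[rule_format, of n] show False by (simp add: inverse_eq_divide)
      qed
    qed
    with nondegenerate show False by blast
  qed
  then obtain n where "measure \<nu> {s. 1 / real (Suc n) \<le> \<bar>s - x0\<bar>} > 0"
    by (auto simp: less_le)
  moreover have "2 * (1 / (2 * real (Suc n))) = 1 / real (Suc n)" by (simp del: of_nat_Suc)
  ultimately show thesis by (intro that[of "1 / (2 * real (Suc n))"]) (simp_all del: of_nat_Suc)
qed

text \<open>Split the logarithmic potential at \<open>A\<close>. Away from \<open>A\<close> it is
  bounded below by a constant, which becomes the factor C. On \<open>A\<close>, of mass alpha, write
  the integral of ln as the average of alpha ln and apply Jensen; this is why the kernel has
  exponent alpha, and alpha < 1 makes it integrable in x. Bounding |s - x - iy| below by |s - x|
  removes the dependence on y.\<close>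

lemma local_majorant:
  obtains \<eta> G where "\<eta> > 0" "G \<in> borel_measurable borel"
    "(\<integral>\<^sup>+x. indicator {x0 - \<eta><..<x0 + \<eta>} x * G x \<partial>lborel) < \<infinity>"
    "\<And>x y. x \<in> {x0 - \<eta><..<x0 + \<eta>} \<Longrightarrow> y > 0 \<Longrightarrow> ennreal (cmod (cauchy_tr (Complex x y))) \<le> G x"
proof -
  obtain \<eta> where \<eta>: "\<eta> > 0" and B0: "measure \<nu> {s. 2 * \<eta> \<le> \<bar>s - x0\<bar>} > 0" by (rule nu_away)
  define A where "A = {s. \<bar>s - x0\<bar> < 2 * \<eta>}"
  define \<alpha> where "\<alpha> = measure \<nu> A"
  let ?I = "{x0 - \<eta><..<x0 + \<eta>}"
  have A [measurable]: "A \<in> sets borel" unfolding A_def by measurable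
  have A\<nu>: "A \<in> sets \<nu>" by simp
  have cA: "- A = {s. 2 * \<eta> \<le> \<bar>s - x0\<bar>}" by (auto simp: A_def)
  have \<alpha>: "0 \<le> \<alpha>" "\<alpha> < 1"
    using nu.prob_compl[OF A\<nu>] B0 by (auto simp: \<alpha>_def cA Compl_eq_Diff_UNIV[symmetric])
  define Q where "Q x = (\<integral>\<^sup>+s. indicator A s * singular_kernel \<alpha> (s - x) \<partial>\<nu>)" for x
  define C where "C = K * exp \<bar>ln \<eta>\<bar>"
  have C: "C > 0" using K by (simp add: C_def)
  \<comment> \<open>The summand 1 covers alpha = 0, where \<open>1 / \<alpha>\<close> is 0 and the
    integral over \<open>A\<close> vanishes.\<close>
  define G where "G x = ennreal C * (1 + ennreal (1 / \<alpha>) * Q x)" for x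
  have Qm [measurable]: "Q \<in> borel_measurable borel"
    unfolding Q_def by (rule nu.borel_measurable_nn_integral) measurable
  have Gm: "G \<in> borel_measurable borel" unfolding G_def by measurable
  have Qint: "(\<integral>\<^sup>+x. indicator ?I x * Q x \<partial>lborel) < \<infinity>"
  proof -
    interpret P: pair_sigma_finite \<nu> lborel ..
    \<comment> \<open>For x in the interval and s in \<open>A\<close> the difference s - x is less
      than eta + 2 eta in modulus.\<close>
    let ?Z = "\<integral>\<^sup>+u. indicator {- (3 * \<eta>)..3 * \<eta>} u * singular_kernel \<alpha> u \<partial>lborel"
    have "(\<integral>\<^sup>+x. indicator ?I x * Q x \<partial>lborel) = (\<integral>\<^sup>+x. (\<integral>\<^sup>+s. indicator ?I x * (indicator A s * singular_kernel \<alpha> (s - x)) \<partial>\<nu>) \<partial>lborel)"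
      unfolding Q_def by (intro nn_integral_cong nn_integral_cmult[symmetric]) measurable
    also have "\<dots> = (\<integral>\<^sup>+s. (\<integral>\<^sup>+x. indicator ?I x * (indicator A s * singular_kernel \<alpha> (s - x)) \<partial>lborel) \<partial>\<nu>)"
      by (rule P.Fubini') measurable
    also have "\<dots> \<le> (\<integral>\<^sup>+s. ?Z \<partial>\<nu>)"
    proof (rule nn_integral_mono)
      fix s
      have "(\<integral>\<^sup>+x. indicator ?I x * (indicator A s * singular_kernel \<alpha> (s - x)) \<partial>lborel) \<le>
        (\<integral>\<^sup>+x. indicator {- (3 * \<eta>)..3 * \<eta>} (s + (-1) * x) * singular_kernel \<alpha> (s + (-1) * x) \<partial>lborel)"
        by (rule nn_integral_mono) (auto simp: A_def split: split_indicator)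
      also have "\<dots> = ?Z"
        using nn_integral_real_affine[of "\<lambda>u. indicator {- (3 * \<eta>)..3 * \<eta>} u * singular_kernel \<alpha> u" "-1" s]
        by simp
      finally show "(\<integral>\<^sup>+x. indicator ?I x * (indicator A s * singular_kernel \<alpha> (s - x)) \<partial>lborel) \<le> ?Z" .
    qed
    also have "\<dots> = ?Z" using nu.emeasure_space_1 by simp
    also have "\<dots> < \<infinity>" by (rule nn_integral_singular_kernel) (use \<alpha> \<eta> in auto)
    finally show ?thesis .
  qed
  have Gint: "(\<integral>\<^sup>+x. indicator ?I x * G x \<partial>lborel) < \<infinity>"
  proof -
    have "(\<integral>\<^sup>+x. indicator ?I x * G x \<partial>lborel) = (\<integral>\<^sup>+x. ennreal C * (indicator ?I x + ennreal (1 / \<alpha>) * (indicator ?I x * Q x)) \<partial>lborel)"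
      unfolding G_def by (intro nn_integral_cong) (simp split: split_indicator)
    also have "\<dots> = ennreal C * (\<integral>\<^sup>+x. indicator ?I x + ennreal (1 / \<alpha>) * (indicator ?I x * Q x) \<partial>lborel)"
      by (rule nn_integral_cmult) measurable
    also have "(\<integral>\<^sup>+x. indicator ?I x + ennreal (1 / \<alpha>) * (indicator ?I x * Q x) \<partial>lborel) =
      (\<integral>\<^sup>+x. indicator ?I x \<partial>lborel) + (\<integral>\<^sup>+x. ennreal (1 / \<alpha>) * (indicator ?I x * Q x) \<partial>lborel)"
      by (rule nn_integral_add) measurable
    also have "(\<integral>\<^sup>+x. ennreal (1 / \<alpha>) * (indicator ?I x * Q x) \<partial>lborel) = ennreal (1 / \<alpha>) * (\<integral>\<^sup>+x. indicator ?I x * Q x \<partial>lborel)"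
      by (rule nn_integral_cmult) measurable
    also have "(\<integral>\<^sup>+x. indicator ?I x \<partial>lborel) = emeasure lborel ?I" by (rule nn_integral_indicator) simp
    finally show ?thesis using Qint \<eta> by (simp add: ennreal_mult_less_top)
  qed
  have bound: "ennreal (cmod (cauchy_tr (Complex x y))) \<le> G x" if x: "x \<in> ?I" and y: "y > 0" for x y
  proof -
    let ?l = "\<lambda>s. ln (cmod (of_real s - Complex x y))"
    note l = norm_cauchy_tr(1)[OF y, of x]
    have iA: "integrable \<nu> (\<lambda>s. indicator B s * ?l s)" if "B \<in> sets borel" for B
      using integrable_mult_indicator[OF _ l, of B] that by simp
    have le: "\<bar>s - x\<bar> \<le> cmod (of_real s - Complex x y)" for s
      using abs_Re_le_cmod[of "of_real s - Complex x y"] by simp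
    have pos: "cmod (of_real s - Complex x y) > 0" for s using y by (auto simp: complex_eq_iff)
    define J where "J = (\<integral>s. indicator A s * ?l s \<partial>\<nu>)"
    have "(\<integral>s. ?l s \<partial>\<nu>) = (\<integral>s. indicator A s * ?l s + indicator (- A) s * ?l s \<partial>\<nu>)"
      by (rule Bochner_Integration.integral_cong) (auto split: split_indicator)
    also have "\<dots> = J + (\<integral>s. indicator (- A) s * ?l s \<partial>\<nu>)"
      unfolding J_def by (rule Bochner_Integration.integral_add[OF iA iA]) auto
    finally have split: "(\<integral>s. ?l s \<partial>\<nu>) = J + (\<integral>s. indicator (- A) s * ?l s \<partial>\<nu>)" .
    \<comment> \<open>The negative absolute value is a lower bound on and off \<open>A\<close>,
      whatever the sign of ln eta.\<close>
    have "(\<integral>s. - \<bar>ln \<eta>\<bar> \<partial>\<nu>) \<le> (\<integral>s. indicator (- A) s * ?l s \<partial>\<nu>)"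
    proof (rule integral_mono[OF _ iA])
      fix s
      have "\<eta> \<le> cmod (of_real s - Complex x y)" if "s \<notin> A"
        using that x le[of s] by (auto simp: A_def)
      then have "ln \<eta> \<le> ?l s" if "s \<notin> A" using that \<eta> pos[of s] by simp
      then show "- \<bar>ln \<eta>\<bar> \<le> indicator (- A) s * ?l s"
        by (force split: split_indicator)
    qed auto
    then have "- \<bar>ln \<eta>\<bar> \<le> (\<integral>s. indicator (- A) s * ?l s \<partial>\<nu>)" using nu.prob_space by simp
    then have "- (\<integral>s. ?l s \<partial>\<nu>) \<le> \<bar>ln \<eta>\<bar> + (- J)" using split by linarith
    then have "exp (- (\<integral>s. ?l s \<partial>\<nu>)) \<le> exp \<bar>ln \<eta>\<bar> * exp (- J)"
      by (simp flip: exp_add)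
    then have SC: "cmod (cauchy_tr (Complex x y)) \<le> C * exp (- J)"
      unfolding norm_cauchy_tr(2)[OF y] C_def using K by (simp add: mult.assoc)
    have "ennreal (exp (- J)) \<le> 1 + ennreal (1 / \<alpha>) * Q x"
    proof (cases "\<alpha> = 0")
      case True
      then have "emeasure \<nu> A = 0" by (simp add: \<alpha>_def nu.emeasure_eq_measure)
      then have "AE s in \<nu>. s \<notin> A" by (intro AE_I[of _ _ A]) auto
      then have "J = 0" unfolding J_def by (intro integral_eq_zero_AE) auto
      then show ?thesis using True by simp
    next
      case False
      then have a: "\<alpha> > 0" using \<alpha> by simp
      \<comment> \<open>Jensen with X = -alpha ln|s - z|, whose average over \<open>A\<close> is
        exactly -J.\<close>
      have "ennreal (\<alpha> * exp (- J)) \<le> (\<integral>\<^sup>+s. indicator A s * ennreal (exp (- \<alpha> * ?l s)) \<partial>\<nu>)"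
      proof (rule exp_integral_le[OF nu.finite_measure_axioms A\<nu>])
        show "integrable \<nu> (\<lambda>s. indicator A s * (- \<alpha> * ?l s))"
          using integrable_mult_right[OF iA[OF A], of "- \<alpha>"] by (simp add: mult.left_commute)
        have "(\<integral>s. indicator A s * (- \<alpha> * ?l s) \<partial>\<nu>) = (\<integral>s. (- \<alpha>) * (indicator A s * ?l s) \<partial>\<nu>)"
          by (simp add: mult.left_commute)
        also have "\<dots> = \<alpha> * - J" unfolding J_def by simp
        finally show "(\<integral>s. indicator A s * (- \<alpha> * ?l s) \<partial>\<nu>) = \<alpha> * - J" .
      qed (simp add: \<alpha>_def)
      also have "\<dots> \<le> Q x"
        unfolding Q_def
      proof (intro nn_integral_mono mult_left_mono)
        fix s
        show "ennreal (exp (- \<alpha> * ?l s)) \<le> singular_kernel \<alpha> (s - x)"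
        proof (cases "s = x")
          case False
          then have "ln \<bar>s - x\<bar> \<le> ?l s" using le[of s] pos[of s] by simp
          then have "exp (- \<alpha> * ?l s) \<le> \<bar>s - x\<bar> powr (- \<alpha>)"
            using False a by (simp add: powr_def)
          then show ?thesis using False by (simp add: singular_kernel_def ennreal_leI)
        qed (simp add: singular_kernel_def)
      qed simp
      finally have "ennreal (1 / \<alpha>) * ennreal (\<alpha> * exp (- J)) \<le> ennreal (1 / \<alpha>) * Q x"
        by (rule mult_left_mono) simp
      moreover have "ennreal (1 / \<alpha>) * ennreal (\<alpha> * exp (- J)) = ennreal (exp (- J))"
        using a by (simp flip: ennreal_mult)
      ultimately show ?thesis by (simp add: add_increasing)
    qed
    then have "ennreal C * ennreal (exp (- J)) \<le> G x"
      unfolding G_def by (rule mult_left_mono) simp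
    moreover have "ennreal (cmod (cauchy_tr (Complex x y))) \<le> ennreal C * ennreal (exp (- J))"
      using SC C by (simp add: ennreal_leI flip: ennreal_mult)
    ultimately show ?thesis by (rule order_trans[rotated])
  qed
  from that[OF \<eta> Gm Gint bound] show thesis .
qed

text \<open>One-sided Stieltjes inversion. If t lies further than y from the complement of
  \<open>V\<close>, then [t - y, t + y] is inside \<open>V\<close> and the kernel is at least 1/(2y)
  there, so its integral over \<open>V\<close> is at least 1. Tonelli and the bound
  \<open>G\<close>, uniform in y, finish the estimate, and \<open>V\<close> is exhausted as y
  decreases. The case \<open>V = UNIV\<close> is excluded because \<open>infdist\<close> to the
  empty set is 0.\<close>

lemma open_measure_le:
  assumes V: "open V" "V \<noteq> UNIV" and G: "G \<in> borel_measurable borel"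
    and bound: "\<And>x y. x \<in> V \<Longrightarrow> y > 0 \<Longrightarrow> ennreal (cmod (cauchy_tr (Complex x y))) \<le> G x"
  shows "emeasure \<mu> V \<le> (\<integral>\<^sup>+x. indicator V x * G x \<partial>lborel)"
proof -
  interpret P: pair_sigma_finite \<mu> lborel ..
  have Vm [measurable]: "V \<in> sets borel" using V(1) by simp
  let ?p = "\<lambda>y t x. ennreal (y / ((t - x)\<^sup>2 + y\<^sup>2))"
  let ?V = "\<lambda>n::nat. {t. 1 / real (Suc n) < infdist t (- V)}"
  have Vn [measurable]: "?V n \<in> sets borel" for n
    by (intro borel_open open_Collect_less continuous_intros)
  have le: "emeasure \<mu> (?V n) \<le> (\<integral>\<^sup>+x. indicator V x * G x \<partial>lborel)" for n
  proof -
    define y where "y = 1 / real (Suc n)"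
    have y: "y > 0" by (simp add: y_def)
    have one: "1 \<le> (\<integral>\<^sup>+x. indicator V x * ?p y t x \<partial>lborel)" if t: "t \<in> ?V n" for t
    proof -
      have "indicator {t - y..t + y} x * ennreal (1 / (2 * y)) \<le> indicator V x * ?p y t x" for x
      proof (cases "x \<in> {t - y..t + y}")
        case True
        then have d: "\<bar>t - x\<bar> \<le> y" by auto
        have "x \<in> V"
        proof (rule ccontr)
          assume "x \<notin> V"
          then have "infdist t (- V) \<le> dist t x" by (intro infdist_le) auto
          with d t show False by (simp add: dist_real_def y_def)
        qed
        moreover have "(t - x)\<^sup>2 \<le> y\<^sup>2" using d y by (simp add: abs_le_square_iff[symmetric])
        then have "y / (y\<^sup>2 + y\<^sup>2) \<le> y / ((t - x)\<^sup>2 + y\<^sup>2)"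
          using y by (intro divide_left_mono) (auto intro!: mult_pos_pos add_nonneg_pos)
        then have "1 / (2 * y) \<le> y / ((t - x)\<^sup>2 + y\<^sup>2)"
          using y by (simp add: power2_eq_square)
        ultimately show ?thesis using True by (simp add: ennreal_leI)
      qed simp
      then have "(\<integral>\<^sup>+x. indicator {t - y..t + y} x * ennreal (1 / (2 * y)) \<partial>lborel) \<le> (\<integral>\<^sup>+x. indicator V x * ?p y t x \<partial>lborel)"
        by (intro nn_integral_mono)
      moreover have "(\<integral>\<^sup>+x. indicator {t - y..t + y} x * ennreal (1 / (2 * y)) \<partial>lborel) = ennreal (2 * y) * ennreal (1 / (2 * y))"
        using y by (subst nn_integral_multc) auto
      moreover have "ennreal (2 * y) * ennreal (1 / (2 * y)) = 1"
        using y by (simp flip: ennreal_mult)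
      ultimately show ?thesis by simp
    qed
    have "emeasure \<mu> (?V n) = (\<integral>\<^sup>+t. indicator (?V n) t \<partial>\<mu>)"
      by (rule nn_integral_indicator[symmetric]) (simp only: sets_mu Vn)
    also have "\<dots> \<le> (\<integral>\<^sup>+t. (\<integral>\<^sup>+x. indicator V x * ?p y t x \<partial>lborel) \<partial>\<mu>)"
      by (intro nn_integral_mono) (use one in \<open>auto split: split_indicator\<close>)
    also have "\<dots> = (\<integral>\<^sup>+x. (\<integral>\<^sup>+t. indicator V x * ?p y t x \<partial>\<mu>) \<partial>lborel)"
      by (rule P.Fubini'[symmetric]) measurable
    also have "\<dots> \<le> (\<integral>\<^sup>+x. indicator V x * G x \<partial>lborel)"
    proof (rule nn_integral_mono)
      fix x
      show "(\<integral>\<^sup>+t. indicator V x * ?p y t x \<partial>\<mu>) \<le> indicator V x * G x"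
        using order_trans[OF poisson_integral_le[OF y] bound[OF _ y]] by (auto split: split_indicator)
    qed
    finally show ?thesis .
  qed
  have VU: "V = (\<Union>n. ?V n)"
  proof (intro equalityI subsetI)
    fix t assume "t \<in> V"
    then have "infdist t (- V) \<noteq> 0"
      using in_closed_iff_infdist_zero[of "- V" t] V by auto
    then have "infdist t (- V) > 0" using infdist_nonneg[of t "- V"] by linarith
    then obtain n where "inverse (real (Suc n)) < infdist t (- V)" using reals_Archimedean by blast
    then show "t \<in> (\<Union>n. ?V n)" by (auto simp: inverse_eq_divide)
  next
    fix t assume "t \<in> (\<Union>n. ?V n)"
    then obtain n where n: "1 / real (Suc n) < infdist t (- V)" by auto
    have "0 < 1 / real (Suc n)" by simp
    with n have "infdist t (- V) \<noteq> 0" by linarith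
    moreover have "infdist t (- V) = 0" if "t \<in> - V" using that infdist_le[of t "- V" t] infdist_nonneg[of t "- V"] by simp
    ultimately show "t \<in> V" by blast
  qed
  have inc: "incseq ?V"
  proof (intro monoI subsetI)
    fix i j :: nat and t assume "i \<le> j" "t \<in> ?V i"
    moreover from this have "1 / real (Suc j) \<le> 1 / real (Suc i)" by (intro divide_left_mono) auto
    ultimately show "t \<in> ?V j" by (simp del: of_nat_Suc)
  qed
  have "range ?V \<subseteq> sets \<mu>" unfolding sets_mu using Vn by blast
  from SUP_emeasure_incseq[OF this inc] have "emeasure \<mu> V = (SUP n. emeasure \<mu> (?V n))"
    unfolding VU[symmetric] by (rule sym)
  also have "\<dots> \<le> (\<integral>\<^sup>+x. indicator V x * G x \<partial>lborel)" by (rule SUP_least) (rule le)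
  finally show ?thesis .
qed

text \<open>The finite measure with density \<open>G\<close> on the interval is outer regular, so
  the bound on open sets extends to N within the interval, where that measure vanishes.\<close>

lemma local_null:
  assumes N: "N \<in> sets borel" "emeasure lborel N = 0"
  obtains I where "open I" "x0 \<in> I" "emeasure \<mu> (N \<inter> I) = 0"
proof -
  obtain \<eta> G where \<eta>: "\<eta> > 0" and Gm [measurable]: "G \<in> borel_measurable borel"
    and Gint: "(\<integral>\<^sup>+x. indicator {x0 - \<eta><..<x0 + \<eta>} x * G x \<partial>lborel) < \<infinity>"
    and G: "\<And>x y. x \<in> {x0 - \<eta><..<x0 + \<eta>} \<Longrightarrow> y > 0 \<Longrightarrow> ennreal (cmod (cauchy_tr (Complex x y))) \<le> G x"
    by (rule local_majorant[of x0]) (rule that)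
  define I where "I = {x0 - \<eta><..<x0 + \<eta>}"
  let ?\<rho> = "density lborel (\<lambda>x. indicator I x * G x)"
  have Im [measurable]: "I \<in> sets borel" by (simp add: I_def)
  have NI: "N \<inter> I \<in> sets borel" using N by auto
  have "emeasure ?\<rho> (N \<inter> I) = (INF U\<in>{U. N \<inter> I \<subseteq> U \<and> open U}. emeasure ?\<rho> U)"
    by (rule outer_regular[OF _ _ NI]) (use Gint in \<open>auto simp: emeasure_density I_def\<close>)
  moreover have "emeasure \<mu> (N \<inter> I) \<le> emeasure ?\<rho> U" if U: "N \<inter> I \<subseteq> U" "open U" for U
  proof -
    have "emeasure \<mu> (N \<inter> I) \<le> emeasure \<mu> (U \<inter> I)"
      by (rule emeasure_mono) (use U in auto)
    also have "\<dots> \<le> (\<integral>\<^sup>+x. indicator (U \<inter> I) x * G x \<partial>lborel)"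
    proof (rule open_measure_le)
      show "open (U \<inter> I)" using U by (auto simp: I_def)
      have "x0 + \<eta> \<notin> U \<inter> I" by (simp add: I_def)
      then show "U \<inter> I \<noteq> UNIV" by blast
    qed (use G in \<open>auto simp: I_def\<close>)
    also have "\<dots> = emeasure ?\<rho> U"
      using U(2) by (subst emeasure_density) (auto intro!: nn_integral_cong split: split_indicator)
    finally show ?thesis .
  qed
  ultimately have "emeasure \<mu> (N \<inter> I) \<le> emeasure ?\<rho> (N \<inter> I)"
    by (auto intro!: INF_greatest)
  also have "emeasure ?\<rho> (N \<inter> I) = 0"
  proof -
    have "AE x in lborel. x \<notin> N" using N by (intro AE_I[of _ _ N]) auto
    then show ?thesis using NI
      by (subst emeasure_density) (auto simp: nn_integral_0_iff_AE split: split_indicator elim!: eventually_mono)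
  qed
  finally have "emeasure \<mu> (N \<inter> I) = 0" by simp
  then show thesis using \<eta> by (intro that[of I]) (auto simp: I_def)
qed

text \<open>The interval and the exponent depend on the centre, so only local nullity is known;
  Lindelof reduces the cover of the line to a countable one.\<close>

lemma absolutely_continuous_lborel: "absolutely_continuous lborel \<mu>"
  unfolding absolutely_continuous_def
proof
  fix N :: "real set" assume "N \<in> null_sets lborel"
  then have N: "N \<in> sets borel" "emeasure lborel N = 0" by auto
  let ?F = "{I. open I \<and> emeasure \<mu> (N \<inter> I) = 0}"
  obtain F where F: "F \<subseteq> ?F" "countable F" "\<Union>F = \<Union>?F" by (rule Lindelof[of ?F]) auto
  have "x \<in> \<Union>?F" for x using local_null[OF N, of x] by auto
  then have "N = (\<Union>I\<in>F. N \<inter> I)" unfolding F(3)[symmetric] by blast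
  moreover have "(\<Union>I\<in>F. N \<inter> I) \<in> null_sets \<mu>"
    by (rule null_sets_UN'[OF F(2)]) (use F(1) N in \<open>auto intro!: null_setsI\<close>)
  ultimately show "N \<in> null_sets \<mu>" by simp
qed

end

section \<open>Spectral measures of Toeplitz operators\<close>

locale toeplitz_spectral = toeplitz_symbol +
  fixes E :: "real set \<Rightarrow> (complex \<Rightarrow> complex) \<Rightarrow> (complex \<Rightarrow> complex)"
  assumes spectral_measure: "is_spectral_measure circle hardy2 (toeplitz \<omega>) E"
begin

sublocale spectral_operator circle hardy2 E "toeplitz \<omega>" \<gamma>
proof
  show "projection_valued_measure circle hardy2 E"
    using spectral_measure by (simp add: is_spectral_measure_def)
qed (auto intro: hardy2_L2 hardy2_lincomb spectral_measure toeplitz_lincomb toeplitz_symmetric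
    toeplitz_bounded_below dest: toeplitz_hardy2)

text \<open>By \<open>toeplitz_szego\<close> the vector f = k_w / (F_lam conj(F_lam(w))) satisfies
  (T - lam) f = k_w. Its value at \<open>w\<close> is 1 / (|F_lam(w)|^2 (1 - |w|^2)), and the
  modulus is given by \<open>norm_outer\<close>.\<close>

lemma szego_transform:
  assumes w: "cmod w < 1" and lam: "lam < \<gamma>"
  shows "(\<integral>t. 1 / (t - lam) \<partial>\<mu> (szego w)) =
    1 / (1 - (cmod w)\<^sup>2) * exp (- (\<integral>\<zeta>. ln (\<omega> \<zeta> - lam) * poisson w \<zeta> \<partial>circle))"
proof -
  define c where "c = cnj (outer_fun \<omega> lam w)"
  have c: "c \<noteq> 0" by (simp add: c_def outer_fun_eq outer_nonzero)
  define \<phi> where "\<phi> = (\<lambda>\<zeta>. szego w \<zeta> * inv_outer lam \<zeta>)"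
  have T: "(\<phi>, \<lambda>\<zeta>. of_real lam * \<phi> \<zeta> + c * szego w \<zeta>) \<in> toeplitz \<omega>"
    unfolding \<phi>_def c_def by (rule toeplitz_szego[OF lam w])
  \<comment> \<open>Scaling is written as a two-term combination with a zero coefficient to fit
    \<open>toeplitz_lincomb\<close>.\<close>
  let ?f = "\<lambda>\<zeta>. 1 / c * \<phi> \<zeta> + 0 * \<phi> \<zeta>"
  let ?h = "\<lambda>\<zeta>. 1 / c * (of_real lam * \<phi> \<zeta> + c * szego w \<zeta>) + 0 * (of_real lam * \<phi> \<zeta> + c * szego w \<zeta>)"
  have fT: "(?f, ?h) \<in> toeplitz \<omega>" by (rule toeplitz_lincomb[OF T T])
  have \<phi>: "\<phi> \<in> hardy2" and fH: "?f \<in> hardy2" using toeplitz_hardy2[OF T] toeplitz_hardy2[OF fT] by auto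
  have k: "szego w = (\<lambda>\<zeta>. of_real 1 * ?h \<zeta> + of_real (- lam) * ?f \<zeta>)"
    using c by (simp add: fun_eq_iff field_simps)
  have "disk_ext ?f w = 1 / c * disk_ext \<phi> w"
    using disk_ext_lincomb[OF hardy2_integrable[OF \<phi>] hardy2_integrable[OF \<phi>] w, of "1 / c" 0] by simp
  also have "disk_ext \<phi> w = 1 / (outer_fun \<omega> lam w * (1 - (cmod w)\<^sup>2))"
    unfolding \<phi>_def by (rule disk_ext_szego_inv_outer[OF lam w])
  also have "1 / c * \<dots> = 1 / ((c * outer_fun \<omega> lam w) * (1 - (cmod w)\<^sup>2))" by (simp add: mult.assoc)
  also have "c * outer_fun \<omega> lam w = of_real ((cmod (outer_fun \<omega> lam w))\<^sup>2)"
    by (simp only: c_def complex_norm_square mult.commute)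
  also have "1 / (of_real ((cmod (outer_fun \<omega> lam w))\<^sup>2) * complex_of_real (1 - (cmod w)\<^sup>2)) =
      of_real (1 / ((cmod (outer_fun \<omega> lam w))\<^sup>2 * (1 - (cmod w)\<^sup>2)))" by simp
  finally have f: "disk_ext ?f w = of_real (1 / ((cmod (outer_fun \<omega> lam w))\<^sup>2 * (1 - (cmod w)\<^sup>2)))" .
  have "(\<integral>t. 1 / (t - lam) \<partial>\<mu> (szego w)) = Re (L2_inner circle (szego w) ?f)"
    by (rule resolvent_integral[OF fT lam k])
  also have "L2_inner circle (szego w) ?f = cnj (disk_ext ?f w)"
    by (subst L2_inner_cnj) (simp only: L2_inner_szego)
  also have "Re (cnj (disk_ext ?f w)) = 1 / ((cmod (outer_fun \<omega> lam w))\<^sup>2 * (1 - (cmod w)\<^sup>2))"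
    unfolding f by (simp only: complex_cnj_complex_of_real Re_complex_of_real)
  also have "(cmod (outer_fun \<omega> lam w))\<^sup>2 = exp (\<integral>\<zeta>. ln (\<omega> \<zeta> - lam) * poisson w \<zeta> \<partial>circle)"
    unfolding outer_fun_eq by (rule norm_outer[OF integrable_ln_symbol[OF lam] w])
  finally show ?thesis by (simp add: exp_minus field_simps)
qed

text \<open>The Poisson kernel is strictly positive on the circle, so the weighted measure has the
  same null sets as \<open>circle\<close>; the lower bound on omega and its non-constancy carry over
  to its law.\<close>

lemma szego_absolutely_continuous:
  assumes w: "cmod w < 1" and nonconst: "\<not> (\<exists>c. AE \<zeta> in circle. \<omega> \<zeta> = c)"
  shows "absolutely_continuous lborel (\<mu> (szego w))"
proof -
  let ?D = "density circle (\<lambda>\<zeta>. ennreal (poisson w \<zeta>))"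
  let ?\<nu> = "distr ?D borel \<omega>"
  have pos: "0 \<le> poisson w \<zeta>" for \<zeta> by (rule poisson_nonneg[OF w])
  have m [measurable]: "\<omega> \<in> borel_measurable ?D" by simp
  have int\<nu>: "(\<integral>s. F s \<partial>?\<nu>) = (\<integral>\<zeta>. poisson w \<zeta> * F (\<omega> \<zeta>) \<partial>circle)"
    if [measurable]: "F \<in> borel_measurable borel" for F :: "real \<Rightarrow> real"
    by (simp add: integral_distr[OF m] integral_density pos)
  have AE\<nu>: "(AE s in ?\<nu>. P s) \<longleftrightarrow> (AE \<zeta> in circle. P (\<omega> \<zeta>))" if [measurable]: "Measurable.pred borel P" for P
  proof -
    have "(AE s in ?\<nu>. P s) \<longleftrightarrow> (AE \<zeta> in circle. 0 < poisson w \<zeta> \<longrightarrow> P (\<omega> \<zeta>))"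
      by (subst AE_distr_iff[OF m], measurable, subst AE_density, measurable)
    also have "\<dots> \<longleftrightarrow> (AE \<zeta> in circle. P (\<omega> \<zeta>))"
      by (rule AE_cong) (simp add: poisson_pos[OF w] norm_circle)
    finally show ?thesis .
  qed
  interpret stieltjes_exp "\<mu> (szego w)" ?\<nu> \<gamma> "1 / (1 - (cmod w)\<^sup>2)"
  proof (rule stieltjes_exp.intro)
    have "emeasure ?D (space ?D) = (\<integral>\<^sup>+\<zeta>. ennreal (poisson w \<zeta>) \<partial>circle)"
      by (subst emeasure_density) (auto intro!: nn_integral_cong)
    also have "\<dots> = ennreal (\<integral>\<zeta>. poisson w \<zeta> \<partial>circle)"
      by (rule nn_integral_eq_integral[OF integrable_poisson_real[OF w]]) (simp add: pos)
    finally have "prob_space ?D" using integral_poisson[OF w] by (intro prob_spaceI) simp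
    then show "prob_space ?\<nu>" by (rule prob_space.prob_space_distr) (rule m)
    show "finite_measure (\<mu> (szego w))" by (rule finite_\<mu>[OF szego_hardy2[OF w]])
    show "AE t in \<mu> (szego w). \<gamma> \<le> t" by (rule AE_ge[OF szego_hardy2[OF w]])
    show "AE s in ?\<nu>. \<gamma> \<le> s" using symbol_ge by (subst AE\<nu>) auto
    show "integrable ?\<nu> (\<lambda>s. s)"
    proof -
      have "integrable circle (\<lambda>\<zeta>. complex_of_real (\<omega> \<zeta> * poisson w \<zeta>))"
        using integrable_poisson[of "\<lambda>\<zeta>. of_real (\<omega> \<zeta>)" w] integrable_symbol w by simp
      then have "integrable circle (\<lambda>\<zeta>. poisson w \<zeta> * \<omega> \<zeta>)"
        by (simp only: complex_of_real_integrable_eq mult.commute)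
      then show ?thesis by (simp add: integrable_distr_eq[OF m] integrable_density pos)
    qed
    show "\<not> (AE s in ?\<nu>. s = c)" for c using nonconst by (subst AE\<nu>) auto
    show "0 < 1 / (1 - (cmod w)\<^sup>2)" using w by (simp add: abs_square_less_1)
    show "(\<integral>t. 1 / (t - x) \<partial>\<mu> (szego w)) = 1 / (1 - (cmod w)\<^sup>2) * exp (- (\<integral>s. ln (s - x) \<partial>?\<nu>))" if "x < \<gamma>" for x
      by (subst int\<nu>) (simp_all add: szego_transform[OF w that] mult.commute)
  qed simp_all
  show ?thesis by (rule absolutely_continuous_lborel)
qed

text \<open>The functions \<open>szego w\<close> are total in \<^const>\<open>hardy2\<close>, and a projection of the spectral measure
  that annihilates all of them vanishes.\<close>

lemma scalar_absolutely_continuous: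
  assumes nonconst: "\<not> (\<exists>c. AE \<zeta> in circle. \<omega> \<zeta> = c)" and f: "f \<in> hardy2"
  shows "absolutely_continuous lborel (\<mu> f)"
  unfolding absolutely_continuous_def
proof
  fix N :: "real set" assume "N \<in> null_sets lborel"
  then have N: "N \<in> sets borel" and null: "N \<in> null_sets lborel" by auto
  note e = E_in[OF N f]
  \<comment> \<open>The value at \<open>w\<close> is (E(N) f, k_w) = (f, E(N) k_w), and E(N) k_w
    vanishes because its squared norm is the mass of \<open>N\<close>.\<close>
  have "disk_ext (E N f) w = 0" if w: "cmod w < 1" for w
  proof -
    note k = szego_hardy2[OF w]
    have "N \<in> null_sets (\<mu> (szego w))"
      using szego_absolutely_continuous[OF w nonconst] null by (auto simp: absolutely_continuous_def)
    then have "m (szego w) N = 0"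
      using emeasure_\<mu>[OF k N] m_nonneg[OF N k] by (simp add: null_sets_def ennreal_eq_0_iff)
    then have "AE \<zeta> in circle. E N (szego w) \<zeta> = 0"
      using integral_nonneg_eq_0_iff_AE[OF L2_square[OF hardy2_L2[OF E_in[OF N k]]]]
      by (simp add: m_eq[OF N k])
    then have "L2_inner circle f (E N (szego w)) = 0"
      unfolding L2_inner_def by (intro integral_eq_zero_AE) auto
    then show ?thesis
      using form_sym[OF N f k] by (simp add: form_def L2_inner_szego)
  qed
  then have "AE \<zeta> in circle. E N f \<zeta> = 0"
    by (intro hardy_AE_zero hardy2_integrable hardy2_moment e)
  then have "m f N = 0" unfolding m_eq[OF N f] by (intro integral_eq_zero_AE) auto
  then show "N \<in> null_sets (\<mu> f)"
    using emeasure_\<mu>[OF f N] N by (auto intro!: null_setsI)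
qed

end

theorem theorem3p5:
  fixes \<omega> :: "complex \<Rightarrow> real"
    and E :: "real set \<Rightarrow> (complex \<Rightarrow> complex) \<Rightarrow> (complex \<Rightarrow> complex)"
  assumes "integrable circle \<omega>"
    and "ess_inf circle \<omega> > -\<infinity>"
    and "\<not> (\<exists>c. AE \<zeta> in circle. \<omega> \<zeta> = c)"
    and "is_spectral_measure circle hardy2 (toeplitz \<omega>) E"
  shows "\<forall>f\<in>hardy2. absolutely_continuous lborel (scalar_spectral_measure circle E f)"
proof -
  \<comment> \<open>Infinity would force omega, which takes real values, to be infinite almost
    everywhere on a probability space.\<close>
  have "ess_inf circle \<omega> \<noteq> \<infinity>"
  proof
    assume "ess_inf circle \<omega> = \<infinity>"
    then have "esssup circle (\<lambda>x. - ereal (\<omega> x)) = - \<infinity>"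
      unfolding ess_inf_def by (simp add: ereal_uminus_eq_reorder)
    with esssup_AE[of "\<lambda>x. - ereal (\<omega> x)" circle] have "AE \<zeta> in circle. False" by simp
    then show False using circle.AE_False by simp
  qed
  then obtain \<gamma> where \<gamma>: "ess_inf circle \<omega> = ereal \<gamma>"
    using assms(2) by (cases "ess_inf circle \<omega>") auto
  interpret toeplitz_spectral \<omega> \<gamma> E
    by unfold_locales (use assms \<gamma> in auto)
  show ?thesis using scalar_absolutely_continuous[OF assms(3)] by blast
qed

end
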